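(* Let $\mathcal B$ be a Krull–Schmidt exact category with enough projectives and enough injectives, and let $(\mathcal S,\mathcal T),(\mathcal U,\mathcal V)$ be a twin cotorsion pair on $\mathcal B$. Let $\mathcal P$ and $\mathcal I$ be the full subcategories of projective and of injective objects of $\mathcal B$. Suppose that either ($\mathcal U\subseteq\mathcal S*\mathcal T$ and $\mathcal P\subseteq\mathcal W$) or ($\mathcal T\subseteq\mathcal U*\mathcal V$ and $\mathcal I\subseteq\mathcal W$). Then the heart $\underline{\mathcal H}=\mathcal H/\mathcal W$ is integral.
   Context: Exact category is meant in the sense of Quillen (the class of short exact sequences is closed under isomorphisms, direct sums and direct summands); $X\rightarrowtail Y\twoheadrightarrow Z$ denotes a short exact sequence of the exact structure. For subcategories $\mathcal C,\mathcal D$, $\mathrm{Ext}^1_{\mathcal B}(\mathcal C,\mathcal D)=0$ means $\mathrm{Ext}^1_{\mathcal B}(C,D)=0$ for all $C\in\mathcal C$, $D\in\mathcal D$. Cotorsion pair: a pair $(\mathcal U,\mathcal V)$ of full additive subcategories of $\mathcal B$, closed under direct summands, such that $\mathrm{Ext}^1_{\mathcal B}(\mathcal U,\mathcal V)=0$ and every $B\in\mathcal B$ admits short exact sequences $V_B\rightarrowtail U_B\twoheadrightarrow B$ and $B\rightarrowtail V^B\twoheadrightarrow U^B$ with $U_B,U^B\in\mathcal U$, $V_B,V^B\in\mathcal V$. Twin cotorsion pair: a pair of cotorsion pairs $(\mathcal S,\mathcal T),(\mathcal U,\mathcal V)$ with $\mathcal S\subseteq\mathcal U$. For a twin cotorsion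 pair put $\mathcal W=\mathcal T\cap\mathcal U$. $\mathcal B^+$ is the full subcategory of objects $B$ admitting a short exact sequence $V_B\rightarrowtail U_B\twoheadrightarrow B$ with $U_B\in\mathcal W$, $V_B\in\mathcal V$. $\mathcal B^-$ is the full subcategory of objects $B$ admitting a short exact sequence $B\rightarrowtail T^B\twoheadrightarrow S^B$ with $T^B\in\mathcal W$, $S^B\in\mathcal S$. Put $\mathcal H=\mathcal B^+\cap\mathcal B^-\supseteq\mathcal W$. The heart is the additive quotient category $\underline{\mathcal H}=\mathcal H/\mathcal W$ (morphisms modulo those factoring through an object of $\mathcal W$). For subcategories $\mathcal B_1,\mathcal B_2$ of $\mathcal B$, $\mathcal B_1*\mathcal B_2$ is the subcategory of objects $X$ admitting a short exact sequence $B_1\rightarrowtail X\twoheadrightarrow B_2$ with $B_1\in\mathcal B_1$, $B_2\in\mathcal B_2$. Preabelian: additive with all kernels and cokernels. A preabelian category is left integral if in every pull-back square with $\alpha:A\to B$, $\beta:A\to C$, $\gamma:B\to D$, $\delta:C\to D$, $\gamma\alpha=\delta\beta$, the morphism $\alpha$ is an epimorphism whenever $\delta$ is an epimorphism. Right integral is defined dually; integral means both left and right integral. *)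

theory Defs
  imports "HOL-Algebra.Ring"
begin

section \<open>Preadditive and additive categories\<close>

text \<open>
  A category whose hom-sets carry an addition. Every arrow determines its domain and codomain;
  \<open>g \<cdot> f\<close> is the composite "first \<open>f\<close>, then \<open>g\<close>". Values of the operations outside the
  carrier sets are irrelevant.
\<close>

record ('o, 'm) addcat =
  Obj :: "'o set"
  Arr :: "'m set"
  Dom :: "'m \<Rightarrow> 'o"
  Cod :: "'m \<Rightarrow> 'o"
  Ident :: "'o \<Rightarrow> 'm"
  Comp :: "'m \<Rightarrow> 'm \<Rightarrow> 'm"  (infixr "\<cdot>\<index>" 75)
  Plus :: "'m \<Rightarrow> 'm \<Rightarrow> 'm"  (infixl "\<boxplus>\<index>" 65)
  Zer :: "'o \<Rightarrow> 'o \<Rightarrow> 'm"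

definition homs :: "('o, 'm) addcat \<Rightarrow> 'o \<Rightarrow> 'o \<Rightarrow> 'm set"
  where "homs C A B = {f \<in> Arr C. Dom C f = A \<and> Cod C f = B}"

definition hom_group :: "('o, 'm) addcat \<Rightarrow> 'o \<Rightarrow> 'o \<Rightarrow> 'm monoid"
  where "hom_group C A B = \<lparr>carrier = homs C A B, monoid.mult = Plus C, one = Zer C A B\<rparr>"

definition End_ring :: "('o, 'm) addcat \<Rightarrow> 'o \<Rightarrow> 'm ring"
  where "End_ring C A =
    \<lparr>carrier = homs C A A, monoid.mult = Comp C, one = Ident C A,
     ring.zero = Zer C A A, add = Plus C\<rparr>"

locale preadditive_category =
  fixes C :: "('o, 'm) addcat" (structure)
  assumes Dom_closed: "f \<in> Arr C \<Longrightarrow> Dom C f \<in> Obj C"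
    and Cod_closed: "f \<in> Arr C \<Longrightarrow> Cod C f \<in> Obj C"
    and Ident_closed: "A \<in> Obj C \<Longrightarrow> Ident C A \<in> homs C A A"
    and Comp_closed: "\<lbrakk>f \<in> homs C X Y; g \<in> homs C Y Z\<rbrakk> \<Longrightarrow> g \<cdot> f \<in> homs C X Z"
    and Comp_assoc: "\<lbrakk>f \<in> homs C X Y; g \<in> homs C Y Z; h \<in> homs C Z W\<rbrakk>
      \<Longrightarrow> (h \<cdot> g) \<cdot> f = h \<cdot> (g \<cdot> f)"
    and Ident_left: "f \<in> homs C X Y \<Longrightarrow> Ident C Y \<cdot> f = f"
    and Ident_right: "f \<in> homs C X Y \<Longrightarrow> f \<cdot> Ident C X = f"
    and hom_comm_group: "\<lbrakk>A \<in> Obj C; B \<in> Obj C\<rbrakk> \<Longrightarrow> comm_group (hom_group C A B)"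
    and Comp_Plus_left: "\<lbrakk>f \<in> homs C X Y; g \<in> homs C Y Z; g' \<in> homs C Y Z\<rbrakk>
      \<Longrightarrow> (g \<boxplus> g') \<cdot> f = (g \<cdot> f) \<boxplus> (g' \<cdot> f)"
    and Comp_Plus_right: "\<lbrakk>f \<in> homs C X Y; f' \<in> homs C X Y; g \<in> homs C Y Z\<rbrakk>
      \<Longrightarrow> g \<cdot> (f \<boxplus> f') = (g \<cdot> f) \<boxplus> (g \<cdot> f')"

definition is_zero_object :: "('o, 'm) addcat \<Rightarrow> 'o \<Rightarrow> bool"
  where "is_zero_object C Z \<longleftrightarrow> Z \<in> Obj C \<and>
    (\<forall>A \<in> Obj C. (\<exists>!f. f \<in> homs C A Z) \<and> (\<exists>!f. f \<in> homs C Z A))"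

definition is_biproduct ::
    "('o, 'm) addcat \<Rightarrow> 'o \<Rightarrow> 'o \<Rightarrow> 'o \<Rightarrow> 'm \<Rightarrow> 'm \<Rightarrow> 'm \<Rightarrow> 'm \<Rightarrow> bool"
  where "is_biproduct C A B X i1 i2 p1 p2 \<longleftrightarrow>
    A \<in> Obj C \<and> B \<in> Obj C \<and> X \<in> Obj C \<and>
    i1 \<in> homs C A X \<and> i2 \<in> homs C B X \<and> p1 \<in> homs C X A \<and> p2 \<in> homs C X B \<and>
    p1 \<cdot>\<^bsub>C\<^esub> i1 = Ident C A \<and> p2 \<cdot>\<^bsub>C\<^esub> i2 = Ident C B \<and>
    p2 \<cdot>\<^bsub>C\<^esub> i1 = Zer C A B \<and> p1 \<cdot>\<^bsub>C\<^esub> i2 = Zer C B A \<and>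
    (i1 \<cdot>\<^bsub>C\<^esub> p1) \<boxplus>\<^bsub>C\<^esub> (i2 \<cdot>\<^bsub>C\<^esub> p2) = Ident C X"

locale additive_category = preadditive_category +
  assumes ex_zero_object: "\<exists>Z. is_zero_object C Z"
    and ex_biproduct: "\<lbrakk>A \<in> Obj C; B \<in> Obj C\<rbrakk>
      \<Longrightarrow> \<exists>X i1 i2 p1 p2. is_biproduct C A B X i1 i2 p1 p2"

definition is_direct_summand :: "('o, 'm) addcat \<Rightarrow> 'o \<Rightarrow> 'o \<Rightarrow> bool"
  where "is_direct_summand C A X \<longleftrightarrow> (\<exists>B i1 i2 p1 p2. is_biproduct C A B X i1 i2 p1 p2)"

definition is_iso :: "('o, 'm) addcat \<Rightarrow> 'm \<Rightarrow> bool"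
  where "is_iso C f \<longleftrightarrow> f \<in> Arr C \<and>
    (\<exists>g \<in> homs C (Cod C f) (Dom C f).
       g \<cdot>\<^bsub>C\<^esub> f = Ident C (Dom C f) \<and> f \<cdot>\<^bsub>C\<^esub> g = Ident C (Cod C f))"

definition is_mono :: "('o, 'm) addcat \<Rightarrow> 'm \<Rightarrow> bool"
  where "is_mono C f \<longleftrightarrow> f \<in> Arr C \<and>
    (\<forall>X. \<forall>g \<in> homs C X (Dom C f). \<forall>h \<in> homs C X (Dom C f).
       f \<cdot>\<^bsub>C\<^esub> g = f \<cdot>\<^bsub>C\<^esub> h \<longrightarrow> g = h)"

definition is_epi :: "('o, 'm) addcat \<Rightarrow> 'm \<Rightarrow> bool"
  where "is_epi C f \<longleftrightarrow> f \<in> Arr C \<and>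
    (\<forall>X. \<forall>g \<in> homs C (Cod C f) X. \<forall>h \<in> homs C (Cod C f) X.
       g \<cdot>\<^bsub>C\<^esub> f = h \<cdot>\<^bsub>C\<^esub> f \<longrightarrow> g = h)"

text \<open>\<open>is_kernel C k f\<close>: the arrow \<open>k\<close> is a kernel of \<open>f\<close>;
  \<open>is_cokernel C c f\<close>: the arrow \<open>c\<close> is a cokernel of \<open>f\<close>.\<close>

definition is_kernel :: "('o, 'm) addcat \<Rightarrow> 'm \<Rightarrow> 'm \<Rightarrow> bool"
  where "is_kernel C k f \<longleftrightarrow> k \<in> Arr C \<and> f \<in> Arr C \<and> Cod C k = Dom C f \<and>
    f \<cdot>\<^bsub>C\<^esub> k = Zer C (Dom C k) (Cod C f) \<and>
    (\<forall>X. \<forall>h \<in> homs C X (Dom C f). f \<cdot>\<^bsub>C\<^esub> h = Zer C X (Cod C f) \<longrightarrow>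
       (\<exists>!u. u \<in> homs C X (Dom C k) \<and> k \<cdot>\<^bsub>C\<^esub> u = h))"

definition is_cokernel :: "('o, 'm) addcat \<Rightarrow> 'm \<Rightarrow> 'm \<Rightarrow> bool"
  where "is_cokernel C c f \<longleftrightarrow> c \<in> Arr C \<and> f \<in> Arr C \<and> Dom C c = Cod C f \<and>
    c \<cdot>\<^bsub>C\<^esub> f = Zer C (Dom C f) (Cod C c) \<and>
    (\<forall>X. \<forall>h \<in> homs C (Cod C f) X. h \<cdot>\<^bsub>C\<^esub> f = Zer C (Dom C f) X \<longrightarrow>
       (\<exists>!u. u \<in> homs C (Cod C c) X \<and> u \<cdot>\<^bsub>C\<^esub> c = h))"

text \<open>
  Squares are written with \<open>\<alpha> : A \<rightarrow> B\<close>, \<open>\<beta> : A \<rightarrow> C\<close>, \<open>\<gamma> : B \<rightarrow> D\<close>, \<open>\<delta> : C \<rightarrow> D\<close>, in this order.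
\<close>

definition is_comm_square :: "('o, 'm) addcat \<Rightarrow> 'm \<Rightarrow> 'm \<Rightarrow> 'm \<Rightarrow> 'm \<Rightarrow> bool"
  where "is_comm_square C \<alpha> \<beta> \<gamma> \<delta> \<longleftrightarrow>
    \<alpha> \<in> Arr C \<and> \<beta> \<in> Arr C \<and> \<gamma> \<in> Arr C \<and> \<delta> \<in> Arr C \<and>
    Dom C \<alpha> = Dom C \<beta> \<and> Cod C \<alpha> = Dom C \<gamma> \<and> Cod C \<beta> = Dom C \<delta> \<and> Cod C \<gamma> = Cod C \<delta> \<and>
    \<gamma> \<cdot>\<^bsub>C\<^esub> \<alpha> = \<delta> \<cdot>\<^bsub>C\<^esub> \<beta>"

definition is_pullback :: "('o, 'm) addcat \<Rightarrow> 'm \<Rightarrow> 'm \<Rightarrow> 'm \<Rightarrow> 'm \<Rightarrow> bool"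
  where "is_pullback C \<alpha> \<beta> \<gamma> \<delta> \<longleftrightarrow> is_comm_square C \<alpha> \<beta> \<gamma> \<delta> \<and>
    (\<forall>X. \<forall>x \<in> homs C X (Dom C \<gamma>). \<forall>y \<in> homs C X (Dom C \<delta>).
       \<gamma> \<cdot>\<^bsub>C\<^esub> x = \<delta> \<cdot>\<^bsub>C\<^esub> y \<longrightarrow>
       (\<exists>!u. u \<in> homs C X (Dom C \<alpha>) \<and> \<alpha> \<cdot>\<^bsub>C\<^esub> u = x \<and> \<beta> \<cdot>\<^bsub>C\<^esub> u = y))"

definition is_pushout :: "('o, 'm) addcat \<Rightarrow> 'm \<Rightarrow> 'm \<Rightarrow> 'm \<Rightarrow> 'm \<Rightarrow> bool"
  where "is_pushout C \<alpha> \<beta> \<gamma> \<delta> \<longleftrightarrow> is_comm_square C \<alpha> \<beta> \<gamma> \<delta> \<and>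
    (\<forall>X. \<forall>x \<in> homs C (Cod C \<alpha>) X. \<forall>y \<in> homs C (Cod C \<beta>) X.
       x \<cdot>\<^bsub>C\<^esub> \<alpha> = y \<cdot>\<^bsub>C\<^esub> \<beta> \<longrightarrow>
       (\<exists>!u. u \<in> homs C (Cod C \<gamma>) X \<and> u \<cdot>\<^bsub>C\<^esub> \<gamma> = x \<and> u \<cdot>\<^bsub>C\<^esub> \<delta> = y))"

section \<open>Integral categories\<close>

definition preabelian :: "('o, 'm) addcat \<Rightarrow> bool"
  where "preabelian C \<longleftrightarrow> additive_category C \<and>
    (\<forall>f \<in> Arr C. (\<exists>k. is_kernel C k f) \<and> (\<exists>c. is_cokernel C c f))"

definition left_integral :: "('o, 'm) addcat \<Rightarrow> bool"
  where "left_integral C \<longleftrightarrow> preabelian C \<and>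
    (\<forall>\<alpha> \<beta> \<gamma> \<delta>. is_pullback C \<alpha> \<beta> \<gamma> \<delta> \<and> is_epi C \<delta> \<longrightarrow> is_epi C \<alpha>)"

definition right_integral :: "('o, 'm) addcat \<Rightarrow> bool"
  where "right_integral C \<longleftrightarrow> preabelian C \<and>
    (\<forall>\<alpha> \<beta> \<gamma> \<delta>. is_pushout C \<alpha> \<beta> \<gamma> \<delta> \<and> is_mono C \<alpha> \<longrightarrow> is_mono C \<delta>)"

definition integral :: "('o, 'm) addcat \<Rightarrow> bool"
  where "integral C \<longleftrightarrow> left_integral C \<and> right_integral C"

section \<open>Krull--Schmidt categories\<close>

definition is_finite_direct_sum ::
    "('o, 'm) addcat \<Rightarrow> nat \<Rightarrow> (nat \<Rightarrow> 'o) \<Rightarrow> 'o \<Rightarrow> (nat \<Rightarrow> 'm) \<Rightarrow> (nat \<Rightarrow> 'm) \<Rightarrow> bool"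
  where "is_finite_direct_sum C n A X i p \<longleftrightarrow> X \<in> Obj C \<and>
    (\<forall>k < n. A k \<in> Obj C \<and> i k \<in> homs C (A k) X \<and> p k \<in> homs C X (A k)) \<and>
    (\<forall>k < n. \<forall>l < n. p l \<cdot>\<^bsub>C\<^esub> i k = (if k = l then Ident C (A k) else Zer C (A k) (A l))) \<and>
    finprod (hom_group C X X) (\<lambda>k. i k \<cdot>\<^bsub>C\<^esub> p k) {..<n} = Ident C X"

text \<open>Local rings need not be commutative: the non-units are closed under addition.\<close>

definition local_ring :: "('a, 'b) ring_scheme \<Rightarrow> bool"
  where "local_ring R \<longleftrightarrow> ring R \<and> \<one>\<^bsub>R\<^esub> \<noteq> \<zero>\<^bsub>R\<^esub> \<and>
    (\<forall>a \<in> carrier R - Units R. \<forall>b \<in> carrier R - Units R. a \<oplus>\<^bsub>R\<^esub> b \<notin> Units R)"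

definition krull_schmidt :: "('o, 'm) addcat \<Rightarrow> bool"
  where "krull_schmidt C \<longleftrightarrow> additive_category C \<and>
    (\<forall>X \<in> Obj C. \<exists>n A i p. is_finite_direct_sum C n A X i p \<and>
       (\<forall>k < n. local_ring (End_ring C (A k))))"

section \<open>Exact categories\<close>

text \<open>
  An exact structure is a set \<open>E\<close> of pairs \<open>(i, p)\<close>, the short exact sequences
  \<open>X \<rightarrowtail> Y \<twoheadrightarrow> Z\<close> with \<open>i : X \<rightarrow> Y\<close> and \<open>p : Y \<rightarrow> Z\<close>.
\<close>

definition is_composable :: "('o, 'm) addcat \<Rightarrow> 'm \<Rightarrow> 'm \<Rightarrow> bool"
  where "is_composable C f g \<longleftrightarrow> f \<in> Arr C \<and> g \<in> Arr C \<and> Cod C f = Dom C g"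

definition seq_iso :: "('o, 'm) addcat \<Rightarrow> 'm \<times> 'm \<Rightarrow> 'm \<times> 'm \<Rightarrow> bool"
  where "seq_iso C s s' \<longleftrightarrow> (case (s, s') of ((f, g), (f', g')) \<Rightarrow>
    is_composable C f g \<and> is_composable C f' g' \<and>
    (\<exists>a b c. is_iso C a \<and> is_iso C b \<and> is_iso C c \<and>
       a \<in> homs C (Dom C f) (Dom C f') \<and> b \<in> homs C (Cod C f) (Cod C f') \<and>
       c \<in> homs C (Cod C g) (Cod C g') \<and>
       b \<cdot>\<^bsub>C\<^esub> f = f' \<cdot>\<^bsub>C\<^esub> a \<and> c \<cdot>\<^bsub>C\<^esub> g = g' \<cdot>\<^bsub>C\<^esub> b))"

text \<open>
  \<open>seq_direct_sum C s1 s2 s\<close>: the sequence \<open>s\<close> is the direct sum of \<open>s1\<close> and \<open>s2\<close>. Compatibility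
  with the injections already forces compatibility with the projections.
\<close>

definition seq_direct_sum :: "('o, 'm) addcat \<Rightarrow> 'm \<times> 'm \<Rightarrow> 'm \<times> 'm \<Rightarrow> 'm \<times> 'm \<Rightarrow> bool"
  where "seq_direct_sum C s1 s2 s \<longleftrightarrow>
    (case (s1, s2, s) of ((f1, g1), (f2, g2), (f, g)) \<Rightarrow>
    is_composable C f1 g1 \<and> is_composable C f2 g2 \<and> is_composable C f g \<and>
    (\<exists>a1 a2 pa1 pa2 b1 b2 pb1 pb2 c1 c2 pc1 pc2.
       is_biproduct C (Dom C f1) (Dom C f2) (Dom C f) a1 a2 pa1 pa2 \<and>
       is_biproduct C (Cod C f1) (Cod C f2) (Cod C f) b1 b2 pb1 pb2 \<and>
       is_biproduct C (Cod C g1) (Cod C g2) (Cod C g) c1 c2 pc1 pc2 \<and>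
       f \<cdot>\<^bsub>C\<^esub> a1 = b1 \<cdot>\<^bsub>C\<^esub> f1 \<and> f \<cdot>\<^bsub>C\<^esub> a2 = b2 \<cdot>\<^bsub>C\<^esub> f2 \<and>
       g \<cdot>\<^bsub>C\<^esub> b1 = c1 \<cdot>\<^bsub>C\<^esub> g1 \<and> g \<cdot>\<^bsub>C\<^esub> b2 = c2 \<cdot>\<^bsub>C\<^esub> g2))"

definition admissible_mono :: "('m \<times> 'm) set \<Rightarrow> 'm \<Rightarrow> bool"
  where "admissible_mono E i \<longleftrightarrow> (\<exists>p. (i, p) \<in> E)"

definition admissible_epi :: "('m \<times> 'm) set \<Rightarrow> 'm \<Rightarrow> bool"
  where "admissible_epi E p \<longleftrightarrow> (\<exists>i. (i, p) \<in> E)"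

text \<open>
  Quillen's axioms, without his axiom on maps having a kernel (cokernel), which Keller showed to
  be redundant.
\<close>

locale exact_category = additive_category +
  fixes E :: "('m \<times> 'm) set"
  assumes kernel_cokernel_pair: "(i, p) \<in> E \<Longrightarrow> is_kernel C i p \<and> is_cokernel C p i"
    and iso_closed: "\<lbrakk>s \<in> E; seq_iso C s s'\<rbrakk> \<Longrightarrow> s' \<in> E"
    and direct_sum_closed: "\<lbrakk>s1 \<in> E; s2 \<in> E; seq_direct_sum C s1 s2 s\<rbrakk> \<Longrightarrow> s \<in> E"
    and direct_summand_closed: "\<lbrakk>s \<in> E; seq_direct_sum C s1 s2 s\<rbrakk> \<Longrightarrow> s1 \<in> E"
    and split_exact: "is_biproduct C A B X i1 i2 p1 p2 \<Longrightarrow> (i1, p2) \<in> E"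
    and admissible_mono_Comp: "\<lbrakk>admissible_mono E i; admissible_mono E j; Cod C i = Dom C j\<rbrakk>
      \<Longrightarrow> admissible_mono E (j \<cdot> i)"
    and admissible_epi_Comp: "\<lbrakk>admissible_epi E p; admissible_epi E q; Cod C p = Dom C q\<rbrakk>
      \<Longrightarrow> admissible_epi E (q \<cdot> p)"
    and admissible_mono_pushout: "\<lbrakk>admissible_mono E i; f \<in> Arr C; Dom C f = Dom C i\<rbrakk>
      \<Longrightarrow> \<exists>f' i'. is_pushout C i f f' i' \<and> admissible_mono E i'"
    and admissible_epi_pullback: "\<lbrakk>admissible_epi E p; f \<in> Arr C; Cod C f = Cod C p\<rbrakk>
      \<Longrightarrow> \<exists>p' f'. is_pullback C p' f' f p \<and> admissible_epi E p'"

definition ses :: "('o, 'm) addcat \<Rightarrow> ('m \<times> 'm) set \<Rightarrow> 'o \<Rightarrow> 'o \<Rightarrow> 'o \<Rightarrow> ('m \<times> 'm) set"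
  where "ses C E X Y Z = {(i, p) \<in> E. i \<in> homs C X Y \<and> p \<in> homs C Y Z}"

definition projectives :: "('o, 'm) addcat \<Rightarrow> ('m \<times> 'm) set \<Rightarrow> 'o set"
  where "projectives C E = {P \<in> Obj C. \<forall>p. admissible_epi E p \<longrightarrow>
    (\<forall>f \<in> homs C P (Cod C p). \<exists>g \<in> homs C P (Dom C p). p \<cdot>\<^bsub>C\<^esub> g = f)}"

definition injectives :: "('o, 'm) addcat \<Rightarrow> ('m \<times> 'm) set \<Rightarrow> 'o set"
  where "injectives C E = {I \<in> Obj C. \<forall>i. admissible_mono E i \<longrightarrow>
    (\<forall>f \<in> homs C (Dom C i) I. \<exists>g \<in> homs C (Cod C i) I. g \<cdot>\<^bsub>C\<^esub> i = f)}"

definition enough_projectives :: "('o, 'm) addcat \<Rightarrow> ('m \<times> 'm) set \<Rightarrow> bool"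
  where "enough_projectives C E \<longleftrightarrow>
    (\<forall>X \<in> Obj C. \<exists>K. \<exists>P \<in> projectives C E. ses C E K P X \<noteq> {})"

definition enough_injectives :: "('o, 'm) addcat \<Rightarrow> ('m \<times> 'm) set \<Rightarrow> bool"
  where "enough_injectives C E \<longleftrightarrow>
    (\<forall>X \<in> Obj C. \<exists>I \<in> injectives C E. \<exists>L. ses C E X I L \<noteq> {})"

text \<open>
  \<open>Ext1 C E A B\<close> is the set underlying Yoneda's \<open>Ext\<^sup>1(A, B)\<close>: extensions \<open>B \<rightarrowtail> X \<twoheadrightarrow> A\<close> modulo
  isomorphisms that are the identity on both ends. It is never empty (split extension), and the
  group with Baer sum is zero iff the set is a singleton.
\<close>

definition extensions :: "('o, 'm) addcat \<Rightarrow> ('m \<times> 'm) set \<Rightarrow> 'o \<Rightarrow> 'o \<Rightarrow> ('m \<times> 'm) set"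
  where "extensions C E A B = (\<Union>X \<in> Obj C. ses C E B X A)"

definition ext_equiv ::
    "('o, 'm) addcat \<Rightarrow> ('m \<times> 'm) set \<Rightarrow> 'o \<Rightarrow> 'o \<Rightarrow> (('m \<times> 'm) \<times> ('m \<times> 'm)) set"
  where "ext_equiv C E A B = {((i, p), (i', p')).
    (i, p) \<in> extensions C E A B \<and> (i', p') \<in> extensions C E A B \<and>
    (\<exists>h \<in> homs C (Cod C i) (Cod C i'). is_iso C h \<and> h \<cdot>\<^bsub>C\<^esub> i = i' \<and> p' \<cdot>\<^bsub>C\<^esub> h = p)}"

definition Ext1 :: "('o, 'm) addcat \<Rightarrow> ('m \<times> 'm) set \<Rightarrow> 'o \<Rightarrow> 'o \<Rightarrow> ('m \<times> 'm) set set"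
  where "Ext1 C E A B = extensions C E A B // ext_equiv C E A B"

definition Ext1_zero :: "('o, 'm) addcat \<Rightarrow> ('m \<times> 'm) set \<Rightarrow> 'o set \<Rightarrow> 'o set \<Rightarrow> bool"
  where "Ext1_zero C E \<U> \<V> \<longleftrightarrow> (\<forall>A \<in> \<U>. \<forall>B \<in> \<V>. is_singleton (Ext1 C E A B))"

section \<open>Twin cotorsion pairs and their hearts\<close>

text \<open>Full subcategories are given by their sets of objects.\<close>

definition full_subcat :: "('o, 'm) addcat \<Rightarrow> 'o set \<Rightarrow> ('o, 'm) addcat"
  where "full_subcat C D =
    C\<lparr>Obj := D, Arr := {f \<in> Arr C. Dom C f \<in> D \<and> Cod C f \<in> D}\<rparr>"

definition full_additive_subcat :: "('o, 'm) addcat \<Rightarrow> 'o set \<Rightarrow> bool"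
  where "full_additive_subcat C D \<longleftrightarrow> D \<subseteq> Obj C \<and> additive_category (full_subcat C D)"

definition summand_closed :: "('o, 'm) addcat \<Rightarrow> 'o set \<Rightarrow> bool"
  where "summand_closed C D \<longleftrightarrow> (\<forall>X \<in> D. \<forall>A. is_direct_summand C A X \<longrightarrow> A \<in> D)"

definition cotorsion_pair ::
    "('o, 'm) addcat \<Rightarrow> ('m \<times> 'm) set \<Rightarrow> 'o set \<Rightarrow> 'o set \<Rightarrow> bool"
  where "cotorsion_pair C E \<U> \<V> \<longleftrightarrow>
    full_additive_subcat C \<U> \<and> full_additive_subcat C \<V> \<and>
    summand_closed C \<U> \<and> summand_closed C \<V> \<and>
    Ext1_zero C E \<U> \<V> \<and>
    (\<forall>B \<in> Obj C. (\<exists>V \<in> \<V>. \<exists>U \<in> \<U>. ses C E V U B \<noteq> {}) \<and>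
                 (\<exists>V \<in> \<V>. \<exists>U \<in> \<U>. ses C E B V U \<noteq> {}))"

definition twin_cotorsion_pair ::
    "('o, 'm) addcat \<Rightarrow> ('m \<times> 'm) set \<Rightarrow> 'o set \<Rightarrow> 'o set \<Rightarrow> 'o set \<Rightarrow> 'o set \<Rightarrow> bool"
  where "twin_cotorsion_pair C E \<S> \<T> \<U> \<V> \<longleftrightarrow>
    cotorsion_pair C E \<S> \<T> \<and> cotorsion_pair C E \<U> \<V> \<and> \<S> \<subseteq> \<U>"

definition ext_star ::
    "('o, 'm) addcat \<Rightarrow> ('m \<times> 'm) set \<Rightarrow> 'o set \<Rightarrow> 'o set \<Rightarrow> 'o set"
  where "ext_star C E \<B>1 \<B>2 =
    {X \<in> Obj C. \<exists>B1 \<in> \<B>1. \<exists>B2 \<in> \<B>2. ses C E B1 X B2 \<noteq> {}}"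

definition twin_core :: "'o set \<Rightarrow> 'o set \<Rightarrow> 'o set"
  where "twin_core \<T> \<U> = \<T> \<inter> \<U>"

definition B_plus ::
    "('o, 'm) addcat \<Rightarrow> ('m \<times> 'm) set \<Rightarrow> 'o set \<Rightarrow> 'o set \<Rightarrow> 'o set \<Rightarrow> 'o set"
  where "B_plus C E \<T> \<U> \<V> =
    {B \<in> Obj C. \<exists>V \<in> \<V>. \<exists>U \<in> twin_core \<T> \<U>. ses C E V U B \<noteq> {}}"

definition B_minus ::
    "('o, 'm) addcat \<Rightarrow> ('m \<times> 'm) set \<Rightarrow> 'o set \<Rightarrow> 'o set \<Rightarrow> 'o set \<Rightarrow> 'o set"
  where "B_minus C E \<S> \<T> \<U> =
    {B \<in> Obj C. \<exists>T \<in> twin_core \<T> \<U>. \<exists>S \<in> \<S>. ses C E B T S \<noteq> {}}"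

text \<open>
  The additive quotient \<open>C/W\<close>. An arrow of \<open>C/W\<close> is a residue class of parallel arrows of \<open>C\<close>,
  two arrows being identified when they differ by an arrow that factors through an object of \<open>W\<close>.
  The operations are unions over all representatives; when \<open>W\<close> is an additive subcategory all
  classes in such a union coincide.
\<close>

definition factors_through :: "('o, 'm) addcat \<Rightarrow> 'o set \<Rightarrow> 'o \<Rightarrow> 'o \<Rightarrow> 'm set"
  where "factors_through C W A B =
    {v \<cdot>\<^bsub>C\<^esub> u | u v. \<exists>X \<in> W. u \<in> homs C A X \<and> v \<in> homs C X B}"

definition quot_class :: "('o, 'm) addcat \<Rightarrow> 'o set \<Rightarrow> 'm \<Rightarrow> 'm set"
  where "quot_class C W f = {f \<boxplus>\<^bsub>C\<^esub> h | h. h \<in> factors_through C W (Dom C f) (Cod C f)}"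

definition quotient_cat :: "('o, 'm) addcat \<Rightarrow> 'o set \<Rightarrow> ('o, 'm set) addcat"
  where "quotient_cat C W =
    \<lparr>Obj = Obj C,
     Arr = quot_class C W ` Arr C,
     Dom = (\<lambda>F. the_elem (Dom C ` F)),
     Cod = (\<lambda>F. the_elem (Cod C ` F)),
     Ident = (\<lambda>A. quot_class C W (Ident C A)),
     Comp = (\<lambda>G F. \<Union>g \<in> G. \<Union>f \<in> F. quot_class C W (g \<cdot>\<^bsub>C\<^esub> f)),
     Plus = (\<lambda>F G. \<Union>f \<in> F. \<Union>g \<in> G. quot_class C W (f \<boxplus>\<^bsub>C\<^esub> g)),
     Zer = (\<lambda>A B. quot_class C W (Zer C A B))\<rparr>"

definition heart ::
    "('o, 'm) addcat \<Rightarrow> ('m \<times> 'm) set \<Rightarrow> 'o set \<Rightarrow> 'o set \<Rightarrow> 'o set \<Rightarrow> 'o set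
      \<Rightarrow> ('o, 'm set) addcat"
  where "heart C E \<S> \<T> \<U> \<V> =
    quotient_cat (full_subcat C (B_plus C E \<T> \<U> \<V> \<inter> B_minus C E \<S> \<T> \<U>)) (twin_core \<T> \<U>)"

end

theory Submission
  imports Defs
begin

text \<open>
  Put \<open>W = T \<inter> U\<close> and call an arrow null if it factors through an object of \<open>W\<close>. The heart has the
  objects of \<open>H = B\<^sup>+ \<inter> B\<^sup>-\<close> (in the text below: \<open>Bp \<inter> Bm\<close>) as objects and arrows modulo null
  arrows as arrows. Two vanishing rules carry all computations: an arrow out of \<open>B\<^sup>-\<close> that
  factors through \<open>T\<close> is null, because it extends along \<open>Z \<rightarrowtail> W0 \<twoheadrightarrow> S0\<close>; dually, an arrow into \<open>B\<^sup>+\<close> that factors through \<open>U\<close> is null.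

  Passing to the opposite category turns the twin cotorsion pair \<open>(S,T), (U,V)\<close> into \<open>(V,U), (T,S)\<close>,
  exchanges \<open>B\<^sup>+\<close> with \<open>B\<^sup>-\<close>, replaces the heart by its opposite and exchanges the two alternatives
  \<open>U \<subseteq> S * T\<close> and \<open>T \<subseteq> U * V\<close>. Since integrality is self-dual, it is enough to treat \<open>U \<subseteq> S * T\<close>.

  Cokernels and kernels. Every \<open>M\<close> in \<open>B\<^sup>-\<close> has a reflection \<open>M \<rightarrowtail> M' \<twoheadrightarrow> S'\<close> with \<open>M'\<close> in \<open>H\<close>
  (\<open>reflection\<close>). The cokernel of \<open>f : A \<rightarrow> B\<close> in the heart is the reflection of the pushout of
  \<open>A \<rightarrowtail> W0 \<twoheadrightarrow> S0\<close> along \<open>f\<close> (\<open>heart_cokernel_exists\<close>). Kernels come by duality, so the heart is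
  preabelian.

  Images. Every arrow of the heart is a cokernel followed by a monomorphism (\<open>heart_image\<close>). Up to an
  isomorphism of the heart the arrow is a deflation with kernel in \<open>B\<^sup>+\<close>, and for such an arrow the
  factorization is constructed explicitly (\<open>deflation_factor\<close>).

  Amalgamation. If \<open>U \<subseteq> S * T\<close>, a monomorphism \<open>\<alpha> : A \<rightarrow> B\<close> and any \<open>\<beta> : A \<rightarrow> D\<close> fit into a
  commutative square of the heart whose arrow out of \<open>D\<close> is again a monomorphism (\<open>amalgamation\<close>).
  The required vanishing is reduced to an extension problem, and the decomposition
  \<open>S1 \<rightarrowtail> U0 \<twoheadrightarrow> T1\<close> of an object of \<open>U\<close> splits that problem into a part solved by \<open>T1\<close> and a part solved by lifting maps out of \<open>S1\<close>
  (\<open>extends_over_envelope\<close>).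

  Conclusion. Amalgamation gives right integrality, because a pushout maps to every commutative
  square. Amalgamation and images together also give left integrality (\<open>left_integralI\<close>): for the
  pullback of \<open>\<gamma> : B \<rightarrow> F\<close> and an epimorphism \<open>\<delta> : D \<rightarrow> F\<close>, factor \<open>(\<gamma>, -\<delta>) : B \<oplus> D \<rightarrow> F\<close> as a
  cokernel \<open>c\<close> followed by a monomorphism \<open>i\<close>; an arrow on \<open>B\<close> that vanishes on the pullback is
  induced by some \<open>u\<close> on the image, and amalgamating \<open>u\<close> with \<open>i\<close> forces \<open>u = 0\<close>, since \<open>\<delta>\<close> is epi.
\<close>

section \<open>Calculus in preadditive categories\<close>

lemma homs_iff: "f \<in> homs C X Y \<longleftrightarrow> f \<in> Arr C \<and> Dom C f = X \<and> Cod C f = Y"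
  by (simp add: homs_def)

definition neg :: "('o, 'm) addcat \<Rightarrow> 'm \<Rightarrow> 'm"
  where "neg C f = m_inv (hom_group C (Dom C f) (Cod C f)) f"

definition diff :: "('o, 'm) addcat \<Rightarrow> 'm \<Rightarrow> 'm \<Rightarrow> 'm"  (infixl "\<boxminus>\<index>" 65)
  where "diff C f g = f \<boxplus>\<^bsub>C\<^esub> neg C g"

context preadditive_category
begin

lemma homsD:
  assumes "f \<in> homs C X Y"
  shows "f \<in> Arr C" "Dom C f = X" "Cod C f = Y" "X \<in> Obj C" "Y \<in> Obj C"
  using assms Dom_closed Cod_closed by (auto simp: homs_iff)

lemma Obj_Dom [simp]: "f \<in> Arr C \<Longrightarrow> Dom C f \<in> Obj C"
  and Obj_Cod [simp]: "f \<in> Arr C \<Longrightarrow> Cod C f \<in> Obj C"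
  by (fact Dom_closed Cod_closed)+

lemma comp_simps [simp]:
  assumes "f \<in> Arr C" "g \<in> Arr C" "Cod C f = Dom C g"
  shows "g \<cdot> f \<in> Arr C" "Dom C (g \<cdot> f) = Dom C f" "Cod C (g \<cdot> f) = Cod C g"
  using Comp_closed[of f "Dom C f" "Dom C g" g "Cod C g"] assms by (auto simp: homs_iff)

lemma assoc [simp]:
  assumes "f \<in> Arr C" "g \<in> Arr C" "h \<in> Arr C" "Cod C f = Dom C g" "Cod C g = Dom C h"
  shows "(h \<cdot> g) \<cdot> f = h \<cdot> (g \<cdot> f)"
  using Comp_assoc[of f "Dom C f" "Cod C f" g "Cod C g" h "Cod C h"] assms by (auto simp: homs_iff)

lemma ident_simps [simp]:
  assumes "A \<in> Obj C"
  shows "Ident C A \<in> Arr C" "Dom C (Ident C A) = A" "Cod C (Ident C A) = A"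
  using Ident_closed[OF assms] by (auto simp: homs_iff)

lemma ident_left [simp]: "f \<in> Arr C \<Longrightarrow> Cod C f = Y \<Longrightarrow> Ident C Y \<cdot> f = f"
  using Ident_left[of f "Dom C f" Y] by (auto simp: homs_iff)

lemma ident_right [simp]: "f \<in> Arr C \<Longrightarrow> Dom C f = X \<Longrightarrow> f \<cdot> Ident C X = f"
  using Ident_right[of f X "Cod C f"] by (auto simp: homs_iff)

lemma group_simps:
  "carrier (hom_group C X Y) = homs C X Y" "monoid.mult (hom_group C X Y) = Plus C"
  "one (hom_group C X Y) = Zer C X Y"
  by (simp_all add: hom_group_def)

lemma plus_simps [simp]:
  assumes "f \<in> Arr C" "g \<in> Arr C" "Dom C f = Dom C g" "Cod C f = Cod C g"
  shows "f \<boxplus> g \<in> Arr C" "Dom C (f \<boxplus> g) = Dom C g" "Cod C (f \<boxplus> g) = Cod C g"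
proof -
  interpret G: comm_group "hom_group C (Dom C g) (Cod C g)" by (rule hom_comm_group) (use assms in auto)
  show "f \<boxplus> g \<in> Arr C" "Dom C (f \<boxplus> g) = Dom C g" "Cod C (f \<boxplus> g) = Cod C g"
    using G.m_closed[of f g] assms by (auto simp: group_simps homs_iff)
qed

lemma zer_simps [simp]:
  assumes "X \<in> Obj C" "Y \<in> Obj C"
  shows "Zer C X Y \<in> Arr C" "Dom C (Zer C X Y) = X" "Cod C (Zer C X Y) = Y"
proof -
  interpret G: comm_group "hom_group C X Y" by (rule hom_comm_group) (use assms in auto)
  show "Zer C X Y \<in> Arr C" "Dom C (Zer C X Y) = X" "Cod C (Zer C X Y) = Y"
    using G.one_closed by (auto simp: group_simps homs_iff)
qed

lemma neg_simps [simp]: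
  assumes "f \<in> Arr C"
  shows "neg C f \<in> Arr C" "Dom C (neg C f) = Dom C f" "Cod C (neg C f) = Cod C f"
proof -
  interpret G: comm_group "hom_group C (Dom C f) (Cod C f)" by (rule hom_comm_group) (use assms in auto)
  show "neg C f \<in> Arr C" "Dom C (neg C f) = Dom C f" "Cod C (neg C f) = Cod C f"
    using G.inv_closed[of f] assms by (auto simp: group_simps homs_iff neg_def)
qed

lemma diff_simps [simp]:
  assumes "f \<in> Arr C" "g \<in> Arr C" "Dom C f = Dom C g" "Cod C f = Cod C g"
  shows "f \<boxminus> g \<in> Arr C" "Dom C (f \<boxminus> g) = Dom C g" "Cod C (f \<boxminus> g) = Cod C g"
  using assms by (simp_all add: diff_def)

lemma plus_neg:
  assumes "f \<in> Arr C"
  shows "f \<boxplus> neg C f = Zer C (Dom C f) (Cod C f)"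
proof -
  interpret G: comm_group "hom_group C (Dom C f) (Cod C f)" by (rule hom_comm_group) (use assms in auto)
  show ?thesis
    using G.r_inv[of f] assms by (auto simp: group_simps homs_iff neg_def)
qed

lemma plus_zer [simp]:
  assumes "f \<in> Arr C" "Dom C f = X" "Cod C f = Y"
  shows "f \<boxplus> Zer C X Y = f" "Zer C X Y \<boxplus> f = f"
proof -
  interpret G: comm_group "hom_group C X Y" by (rule hom_comm_group) (use assms in auto)
  show "f \<boxplus> Zer C X Y = f" "Zer C X Y \<boxplus> f = f"
    using G.r_one[of f] G.l_one[of f] assms by (auto simp: group_simps homs_iff)
qed

lemma plus_comm:
  assumes "f \<in> Arr C" "g \<in> Arr C" "Dom C f = Dom C g" "Cod C f = Cod C g"
  shows "f \<boxplus> g = g \<boxplus> f"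
proof -
  interpret G: comm_group "hom_group C (Dom C f) (Cod C f)" by (rule hom_comm_group) (use assms in auto)
  show ?thesis
    using G.m_comm[of f g] assms by (auto simp: group_simps homs_iff)
qed

lemma plus_assoc:
  assumes "f \<in> Arr C" "g \<in> Arr C" "h \<in> Arr C" "Dom C f = Dom C g" "Cod C f = Cod C g"
    "Dom C g = Dom C h" "Cod C g = Cod C h"
  shows "(f \<boxplus> g) \<boxplus> h = f \<boxplus> (g \<boxplus> h)"
proof -
  interpret G: comm_group "hom_group C (Dom C f) (Cod C f)" by (rule hom_comm_group) (use assms in auto)
  show ?thesis
    using G.m_assoc[of f g h] assms by (auto simp: group_simps homs_iff)
qed

lemma plus_lcomm:
  assumes "f \<in> Arr C" "g \<in> Arr C" "h \<in> Arr C" "Dom C f = Dom C g" "Cod C f = Cod C g"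
    "Dom C g = Dom C h" "Cod C g = Cod C h"
  shows "f \<boxplus> (g \<boxplus> h) = g \<boxplus> (f \<boxplus> h)"
  by (metis assms plus_assoc plus_comm)

lemmas plus_ac = plus_comm plus_assoc plus_lcomm

lemma plus_cancel:
  assumes "f \<in> Arr C" "g \<in> Arr C" "h \<in> Arr C" "Dom C f = Dom C g" "Cod C f = Cod C g"
    "Dom C g = Dom C h" "Cod C g = Cod C h"
  shows "f \<boxplus> g = f \<boxplus> h \<longleftrightarrow> g = h"
proof -
  interpret G: comm_group "hom_group C (Dom C f) (Cod C f)" by (rule hom_comm_group) (use assms in auto)
  show ?thesis
    using G.Units_l_cancel[of f g h] assms unfolding G.Units_eq by (auto simp: group_simps homs_iff)
qed

lemma comp_plus_left:
  assumes "f \<in> Arr C" "g \<in> Arr C" "g' \<in> Arr C" "Cod C f = Dom C g" "Dom C g = Dom C g'" "Cod C g = Cod C g'"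
  shows "(g \<boxplus> g') \<cdot> f = (g \<cdot> f) \<boxplus> (g' \<cdot> f)"
  using Comp_Plus_left[of f "Dom C f" "Cod C f" g "Cod C g" g'] assms by (auto simp: homs_iff)

lemma comp_plus_right:
  assumes "f \<in> Arr C" "f' \<in> Arr C" "g \<in> Arr C" "Cod C f = Dom C g" "Dom C f = Dom C f'" "Cod C f = Cod C f'"
  shows "g \<cdot> (f \<boxplus> f') = (g \<cdot> f) \<boxplus> (g \<cdot> f')"
  using Comp_Plus_right[of f "Dom C f" "Cod C f" f' g "Cod C g"] assms by (auto simp: homs_iff)

lemma comp_zer [simp]:
  assumes "g \<in> Arr C" "Dom C g = Y" "X \<in> Obj C"
  shows "g \<cdot> Zer C X Y = Zer C X (Cod C g)"
proof -
  let ?z = "Zer C X Y"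
  have [simp]: "Y \<in> Obj C" using assms Obj_Dom by auto
  have "g \<cdot> ?z \<boxplus> g \<cdot> ?z = g \<cdot> ?z \<boxplus> Zer C X (Cod C g)"
    using comp_plus_right[of ?z ?z g] assms by simp
  thus ?thesis using plus_cancel[of "g \<cdot> ?z" "g \<cdot> ?z" "Zer C X (Cod C g)"] assms by simp
qed

lemma zer_comp [simp]:
  assumes "g \<in> Arr C" "Cod C g = X" "Y \<in> Obj C"
  shows "Zer C X Y \<cdot> g = Zer C (Dom C g) Y"
proof -
  let ?z = "Zer C X Y"
  have [simp]: "X \<in> Obj C" using assms Obj_Cod by auto
  have "?z \<cdot> g \<boxplus> ?z \<cdot> g = ?z \<cdot> g \<boxplus> Zer C (Dom C g) Y"
    using comp_plus_left[of g ?z ?z] assms by simp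
  thus ?thesis using plus_cancel[of "?z \<cdot> g" "?z \<cdot> g" "Zer C (Dom C g) Y"] assms by simp
qed

lemma neg_unique:
  assumes "f \<in> Arr C" "g \<in> Arr C" "Dom C f = Dom C g" "Cod C f = Cod C g"
    "f \<boxplus> g = Zer C (Dom C f) (Cod C f)"
  shows "g = neg C f"
proof -
  have "f \<boxplus> g = f \<boxplus> neg C f" by (simp add: assms plus_neg)
  thus ?thesis by (subst (asm) plus_cancel) (simp_all add: assms)
qed

lemma comp_neg:
  assumes "f \<in> Arr C" "g \<in> Arr C" "Cod C f = Dom C g"
  shows "neg C (g \<cdot> f) = g \<cdot> neg C f" "neg C (g \<cdot> f) = neg C g \<cdot> f"
proof -
  have 1: "g \<cdot> f \<boxplus> g \<cdot> neg C f = Zer C (Dom C f) (Cod C g)"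
    by (simp add: comp_plus_right[symmetric] plus_neg assms)
  have 2: "g \<cdot> f \<boxplus> neg C g \<cdot> f = Zer C (Dom C f) (Cod C g)"
    by (simp add: comp_plus_left[symmetric] plus_neg assms)
  show "neg C (g \<cdot> f) = g \<cdot> neg C f"
    by (rule neg_unique[symmetric]) (simp_all add: 1 assms)
  show "neg C (g \<cdot> f) = neg C g \<cdot> f"
    by (rule neg_unique[symmetric]) (simp_all add: 2 assms)
qed

lemma neg_neg [simp]: "f \<in> Arr C \<Longrightarrow> neg C (neg C f) = f"
  by (metis neg_simps neg_unique plus_comm plus_neg)

lemma comp_diff_left:
  assumes "f \<in> Arr C" "g \<in> Arr C" "g' \<in> Arr C" "Cod C f = Dom C g" "Dom C g = Dom C g'" "Cod C g = Cod C g'"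
  shows "(g \<boxminus> g') \<cdot> f = (g \<cdot> f) \<boxminus> (g' \<cdot> f)"
  using assms comp_neg(2)[of f g'] by (simp add: diff_def comp_plus_left)

lemma comp_diff_right:
  assumes "f \<in> Arr C" "f' \<in> Arr C" "g \<in> Arr C" "Cod C f = Dom C g" "Dom C f = Dom C f'" "Cod C f = Cod C f'"
  shows "g \<cdot> (f \<boxminus> f') = (g \<cdot> f) \<boxminus> (g \<cdot> f')"
  using assms comp_neg(1)[of f' g] by (simp add: diff_def comp_plus_right)

lemma diff_plus:
  assumes "f \<in> Arr C" "g \<in> Arr C" "Dom C f = Dom C g" "Cod C f = Cod C g"
  shows "(f \<boxminus> g) \<boxplus> g = f" "g \<boxplus> (f \<boxminus> g) = f"
proof -
  have 1: "neg C g \<boxplus> g = Zer C (Dom C g) (Cod C g)"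
    using plus_neg[of g] plus_comm[of "neg C g" g] assms(2) by simp
  show "(f \<boxminus> g) \<boxplus> g = f"
    using plus_assoc[of f "neg C g" g] assms 1 by (simp add: diff_def)
  thus "g \<boxplus> (f \<boxminus> g) = f"
    using plus_comm[of g "f \<boxminus> g"] assms by (metis diff_simps)
qed

lemma diff_self [simp]: "f \<in> Arr C \<Longrightarrow> f \<boxminus> f = Zer C (Dom C f) (Cod C f)"
  by (simp add: diff_def plus_neg)

lemma diff_zer [simp]:
  assumes "f \<in> Arr C" "Dom C f = X" "Cod C f = Y"
  shows "f \<boxminus> Zer C X Y = f"
proof -
  have [simp]: "X \<in> Obj C" "Y \<in> Obj C" using assms Obj_Dom Obj_Cod by auto
  show ?thesis using diff_plus(1)[of f "Zer C X Y"] assms by simp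
qed

lemma diff_eq_zer:
  assumes "f \<in> Arr C" "g \<in> Arr C" "Dom C f = Dom C g" "Cod C f = Cod C g"
    "f \<boxminus> g = Zer C (Dom C g) (Cod C g)"
  shows "f = g"
  using diff_plus(1)[of f g] assms by simp

lemma plus_eq_iff:
  assumes "f \<in> Arr C" "g \<in> Arr C" "h \<in> Arr C" "Dom C f = Dom C g" "Cod C f = Cod C g"
    "Dom C g = Dom C h" "Cod C g = Cod C h"
  shows "f \<boxplus> g = h \<longleftrightarrow> f = h \<boxminus> g"
  using diff_plus(2)[of h g] plus_cancel[of g f "h \<boxminus> g"] plus_comm[of f g] assms
  by (metis diff_simps)

text \<open>
  The simplifier normalizes composites to the right, which hides the left-hand side of an equation
  between composites inside a longer one. This form restores it as a rewrite rule.
\<close>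

lemma sq_ext:
  assumes "g \<cdot> f = k" "f \<in> Arr C" "g \<in> Arr C" "Cod C f = Dom C g" "z \<in> Arr C" "Cod C z = Dom C f"
  shows "g \<cdot> (f \<cdot> z) = k \<cdot> z"
  using assoc[of z f g] assms by simp

lemma biproductD:
  assumes "is_biproduct C A B X i1 i2 p1 p2"
  shows "A \<in> Obj C" "B \<in> Obj C" "X \<in> Obj C" "i1 \<in> homs C A X" "i2 \<in> homs C B X" "p1 \<in> homs C X A"
    "p2 \<in> homs C X B" "p1 \<cdot> i1 = Ident C A" "p2 \<cdot> i2 = Ident C B" "p2 \<cdot> i1 = Zer C A B"
    "p1 \<cdot> i2 = Zer C B A" "(i1 \<cdot> p1) \<boxplus> (i2 \<cdot> p2) = Ident C X"
  using assms by (auto simp: is_biproduct_def)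

lemma biproduct_swap:
  assumes "is_biproduct C A B X i1 i2 p1 p2"
  shows "is_biproduct C B A X i2 i1 p2 p1"
proof -
  note b = biproductD[OF assms]
  note [simp] = homsD[OF b(4)] homsD[OF b(5)] homsD[OF b(6)] homsD[OF b(7)]
  show ?thesis
    using b plus_comm[of "i2 \<cdot> p2" "i1 \<cdot> p1"] by (simp add: is_biproduct_def)
qed

lemma biproduct_eqI_left:
  assumes "is_biproduct C A B X i1 i2 p1 p2" "f \<in> homs C X Y" "g \<in> homs C X Y"
    "f \<cdot> i1 = g \<cdot> i1" "f \<cdot> i2 = g \<cdot> i2"
  shows "f = g"
proof -
  note b = biproductD[OF assms(1)]
  note [simp] = homsD[OF b(4)] homsD[OF b(5)] homsD[OF b(6)] homsD[OF b(7)]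
    homsD[OF assms(2)] homsD[OF assms(3)]
  have *: "(h \<cdot> i1) \<cdot> p1 \<boxplus> (h \<cdot> i2) \<cdot> p2 = h" if "h \<in> homs C X Y" for h
  proof -
    note [simp] = homsD[OF that]
    have "(h \<cdot> i1) \<cdot> p1 \<boxplus> (h \<cdot> i2) \<cdot> p2 = h \<cdot> ((i1 \<cdot> p1) \<boxplus> (i2 \<cdot> p2))"
      by (simp add: comp_plus_right)
    thus ?thesis by (simp add: b(12))
  qed
  show ?thesis
    by (metis *[OF assms(2)] *[OF assms(3)] assms(4,5))
qed

lemma biproduct_copair:
  assumes "is_biproduct C A B X i1 i2 p1 p2" "f \<in> homs C A Y" "g \<in> homs C B Y"
  shows "(f \<cdot> p1) \<boxplus> (g \<cdot> p2) \<in> homs C X Y" "((f \<cdot> p1) \<boxplus> (g \<cdot> p2)) \<cdot> i1 = f"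
    "((f \<cdot> p1) \<boxplus> (g \<cdot> p2)) \<cdot> i2 = g"
proof -
  note b = biproductD[OF assms(1)]
  note [simp] = homsD[OF b(4)] homsD[OF b(5)] homsD[OF b(6)] homsD[OF b(7)] b(8-11)
    homsD[OF assms(2)] homsD[OF assms(3)]
  show "(f \<cdot> p1) \<boxplus> (g \<cdot> p2) \<in> homs C X Y" "((f \<cdot> p1) \<boxplus> (g \<cdot> p2)) \<cdot> i1 = f"
    "((f \<cdot> p1) \<boxplus> (g \<cdot> p2)) \<cdot> i2 = g"
    by (simp_all add: homs_iff comp_plus_left)
qed

lemma biproduct_pair:
  assumes "is_biproduct C A B X i1 i2 p1 p2" "f \<in> homs C Y A" "g \<in> homs C Y B"
  shows "(i1 \<cdot> f) \<boxplus> (i2 \<cdot> g) \<in> homs C Y X" "p1 \<cdot> ((i1 \<cdot> f) \<boxplus> (i2 \<cdot> g)) = f"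
    "p2 \<cdot> ((i1 \<cdot> f) \<boxplus> (i2 \<cdot> g)) = g"
proof -
  note b = biproductD[OF assms(1)]
  note [simp] = homsD[OF b(4)] homsD[OF b(5)] homsD[OF b(6)] homsD[OF b(7)] b(8-11)
    b(8-11)[THEN sq_ext] homsD[OF assms(2)] homsD[OF assms(3)]
  show "(i1 \<cdot> f) \<boxplus> (i2 \<cdot> g) \<in> homs C Y X" "p1 \<cdot> ((i1 \<cdot> f) \<boxplus> (i2 \<cdot> g)) = f"
    "p2 \<cdot> ((i1 \<cdot> f) \<boxplus> (i2 \<cdot> g)) = g"
    by (simp_all add: homs_iff comp_plus_right)
qed

lemma monoI_zero:
  assumes "f \<in> homs C X Y" "\<And>Z g. g \<in> homs C Z X \<Longrightarrow> f \<cdot> g = Zer C Z Y \<Longrightarrow> g = Zer C Z X"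
  shows "is_mono C f"
  unfolding is_mono_def
proof (intro conjI allI ballI impI)
  note [simp] = homsD[OF assms(1)]
  show "f \<in> Arr C" by simp
  fix Z g h assume g: "g \<in> homs C Z (Dom C f)" and h: "h \<in> homs C Z (Dom C f)" and eq: "f \<cdot> g = f \<cdot> h"
  note [simp] = homsD[OF g] homsD[OF h]
  have "f \<cdot> (g \<boxminus> h) = Zer C Z Y" by (simp add: comp_diff_right eq)
  hence "g \<boxminus> h = Zer C Z X" by (intro assms(2)) (simp_all add: homs_iff)
  thus "g = h" using diff_eq_zer[of g h] by simp
qed

lemma epiI_zero:
  assumes "f \<in> homs C X Y" "\<And>Z g. g \<in> homs C Y Z \<Longrightarrow> g \<cdot> f = Zer C X Z \<Longrightarrow> g = Zer C Y Z"
  shows "is_epi C f"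
  unfolding is_epi_def
proof (intro conjI allI ballI impI)
  note [simp] = homsD[OF assms(1)]
  show "f \<in> Arr C" by simp
  fix Z g h assume g: "g \<in> homs C (Cod C f) Z" and h: "h \<in> homs C (Cod C f) Z" and eq: "g \<cdot> f = h \<cdot> f"
  note [simp] = homsD[OF g] homsD[OF h]
  have "(g \<boxminus> h) \<cdot> f = Zer C X Z" by (simp add: comp_diff_left eq)
  hence "g \<boxminus> h = Zer C Y Z" by (intro assms(2)) (simp_all add: homs_iff)
  thus "g = h" using diff_eq_zer[of g h] by simp
qed

lemma monoD_zero:
  assumes "is_mono C f" "f \<in> homs C X Y" "g \<in> homs C Z X" "f \<cdot> g = Zer C Z Y"
  shows "g = Zer C Z X"
proof -
  note [simp] = homsD[OF assms(2)] homsD[OF assms(3)]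
  have "f \<cdot> g = f \<cdot> Zer C Z X" using assms(4) by simp
  moreover have "Zer C Z X \<in> homs C Z (Dom C f)" "g \<in> homs C Z (Dom C f)" by (simp_all add: homs_iff)
  moreover have "\<forall>X. \<forall>g \<in> homs C X (Dom C f). \<forall>h \<in> homs C X (Dom C f). f \<cdot> g = f \<cdot> h \<longrightarrow> g = h"
    using assms(1) unfolding is_mono_def by (rule conjunct2)
  ultimately show ?thesis by (metis (no_types))
qed

lemma epiD_zero:
  assumes "is_epi C f" "f \<in> homs C X Y" "g \<in> homs C Y Z" "g \<cdot> f = Zer C X Z"
  shows "g = Zer C Y Z"
proof -
  note [simp] = homsD[OF assms(2)] homsD[OF assms(3)]
  have "g \<cdot> f = Zer C Y Z \<cdot> f" using assms(4) by simp
  moreover have "Zer C Y Z \<in> homs C (Cod C f) Z" "g \<in> homs C (Cod C f) Z" by (simp_all add: homs_iff)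
  moreover have "\<forall>X. \<forall>g \<in> homs C (Cod C f) X. \<forall>h \<in> homs C (Cod C f) X. g \<cdot> f = h \<cdot> f \<longrightarrow> g = h"
    using assms(1) unfolding is_epi_def by (rule conjunct2)
  ultimately show ?thesis by (metis (no_types))
qed

end

section \<open>Opposite categories\<close>

definition op :: "('o, 'm) addcat \<Rightarrow> ('o, 'm) addcat"
  where "op C = \<lparr>Obj = Obj C, Arr = Arr C, Dom = Cod C, Cod = Dom C, Ident = Ident C,
    Comp = (\<lambda>g f. f \<cdot>\<^bsub>C\<^esub> g), Plus = Plus C, Zer = (\<lambda>A B. Zer C B A)\<rparr>"

lemma op_simps [simp]:
  "Obj (op C) = Obj C" "Arr (op C) = Arr C" "Dom (op C) = Cod C" "Cod (op C) = Dom C"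
  "Ident (op C) = Ident C" "Comp (op C) g f = f \<cdot>\<^bsub>C\<^esub> g" "Plus (op C) = Plus C"
  "Zer (op C) A B = Zer C B A"
  by (simp_all add: op_def)

lemma homs_op [simp]: "homs (op C) A B = homs C B A"
  by (auto simp: homs_iff)

lemma hom_group_op: "hom_group (op C) A B = hom_group C B A"
  by (simp add: hom_group_def)

lemma neg_op [simp]: "neg (op C) f = neg C f"
  by (simp add: neg_def hom_group_op)

lemma op_op [simp]: "op (op C) = C"
  by (simp add: op_def)

lemma is_biproduct_op: "is_biproduct (op C) A B X i1 i2 p1 p2 \<longleftrightarrow> is_biproduct C A B X p1 p2 i1 i2"
  by (auto simp: is_biproduct_def)

lemma is_zero_object_op [simp]: "is_zero_object (op C) Z \<longleftrightarrow> is_zero_object C Z"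
  by (auto simp: is_zero_object_def)

lemma is_mono_op [simp]: "is_mono (op C) f \<longleftrightarrow> is_epi C f"
  and is_epi_op [simp]: "is_epi (op C) f \<longleftrightarrow> is_mono C f"
  by (auto simp: is_mono_def is_epi_def)

lemma is_iso_op [simp]: "is_iso (op C) f \<longleftrightarrow> is_iso C f"
  by (auto simp: is_iso_def)

lemma is_kernel_op [simp]: "is_kernel (op C) k f \<longleftrightarrow> is_cokernel C k f"
  and is_cokernel_op [simp]: "is_cokernel (op C) k f \<longleftrightarrow> is_kernel C k f"
  by (auto simp: is_kernel_def is_cokernel_def)

lemma is_comm_square_op: "is_comm_square (op C) a b c d \<longleftrightarrow> is_comm_square C d c b a"
  by (auto simp: is_comm_square_def)

lemma is_comm_square_swap: "is_comm_square C a b c d \<longleftrightarrow> is_comm_square C b a d c"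
  by (auto simp: is_comm_square_def)

lemma is_pushout_swap:
  assumes "is_pushout C a b c d"
  shows "is_pushout C b a d c"
  unfolding is_pushout_def
proof (intro conjI allI ballI impI)
  show "is_comm_square C b a d c" using assms is_comm_square_swap[of C a b c d] by (simp add: is_pushout_def)
  fix X x y assume "x \<in> homs C (Cod C b) X" "y \<in> homs C (Cod C a) X" "x \<cdot>\<^bsub>C\<^esub> b = y \<cdot>\<^bsub>C\<^esub> a"
  then have "\<exists>!u. u \<in> homs C (Cod C c) X \<and> u \<cdot>\<^bsub>C\<^esub> c = y \<and> u \<cdot>\<^bsub>C\<^esub> d = x"
    using assms unfolding is_pushout_def by metis
  moreover have "Cod C c = Cod C d" using assms by (simp add: is_pushout_def is_comm_square_def)
  ultimately show "\<exists>!u. u \<in> homs C (Cod C d) X \<and> u \<cdot>\<^bsub>C\<^esub> d = x \<and> u \<cdot>\<^bsub>C\<^esub> c = y"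
    by (simp add: conj_ac)
qed

lemma is_pullback_op: "is_pullback (op C) a b c d \<longleftrightarrow> is_pushout C d c b a"
proof -
  have "is_pullback (op C) a b c d \<longleftrightarrow> is_pushout C c d a b"
    unfolding is_pullback_def is_pushout_def is_comm_square_op is_comm_square_swap[of C d]
    by simp
  also have "\<dots> \<longleftrightarrow> is_pushout C d c b a" using is_pushout_swap[of C c d a b] is_pushout_swap[of C d c b a] by blast
  finally show ?thesis .
qed

lemma is_pushout_op: "is_pushout (op C) a b c d \<longleftrightarrow> is_pullback C d c b a"
  using is_pullback_op[of "op C" d c b a] by simp

lemma preadditive_op:
  assumes "preadditive_category C"
  shows "preadditive_category (op C)"
proof -
  interpret preadditive_category C by fact
  show ?thesis
    by (rule preadditive_category.intro) (auto simp: hom_group_op hom_comm_group homs_iff comp_plus_left comp_plus_right)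
qed

lemma additive_op:
  assumes "additive_category C"
  shows "additive_category (op C)"
proof -
  interpret additive_category C by fact
  interpret o: preadditive_category "op C" by (rule preadditive_op) unfold_locales
  show ?thesis
  proof
    show "\<exists>Z. is_zero_object (op C) Z" using ex_zero_object by simp
    show "\<exists>X i1 i2 p1 p2. is_biproduct (op C) A B X i1 i2 p1 p2"
      if "A \<in> Obj (op C)" "B \<in> Obj (op C)" for A B
      using ex_biproduct[of A B] that by (fastforce simp: is_biproduct_op)
  qed
qed

lemma preabelian_op: "preabelian C \<Longrightarrow> preabelian (op C)"
  by (auto simp: preabelian_def additive_op)

lemma left_integral_op: "left_integral (op C) \<longleftrightarrow> right_integral C"
proof -
  have "preabelian (op C) \<longleftrightarrow> preabelian C"
    using preabelian_op[of C] preabelian_op[of "op C"] by auto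
  thus ?thesis
    unfolding left_integral_def right_integral_def is_pullback_op by auto
qed

lemma right_integral_op: "right_integral (op C) \<longleftrightarrow> left_integral C"
  using left_integral_op[of "op C"] by simp

lemma integral_op: "integral (op C) \<longleftrightarrow> integral C"
  by (auto simp: integral_def left_integral_op right_integral_op)

lemma is_composable_op: "is_composable (op C) f g \<longleftrightarrow> is_composable C g f"
  by (auto simp: is_composable_def)

definition op_seqs :: "('m \<times> 'm) set \<Rightarrow> ('m \<times> 'm) set"
  where "op_seqs E = {(p, i). (i, p) \<in> E}"

lemma op_seqs_iff [simp]: "(p, i) \<in> op_seqs E \<longleftrightarrow> (i, p) \<in> E"
  by (simp add: op_seqs_def)

lemma admissible_op [simp]:
  "admissible_mono (op_seqs E) = admissible_epi E" "admissible_epi (op_seqs E) = admissible_mono E"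
  by (auto simp: admissible_mono_def admissible_epi_def)

context preadditive_category
begin

lemma seq_iso_op:
  assumes "seq_iso (op C) (p, i) (p', i')"
  shows "seq_iso C (i', p') (i, p)"
proof -
  obtain a b c where "is_composable C i p" "is_composable C i' p'" "is_iso C a" "is_iso C b" "is_iso C c"
    "a \<in> homs C (Cod C p') (Cod C p)" "b \<in> homs C (Cod C i') (Cod C i)" "c \<in> homs C (Dom C i') (Dom C i)"
    "p \<cdot> b = a \<cdot> p'" "i \<cdot> c = b \<cdot> i'"
    using assms unfolding seq_iso_def by (auto simp: is_composable_op is_composable_def)
  thus ?thesis unfolding seq_iso_def prod.case by metis
qed

lemma seq_iso_sym:
  assumes "seq_iso C s s'"
  shows "seq_iso C s' s"
proof -
  obtain f g f' g' where s: "s = (f, g)" "s' = (f', g')" by (cases s, cases s') auto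
  obtain a b c where co: "is_composable C f g" "is_composable C f' g'"
    and i: "is_iso C a" "is_iso C b" "is_iso C c"
    and h: "a \<in> homs C (Dom C f) (Dom C f')" "b \<in> homs C (Cod C f) (Cod C f')" "c \<in> homs C (Cod C g) (Cod C g')"
    and e: "b \<cdot> f = f' \<cdot> a" "c \<cdot> g = g' \<cdot> b"
    using assms s unfolding seq_iso_def by auto
  note [simp] = homsD[OF h(1)] homsD[OF h(2)] homsD[OF h(3)]
  obtain a' where a': "a' \<in> homs C (Dom C f') (Dom C f)" "a' \<cdot> a = Ident C (Dom C f)" "a \<cdot> a' = Ident C (Dom C f')"
    using i(1) unfolding is_iso_def by auto
  obtain b' where b': "b' \<in> homs C (Cod C f') (Cod C f)" "b' \<cdot> b = Ident C (Cod C f)" "b \<cdot> b' = Ident C (Cod C f')"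
    using i(2) unfolding is_iso_def by auto
  obtain c' where c': "c' \<in> homs C (Cod C g') (Cod C g)" "c' \<cdot> c = Ident C (Cod C g)" "c \<cdot> c' = Ident C (Cod C g')"
    using i(3) unfolding is_iso_def by auto
  note [simp] = homsD[OF a'(1)] homsD[OF b'(1)] homsD[OF c'(1)] a'(2,3) b'(2,3) c'(2,3)
    b'(2)[THEN sq_ext] c'(2)[THEN sq_ext] a'(3)[THEN sq_ext] b'(3)[THEN sq_ext]
  have [simp]: "f \<in> Arr C" "g \<in> Arr C" "f' \<in> Arr C" "g' \<in> Arr C" "Cod C f = Dom C g" "Cod C f' = Dom C g'"
    using co by (auto simp: is_composable_def)
  have "b' \<cdot> f' = b' \<cdot> ((f' \<cdot> a) \<cdot> a')" by simp
  also have "\<dots> = f \<cdot> a'" unfolding e(1)[symmetric] by simp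
  finally have 1: "b' \<cdot> f' = f \<cdot> a'" .
  have "c' \<cdot> g' = c' \<cdot> ((g' \<cdot> b) \<cdot> b')" by simp
  also have "\<dots> = g \<cdot> b'" unfolding e(2)[symmetric] by simp
  finally have 2: "c' \<cdot> g' = g \<cdot> b'" .
  have "is_iso C a'" unfolding is_iso_def using h by (auto intro: bexI[of _ a])
  moreover have "is_iso C b'" unfolding is_iso_def using h by (auto intro: bexI[of _ b])
  moreover have "is_iso C c'" unfolding is_iso_def using h by (auto intro: bexI[of _ c])
  ultimately show ?thesis using 1 2 co a'(1) b'(1) c'(1)
    unfolding seq_iso_def s prod.case by metis
qed

text \<open>
  The definition of a direct sum of sequences only speaks about the injections, and its dual only
  about the projections. An arrow that is diagonal for the projections is diagonal for the
  injections as well, which makes the notion self-dual.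
\<close>

lemma biproduct_matrix:
  assumes X: "is_biproduct C A1 A2 X a1 a2 pa1 pa2" and Y: "is_biproduct C B1 B2 Y b1 b2 pb1 pb2"
    and f: "f \<in> homs C X Y" "f1 \<in> homs C A1 B1" "f2 \<in> homs C A2 B2"
    and e: "f1 \<cdot> pa1 = pb1 \<cdot> f" "f2 \<cdot> pa2 = pb2 \<cdot> f"
  shows "f \<cdot> a1 = b1 \<cdot> f1" "f \<cdot> a2 = b2 \<cdot> f2"
proof -
  note x = biproductD[OF X] and y = biproductD[OF Y]
  note [simp] = homsD[OF x(4)] homsD[OF x(5)] homsD[OF x(6)] homsD[OF x(7)] x(8-11)
    homsD[OF y(4)] homsD[OF y(5)] homsD[OF y(6)] homsD[OF y(7)] homsD[OF f(1)]  homsD[OF f(2)] homsD[OF f(3)]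
  have *: "b1 \<cdot> (f1 \<cdot> (pa1 \<cdot> g)) \<boxplus> b2 \<cdot> (f2 \<cdot> (pa2 \<cdot> g)) = f \<cdot> g" if "g \<in> homs C Z X" for g Z
  proof -
    note [simp] = homsD[OF that]
    have "b1 \<cdot> (f1 \<cdot> (pa1 \<cdot> g)) \<boxplus> b2 \<cdot> (f2 \<cdot> (pa2 \<cdot> g)) = ((b1 \<cdot> pb1) \<boxplus> (b2 \<cdot> pb2)) \<cdot> (f \<cdot> g)"
      by (simp add: comp_plus_left e(1)[THEN sq_ext] e(2)[THEN sq_ext])
    thus ?thesis by (simp add: y(12))
  qed
  show "f \<cdot> a1 = b1 \<cdot> f1" "f \<cdot> a2 = b2 \<cdot> f2"
    using *[OF x(4)] *[OF x(5)] by simp_all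
qed

lemma seq_direct_sum_op:
  assumes "seq_direct_sum (op C) (p1, i1) (p2, i2) (p, i)"
  shows "seq_direct_sum C (i1, p1) (i2, p2) (i, p)"
proof -
  obtain a1 a2 pa1 pa2 b1 b2 pb1 pb2 c1 c2 pc1 pc2 where
    co: "is_composable C i1 p1" "is_composable C i2 p2" "is_composable C i p" and
    A: "is_biproduct C (Cod C p1) (Cod C p2) (Cod C p) pa1 pa2 a1 a2" and
    B: "is_biproduct C (Cod C i1) (Cod C i2) (Cod C i) pb1 pb2 b1 b2" and
    D: "is_biproduct C (Dom C i1) (Dom C i2) (Dom C i) pc1 pc2 c1 c2" and
    e: "a1 \<cdot> p = p1 \<cdot> b1" "a2 \<cdot> p = p2 \<cdot> b2" "b1 \<cdot> i = i1 \<cdot> c1" "b2 \<cdot> i = i2 \<cdot> c2"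
    using assms unfolding seq_direct_sum_def by (auto simp: is_composable_op is_biproduct_op is_composable_def)
  have "p \<cdot> pb1 = pa1 \<cdot> p1 \<and> p \<cdot> pb2 = pa2 \<cdot> p2" "i \<cdot> pc1 = pb1 \<cdot> i1 \<and> i \<cdot> pc2 = pb2 \<cdot> i2"
    using biproduct_matrix[OF B A, of p p1 p2] biproduct_matrix[OF D B, of i i1 i2] e co
    by (auto simp: homs_iff is_composable_def)
  with co A B D show ?thesis unfolding seq_direct_sum_def prod.case by metis
qed

end

text \<open>
  Every construction below is carried out for one of two dual situations; the other one is obtained
  by interpreting the theory in the opposite category.
\<close>

lemma exact_op:
  assumes "exact_category C E"
  shows "exact_category (op C) (op_seqs E)"
proof -
  interpret exact_category C E by fact
  interpret o: additive_category "op C" by (rule additive_op) unfold_locales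
  show ?thesis
  proof
    show "is_kernel (op C) i p \<and> is_cokernel (op C) p i" if "(i, p) \<in> op_seqs E" for i p
      using kernel_cokernel_pair[of p i] that by simp
    show "s' \<in> op_seqs E" if "s \<in> op_seqs E" "seq_iso (op C) s s'" for s s'
    proof -
      obtain p i p' i' where s: "s = (p, i)" "s' = (p', i')" by (cases s, cases s') auto
      have "seq_iso (op C) (p', i') (p, i)"
        using that(2) o.seq_iso_sym s by auto
      from seq_iso_op[OF this] show ?thesis
        using iso_closed[of "(i, p)" "(i', p')"] that s by auto
    qed
    show "s \<in> op_seqs E" if "s1 \<in> op_seqs E" "s2 \<in> op_seqs E" "seq_direct_sum (op C) s1 s2 s" for s1 s2 s
    proof -
      obtain p1 i1 p2 i2 p i where s: "s1 = (p1, i1)" "s2 = (p2, i2)" "s = (p, i)"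
        by (cases s1, cases s2, cases s)
      have "seq_direct_sum C (i1, p1) (i2, p2) (i, p)"
        by (rule seq_direct_sum_op) (use that(3) s in simp)
      from direct_sum_closed[OF _ _ this] show ?thesis using that(1,2) s by simp
    qed
    show "s1 \<in> op_seqs E" if "s \<in> op_seqs E" "seq_direct_sum (op C) s1 s2 s" for s1 s2 s
    proof -
      obtain p1 i1 p2 i2 p i where s: "s1 = (p1, i1)" "s2 = (p2, i2)" "s = (p, i)"
        by (cases s1, cases s2, cases s)
      have "seq_direct_sum C (i1, p1) (i2, p2) (i, p)"
        by (rule seq_direct_sum_op) (use that(2) s in simp)
      from direct_summand_closed[OF _ this] show ?thesis using that(1) s by simp
    qed
    show "(i1, p2) \<in> op_seqs E" if "is_biproduct (op C) A B X i1 i2 p1 p2" for A B X i1 i2 p1 p2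
      using split_exact[OF biproduct_swap[of A B X p1 p2 i1 i2]] that by (simp add: is_biproduct_op)
    show "admissible_mono (op_seqs E) (Comp (op C) j i)"
      if "admissible_mono (op_seqs E) i" "admissible_mono (op_seqs E) j" "Cod (op C) i = Dom (op C) j" for i j
      using that admissible_epi_Comp by simp
    show "admissible_epi (op_seqs E) (Comp (op C) q p)"
      if "admissible_epi (op_seqs E) p" "admissible_epi (op_seqs E) q" "Cod (op C) p = Dom (op C) q" for p q
      using that admissible_mono_Comp by simp
    show "\<exists>f' i'. is_pushout (op C) i f f' i' \<and> admissible_mono (op_seqs E) i'"
      if "admissible_mono (op_seqs E) i" "f \<in> Arr (op C)" "Dom (op C) f = Dom (op C) i" for i f
      using admissible_epi_pullback[of i f] that by (auto simp: is_pushout_op)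
    show "\<exists>p' f'. is_pullback (op C) p' f' f p \<and> admissible_epi (op_seqs E) p'"
      if "admissible_epi (op_seqs E) p" "f \<in> Arr (op C)" "Cod (op C) f = Cod (op C) p" for p f
      using admissible_mono_pushout[of p f] that by (auto simp: is_pullback_op)
  qed
qed

section \<open>Short exact sequences\<close>

lemma ses_op [simp]: "(p, i) \<in> ses (op C) (op_seqs E) Z Y X \<longleftrightarrow> (i, p) \<in> ses C E X Y Z"
  by (auto simp: ses_def)

context preadditive_category
begin

lemma pushoutD:
  assumes "is_pushout C \<alpha> \<beta> \<gamma> \<delta>" "\<alpha> \<in> homs C A B" "\<beta> \<in> homs C A B'" "\<gamma> \<in> homs C B D"
  shows "\<delta> \<in> homs C B' D" "\<gamma> \<cdot> \<alpha> = \<delta> \<cdot> \<beta>"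
    "\<lbrakk>x \<in> homs C B X; y \<in> homs C B' X; x \<cdot> \<alpha> = y \<cdot> \<beta>\<rbrakk> \<Longrightarrow> \<exists>u \<in> homs C D X. u \<cdot> \<gamma> = x \<and> u \<cdot> \<delta> = y"
    "\<lbrakk>u \<in> homs C D X; v \<in> homs C D X; u \<cdot> \<gamma> = v \<cdot> \<gamma>; u \<cdot> \<delta> = v \<cdot> \<delta>\<rbrakk> \<Longrightarrow> u = v"
proof -
  note h = homsD[OF assms(2)] homsD[OF assms(3)] homsD[OF assms(4)]
  have sq: "is_comm_square C \<alpha> \<beta> \<gamma> \<delta>" and
    un: "\<And>X x y. \<lbrakk>x \<in> homs C B X; y \<in> homs C B' X; x \<cdot> \<alpha> = y \<cdot> \<beta>\<rbrakk>
      \<Longrightarrow> \<exists>!u. u \<in> homs C D X \<and> u \<cdot> \<gamma> = x \<and> u \<cdot> \<delta> = y"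
    using assms(1) unfolding is_pushout_def h by auto
  show d: "\<delta> \<in> homs C B' D" "\<gamma> \<cdot> \<alpha> = \<delta> \<cdot> \<beta>"
    using sq h unfolding is_comm_square_def by (auto simp: homs_iff)
  show "\<lbrakk>x \<in> homs C B X; y \<in> homs C B' X; x \<cdot> \<alpha> = y \<cdot> \<beta>\<rbrakk> \<Longrightarrow> \<exists>u \<in> homs C D X. u \<cdot> \<gamma> = x \<and> u \<cdot> \<delta> = y"
    using un[of x X y] by blast
  assume uv: "u \<in> homs C D X" "v \<in> homs C D X" "u \<cdot> \<gamma> = v \<cdot> \<gamma>" "u \<cdot> \<delta> = v \<cdot> \<delta>"
  have "(u \<cdot> \<gamma>) \<cdot> \<alpha> = (u \<cdot> \<delta>) \<cdot> \<beta>"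
    using homsD[OF uv(1)] homsD[OF d(1)] h d(2) by simp
  then have "\<exists>!w. w \<in> homs C D X \<and> w \<cdot> \<gamma> = u \<cdot> \<gamma> \<and> w \<cdot> \<delta> = u \<cdot> \<delta>"
    using uv(1) assms(4) d(1) by (intro un) (auto intro: Comp_closed)
  with uv show "u = v" by metis
qed

lemma iso_biproduct_zero:
  assumes "f \<in> homs C A B" "g \<in> homs C B A" "g \<cdot> f = Ident C A" "f \<cdot> g = Ident C B" "is_zero_object C Z"
  shows "is_biproduct C A Z B f (Zer C Z B) g (Zer C B Z)"
proof -
  note [simp] = homsD[OF assms(1)] homsD[OF assms(2)] assms(3,4)
  have [simp]: "Z \<in> Obj C" using assms(5) by (simp add: is_zero_object_def)
  have "Ident C Z \<in> homs C Z Z" "Zer C Z Z \<in> homs C Z Z" by (simp_all add: homs_iff)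
  moreover have "\<exists>!f. f \<in> homs C Z Z" using assms(5) by (auto simp: is_zero_object_def)
  ultimately have "Ident C Z = Zer C Z Z" by blast
  thus ?thesis by (simp add: is_biproduct_def homs_iff)
qed

end

context exact_category
begin

lemma sesD:
  assumes "(i, p) \<in> ses C E X Y Z"
  shows "i \<in> homs C X Y" "p \<in> homs C Y Z" "(i, p) \<in> E" "p \<cdot> i = Zer C X Z"
    "is_kernel C i p" "is_cokernel C p i"
proof -
  show *: "i \<in> homs C X Y" "p \<in> homs C Y Z" "(i, p) \<in> E"
    using assms by (auto simp: ses_def)
  show "is_kernel C i p" "is_cokernel C p i" using kernel_cokernel_pair[OF *(3)] by auto
  thus "p \<cdot> i = Zer C X Z" using * by (auto simp: is_kernel_def homs_iff)
qed

lemma ses_lift: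
  assumes "(i, p) \<in> ses C E X Y Z" "f \<in> homs C A Y" "p \<cdot> f = Zer C A Z"
  shows "\<exists>u \<in> homs C A X. i \<cdot> u = f"
proof -
  note s = sesD[OF assms(1)]
  note [simp] = homsD[OF s(1)] homsD[OF s(2)] 
  have "\<exists>!u. u \<in> homs C A X \<and> i \<cdot> u = f"
    using s(5) assms(2,3) unfolding is_kernel_def by simp
  thus ?thesis by blast
qed

lemma ses_mono:
  assumes "(i, p) \<in> ses C E X Y Z" "u \<in> homs C A X" "v \<in> homs C A X" "i \<cdot> u = i \<cdot> v"
  shows "u = v"
proof -
  note s = sesD[OF assms(1)]
  note [simp] = homsD[OF s(1)] homsD[OF s(2)] homsD[OF assms(2)]
  have "i \<cdot> u \<in> homs C A Y" "p \<cdot> (i \<cdot> u) = Zer C A Z"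
    using s(4) by (simp_all add: homs_iff sq_ext)
  then have "\<exists>!w. w \<in> homs C A X \<and> i \<cdot> w = i \<cdot> u"
    using s(5) unfolding is_kernel_def by auto
  thus ?thesis using assms by metis
qed

lemma ses_desc:
  assumes "(i, p) \<in> ses C E X Y Z" "f \<in> homs C Y A" "f \<cdot> i = Zer C X A"
  shows "\<exists>u \<in> homs C Z A. u \<cdot> p = f"
proof -
  note s = sesD[OF assms(1)]
  note [simp] = homsD[OF s(1)] homsD[OF s(2)] 
  have "\<exists>!u. u \<in> homs C Z A \<and> u \<cdot> p = f"
    using s(6) assms(2,3) unfolding is_cokernel_def by simp
  thus ?thesis by blast
qed

lemma ses_epi:
  assumes "(i, p) \<in> ses C E X Y Z" "u \<in> homs C Z A" "v \<in> homs C Z A" "u \<cdot> p = v \<cdot> p"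
  shows "u = v"
proof -
  note s = sesD[OF assms(1)]
  note [simp] = homsD[OF s(1)] homsD[OF s(2)] homsD[OF assms(2)]
  have "u \<cdot> p \<in> homs C Y A" "(u \<cdot> p) \<cdot> i = Zer C X A"
    using s(4) by (simp_all add: homs_iff sq_ext)
  then have "\<exists>!w. w \<in> homs C Z A \<and> w \<cdot> p = u \<cdot> p"
    using s(6) unfolding is_cokernel_def by auto
  thus ?thesis using assms by metis
qed

text \<open>
  The second component of a short exact sequence may be any cokernel of the first, because cokernels
  are unique up to isomorphism and the exact structure is closed under isomorphisms.
\<close>

lemma ses_cokernelI:
  assumes "admissible_mono E i" "i \<in> homs C X Y" "p \<in> homs C Y Z" "p \<cdot> i = Zer C X Z"
    and ex: "\<And>A f. \<lbrakk>f \<in> homs C Y A; f \<cdot> i = Zer C X A\<rbrakk> \<Longrightarrow> \<exists>u \<in> homs C Z A. u \<cdot> p = f"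
    and un: "\<And>A u v. \<lbrakk>u \<in> homs C Z A; v \<in> homs C Z A; u \<cdot> p = v \<cdot> p\<rbrakk> \<Longrightarrow> u = v"
  shows "(i, p) \<in> ses C E X Y Z"
proof -
  note [simp] = homsD[OF assms(2)] homsD[OF assms(3)]
  obtain p0 where p0: "(i, p0) \<in> E" using assms(1) by (auto simp: admissible_mono_def)
  moreover have "is_kernel C i p0" using kernel_cokernel_pair[OF p0] by simp
  ultimately obtain Z0 where s: "(i, p0) \<in> ses C E X Y Z0"
    by (auto simp: ses_def homs_iff is_kernel_def)
  note d = sesD[OF s]
  note [simp] = homsD[OF d(2)]
  obtain a where a: "a \<in> homs C Z0 Z" "a \<cdot> p0 = p"
    using ses_desc[OF s assms(3,4)] by blast
  obtain b where b: "b \<in> homs C Z Z0" "b \<cdot> p = p0"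
    using ex[OF d(2,4)] by blast
  note [simp] = homsD[OF a(1)] homsD[OF b(1)] a(2) b(2)
  have "b \<cdot> a = Ident C Z0"
    by (rule ses_epi[OF s, of _ Z0]) (simp_all add: homs_iff)
  moreover have "a \<cdot> b = Ident C Z"
    by (rule un[of _ Z]) (simp_all add: homs_iff)
  ultimately have "is_iso C a"
    using b(1) by (auto simp: is_iso_def)
  moreover have "is_iso C (Ident C A)" if "A \<in> Obj C" for A
    using that by (auto simp: is_iso_def homs_iff intro: bexI[of _ "Ident C A"])
  ultimately have "seq_iso C (i, p0) (i, p)"
    unfolding seq_iso_def prod.case
    by (intro conjI, simp_all add: is_composable_def)
      (rule exI[of _ "Ident C X"], rule conjI, simp, rule exI[of _ "Ident C Y"], rule conjI, simp,
       rule exI[of _ a], simp add: homs_iff)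
  from iso_closed[OF d(3) this] show ?thesis using assms(2,3) by (simp add: ses_def)
qed

text \<open>
  An isomorphism is the first injection of a biproduct with a zero object.
\<close>

lemma admissible_mono_iso:
  assumes "f \<in> homs C A B" "g \<in> homs C B A" "g \<cdot> f = Ident C A" "f \<cdot> g = Ident C B"
  shows "admissible_mono E f"
  using ex_zero_object iso_biproduct_zero[OF assms] split_exact
  unfolding admissible_mono_def by blast

text \<open>
  A pushout square of an inflation induces a map of short exact sequences that is the identity on
  the cokernels. This holds for every pushout square, not only for the one given by the axiom, since
  two pushouts differ by an isomorphism.
\<close>

lemma pushout_inflation:
  assumes s: "(i, p) \<in> ses C E A B K" and po: "is_pushout C i f f' i'"
    and f: "f \<in> homs C A A'" "f' \<in> homs C B B'"
  shows "\<exists>p'. (i', p') \<in> ses C E A' B' K \<and> p' \<cdot> f' = p"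
proof -
  note d = sesD[OF s]
  note P = pushoutD[OF po d(1) f]
  note [simp] = homsD[OF d(1)] homsD[OF d(2)] homsD[OF f(1)] homsD[OF f(2)] homsD[OF P(1)]
  have adm: "admissible_mono E i'"
  proof -
    have "admissible_mono E i" using d(3) by (auto simp: admissible_mono_def)
    then obtain f1 i1 where po1: "is_pushout C i f f1 i1" and a1: "admissible_mono E i1"
      using admissible_mono_pushout[of i f] by auto
    define B1 where "B1 = Cod C f1"
    have f1: "f1 \<in> homs C B B1"
      using po1 by (auto simp: is_pushout_def is_comm_square_def homs_iff B1_def)
    note P1 = pushoutD[OF po1 d(1) f(1) f1]
    note [simp] = homsD[OF f1] homsD[OF P1(1)]
    obtain u where u: "u \<in> homs C B' B1" "u \<cdot> f' = f1" "u \<cdot> i' = i1"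
      using P(3)[OF f1 P1(1) P1(2)] by blast
    obtain v where v: "v \<in> homs C B1 B'" "v \<cdot> f1 = f'" "v \<cdot> i1 = i'"
      using P1(3)[OF f(2) P(1) P(2)] by blast
    note [simp] = homsD[OF u(1)] homsD[OF v(1)] u(2,3) v(2,3)
    have "u \<cdot> v = Ident C B1" by (rule P1(4)) (simp_all add: homs_iff)
    moreover have "v \<cdot> u = Ident C B'" by (rule P(4)) (simp_all add: homs_iff)
    ultimately have "admissible_mono E v" using admissible_mono_iso[OF v(1) u(1)] by simp
    from admissible_mono_Comp[OF a1 this] show ?thesis by simp
  qed
  obtain p' where p': "p' \<in> homs C B' K" "p' \<cdot> f' = p" "p' \<cdot> i' = Zer C A' K"
    using P(3)[of p K "Zer C A' K"] d(2,4) by (auto simp: homs_iff)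
  note [simp] = homsD[OF p'(1)] p'(2,3)
  have "(i', p') \<in> ses C E A' B' K"
  proof (rule ses_cokernelI[OF adm P(1) p'(1,3)])
    fix X h assume h: "h \<in> homs C B' X" "h \<cdot> i' = Zer C A' X"
    note [simp] = homsD[OF h(1)] h(2)
    have "(h \<cdot> f') \<cdot> i = Zer C A X" using P(2) h(2)[THEN sq_ext] by simp
    then obtain u where u: "u \<in> homs C K X" "u \<cdot> p = h \<cdot> f'"
      using ses_desc[OF s, of "h \<cdot> f'" X] by (auto simp: homs_iff)
    note [simp] = homsD[OF u(1)] u(2)
    have "u \<cdot> p' = h" by (rule P(4)) (simp_all add: homs_iff)
    with u(1) show "\<exists>u \<in> homs C K X. u \<cdot> p' = h" by blast
  next
    fix X u v assume u: "u \<in> homs C K X" and v: "v \<in> homs C K X" and e: "u \<cdot> p' = v \<cdot> p'"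
    note [simp] = homsD[OF u] homsD[OF v]
    have "u \<cdot> p = v \<cdot> p" using sq_ext[OF e, of f'] by simp
    thus "u = v" by (rule ses_epi[OF s u v])
  qed
  with p'(2) show ?thesis by blast
qed

lemma ses_pushout:
  assumes s: "(i, p) \<in> ses C E A B K" and f: "f \<in> homs C A A'"
  obtains B' i' f' p' where "(i', p') \<in> ses C E A' B' K" "f' \<in> homs C B B'" "p' \<cdot> f' = p"
    "is_pushout C i f f' i'"
proof -
  note d = sesD[OF s]
  note [simp] = homsD[OF d(1)] homsD[OF d(2)] homsD[OF f(1)]
  have "admissible_mono E i" using d(3) by (auto simp: admissible_mono_def)
  then obtain f' i' where po: "is_pushout C i f f' i'"
    using admissible_mono_pushout[of i f] by auto
  have f': "f' \<in> homs C B (Cod C f')"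
    using po by (auto simp: is_pushout_def is_comm_square_def homs_iff)
  from pushout_inflation[OF s po f f'] po f' show ?thesis using that by blast
qed

lemma pushout_two:
  assumes i: "(i, p) \<in> ses C E A B K" and j: "(j, q) \<in> ses C E A X L"
  obtains R i' p' j' q' where "(i', p') \<in> ses C E X R K" "(j', q') \<in> ses C E B R L"
    "p' \<cdot> j' = p" "q' \<cdot> i' = q" "is_pushout C i j j' i'"
proof -
  note d = sesD[OF i] and e = sesD[OF j]
  obtain R i' j' p' where *: "(i', p') \<in> ses C E X R K" "j' \<in> homs C B R" "p' \<cdot> j' = p"
    "is_pushout C i j j' i'"
    by (rule ses_pushout[OF i e(1)])
  obtain q' where "(j', q') \<in> ses C E B R L" "q' \<cdot> i' = q"
    using pushout_inflation[OF j is_pushout_swap[OF *(4)] d(1) sesD(1)[OF *(1)]] by blast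
  with * show ?thesis using that by blast
qed

text \<open>
  Noether's isomorphism: for inflations \<open>A \<rightarrowtail> B \<rightarrowtail> X\<close> the cokernels form a short exact sequence
  \<open>B/A \<rightarrowtail> X/A \<twoheadrightarrow> X/B\<close>. The object \<open>X/A\<close> is found as the pushout of \<open>B \<rightarrowtail> X\<close> along \<open>B \<twoheadrightarrow> B/A\<close>,
  and this square is also a pullback.
\<close>

lemma noether:
  assumes i: "(i, p) \<in> ses C E A B K" and j: "(j, q) \<in> ses C E B X L"
  obtains Q r k t where "(j \<cdot> i, r) \<in> ses C E A X Q" "(k, t) \<in> ses C E K Q L"
    "r \<cdot> j = k \<cdot> p" "t \<cdot> r = q" "is_pushout C j p r k" "is_pullback C p j k r"
proof -
  note d = sesD[OF i] and e = sesD[OF j]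
  obtain Q k r t where k: "(k, t) \<in> ses C E K Q L" and r: "r \<in> homs C X Q" and tr: "t \<cdot> r = q"
    and po: "is_pushout C j p r k"
    by (rule ses_pushout[OF j d(2)])
  note P = pushoutD[OF po e(1) d(2) r] and kd = sesD[OF k]
  note [simp] = homsD[OF d(1)] homsD[OF d(2)] homsD[OF e(1)] homsD[OF e(2)] homsD[OF r]
    homsD[OF kd(1)] homsD[OF kd(2)]
  have adm: "admissible_mono E (j \<cdot> i)"
    using admissible_mono_Comp[of i j] d(3) e(3) by (auto simp: admissible_mono_def)
  have rji: "r \<cdot> (j \<cdot> i) = Zer C A Q"
    using sq_ext[OF P(2), of i] d(4) by simp
  have "(j \<cdot> i, r) \<in> ses C E A X Q"
  proof (rule ses_cokernelI[OF adm _ r rji])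
    show "j \<cdot> i \<in> homs C A X" by (simp add: homs_iff)
    fix Z h assume h: "h \<in> homs C X Z" "h \<cdot> (j \<cdot> i) = Zer C A Z"
    note [simp] = homsD[OF h(1)]
    obtain u where u: "u \<in> homs C K Z" "u \<cdot> p = h \<cdot> j"
      using ses_desc[OF i, of "h \<cdot> j" Z] h by (auto simp: homs_iff)
    thus "\<exists>u \<in> homs C Q Z. u \<cdot> r = h" using P(3)[OF h(1) u(1)] by auto
  next
    fix Z u v assume u: "u \<in> homs C Q Z" and v: "v \<in> homs C Q Z" and uv: "u \<cdot> r = v \<cdot> r"
    note [simp] = homsD[OF u] homsD[OF v]
    have "(u \<cdot> k) \<cdot> p = (v \<cdot> k) \<cdot> p"
      using sq_ext[OF uv, of j] P(2) by simp
    hence "u \<cdot> k = v \<cdot> k" by (intro ses_epi[OF i, of "u \<cdot> k" Z "v \<cdot> k"]) (simp_all add: homs_iff)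
    with u v uv show "u = v" by (rule P(4)[of u Z v])
  qed
  moreover have "is_pullback C p j k r"
    unfolding is_pullback_def
  proof (intro conjI allI ballI impI)
    show "is_comm_square C p j k r" using P(2) by (simp add: is_comm_square_def)
    fix Z x y assume x: "x \<in> homs C Z (Dom C k)" and y: "y \<in> homs C Z (Dom C r)" and xy: "k \<cdot> x = r \<cdot> y"
    note [simp] = homsD[OF x] homsD[OF y]
    have "q \<cdot> y = t \<cdot> (r \<cdot> y)" using sq_ext[OF tr, of y] by simp
    also have "\<dots> = Zer C Z L" using xy[symmetric] sq_ext[OF kd(4), of x] by simp
    finally obtain u where u: "u \<in> homs C Z B" "j \<cdot> u = y"
      using ses_lift[OF j, of y] y by auto
    note [simp] = homsD[OF u(1)]
    have "k \<cdot> (p \<cdot> u) = k \<cdot> x"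
      using sq_ext[OF P(2), of u] u(2) xy by simp
    hence "p \<cdot> u = x" using x by (intro ses_mono[OF k, of "p \<cdot> u" Z x]) (simp_all add: homs_iff)
    with u ses_mono[OF j] show "\<exists>!u. u \<in> homs C Z (Dom C p) \<and> p \<cdot> u = x \<and> j \<cdot> u = y"
      by auto
  qed
  ultimately show ?thesis using that k P(2) tr po by blast
qed

lemma ses_section:
  assumes s: "(i, p) \<in> ses C E A B K" and "s \<in> homs C K B" "p \<cdot> s = Ident C K"
  shows "\<exists>r. is_biproduct C A K B i s r p"
proof -
  note d = sesD[OF s]
  note [simp] = homsD[OF d(1)] homsD[OF d(2)] homsD[OF assms(2)] assms(3) d(4) assms(3)[THEN sq_ext]
    d(4)[THEN sq_ext]
  have "p \<cdot> (Ident C B \<boxminus> s \<cdot> p) = Zer C B K"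
    by (simp add: comp_diff_right)
  then obtain r where r: "r \<in> homs C B A" "i \<cdot> r = Ident C B \<boxminus> s \<cdot> p"
    using ses_lift[OF s, of "Ident C B \<boxminus> s \<cdot> p" B] by (auto simp: homs_iff)
  note [simp] = homsD[OF r(1)]
  have "r \<cdot> i = Ident C A"
    by (rule ses_mono[OF s, of _ A]) (simp_all add: homs_iff sq_ext[OF r(2)] comp_diff_left)
  moreover have "r \<cdot> s = Zer C K A"
    by (rule ses_mono[OF s, of _ K]) (simp_all add: homs_iff sq_ext[OF r(2)] comp_diff_left)
  moreover have "(i \<cdot> r) \<boxplus> (s \<cdot> p) = Ident C B"
    by (simp add: r(2) diff_plus)
  ultimately show ?thesis using r(1) d(1,2) assms(2)
    by (auto simp: is_biproduct_def)
qed

lemma exact_dual: "exact_category (op C) (op_seqs E)"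
  by (rule exact_op) unfold_locales

lemma pullbackD:
  assumes "is_pullback C \<alpha> \<beta> \<gamma> \<delta>" "\<gamma> \<in> homs C B D" "\<delta> \<in> homs C B' D" "\<alpha> \<in> homs C A B"
  shows "\<beta> \<in> homs C A B'" "\<gamma> \<cdot> \<alpha> = \<delta> \<cdot> \<beta>"
    "\<lbrakk>x \<in> homs C X B; y \<in> homs C X B'; \<gamma> \<cdot> x = \<delta> \<cdot> y\<rbrakk> \<Longrightarrow> \<exists>u \<in> homs C X A. \<alpha> \<cdot> u = x \<and> \<beta> \<cdot> u = y"
    "\<lbrakk>u \<in> homs C X A; v \<in> homs C X A; \<alpha> \<cdot> u = \<alpha> \<cdot> v; \<beta> \<cdot> u = \<beta> \<cdot> v\<rbrakk> \<Longrightarrow> u = v"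
proof -
  interpret dual: exact_category "op C" "op_seqs E" by (rule exact_dual)
  have po: "is_pushout (op C) \<gamma> \<delta> \<alpha> \<beta>"
    using is_pushout_swap[of "op C" \<delta> \<gamma> \<beta> \<alpha>] assms(1) by (simp add: is_pushout_op)
  note P = dual.pushoutD[OF po, simplified, OF assms(2,3,4)]
  show "\<beta> \<in> homs C A B'" "\<gamma> \<cdot> \<alpha> = \<delta> \<cdot> \<beta>" 
    "\<lbrakk>x \<in> homs C X B; y \<in> homs C X B'; \<gamma> \<cdot> x = \<delta> \<cdot> y\<rbrakk> \<Longrightarrow> \<exists>u \<in> homs C X A. \<alpha> \<cdot> u = x \<and> \<beta> \<cdot> u = y"
    "\<lbrakk>u \<in> homs C X A; v \<in> homs C X A; \<alpha> \<cdot> u = \<alpha> \<cdot> v; \<beta> \<cdot> u = \<beta> \<cdot> v\<rbrakk> \<Longrightarrow> u = v"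
    using P by blast+
qed

lemma ses_pullback:
  assumes s: "(i, p) \<in> ses C E K B A" and f: "f \<in> homs C A' A"
  obtains B' i' f' p' where "(i', p') \<in> ses C E K B' A'" "f' \<in> homs C B' B" "f' \<cdot> i' = i"
    "is_pullback C p' f' f p"
proof -
  interpret dual: exact_category "op C" "op_seqs E" by (rule exact_dual)
  have s': "(p, i) \<in> ses (op C) (op_seqs E) A B K" and f': "f \<in> homs (op C) A A'" using s f by simp_all
  show ?thesis
    by (rule dual.ses_pushout[OF s' f']) (auto simp: is_pushout_op intro: that)
qed

lemma noether_dual:
  assumes i: "(i, p) \<in> ses C E V U Y" and c: "(c, m) \<in> ses C E K Y M"
  obtains N v n \<nu> where "(\<nu>, m \<cdot> p) \<in> ses C E N U M" "(v, n) \<in> ses C E V N K"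
    "p \<cdot> \<nu> = c \<cdot> n" "\<nu> \<cdot> v = i" "is_pullback C n \<nu> c p" "is_pushout C \<nu> n p c"
proof -
  interpret dual: exact_category "op C" "op_seqs E" by (rule exact_dual)
  have c': "(m, c) \<in> ses (op C) (op_seqs E) M Y K" and i': "(p, i) \<in> ses (op C) (op_seqs E) Y U V"
    using i c by simp_all
  show ?thesis
  proof (rule dual.noether[OF c' i'])
    fix Q r k t
    assume "(Comp (op C) p m, r) \<in> ses (op C) (op_seqs E) M U Q" "(k, t) \<in> ses (op C) (op_seqs E) K Q V"
      "Comp (op C) r p = Comp (op C) k c" "Comp (op C) t r = i" "is_pushout (op C) p c r k"
      "is_pullback (op C) c p k r"
    thus ?thesis using that[of r Q t k] by (simp add: is_pushout_op is_pullback_op)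
  qed
qed

lemma ses_retraction:
  assumes s: "(i, p) \<in> ses C E A B K" and "r \<in> homs C B A" "r \<cdot> i = Ident C A"
  shows "\<exists>s. is_biproduct C A K B i s r p"
proof -
  interpret dual: exact_category "op C" "op_seqs E" by (rule exact_dual)
  have s': "(p, i) \<in> ses (op C) (op_seqs E) K B A" using s by simp
  have "\<exists>s. is_biproduct (op C) K A B p r s i"
    by (rule dual.ses_section[OF s']) (use assms in simp_all)
  then obtain s where "is_biproduct C K A B s i p r" by (auto simp: is_biproduct_op)
  from biproduct_swap[OF this] show ?thesis by blast
qed

text \<open>
  Let \<open>M\<close> be a pushout of an inflation \<open>w : A \<rightarrowtail> X\<close> along \<open>\<alpha>\<close>, presented as a map of short exact
  sequences. Then \<open>(-\<alpha>, w)\<close> is an inflation into \<open>B \<oplus> X\<close> with cokernel \<open>M\<close>. The biproduct appears as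
  the pullback of \<open>X\<close> and \<open>M\<close> over their common quotient, which is split over \<open>X\<close> by \<open>w'\<close>.
\<close>

lemma ses_graph:
  assumes w: "(w, s) \<in> ses C E A X S0" and k: "(k, t) \<in> ses C E B M S0"
    and a: "\<alpha> \<in> homs C A B" and w': "w' \<in> homs C X M" "t \<cdot> w' = s" "w' \<cdot> w = k \<cdot> \<alpha>"
  obtains a q R i1 i2 p1 p2 where "(a, q) \<in> ses C E A R M" "is_biproduct C B X R i1 i2 p1 p2"
    "p1 \<cdot> a = neg C \<alpha>" "p2 \<cdot> a = w" "q \<cdot> i1 = k" "q \<cdot> i2 = w'"
proof -
  interpret dual: exact_category "op C" "op_seqs E" by (rule exact_dual)
  have ws: "(s, w) \<in> ses (op C) (op_seqs E) S0 X A" "(t, k) \<in> ses (op C) (op_seqs E) S0 M B"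
    using w k by simp_all
  have "\<exists>R i' p' j' q'. (p', i') \<in> ses C E B R X \<and> (q', j') \<in> ses C E A R M \<and>
    i' \<cdot> q' = w \<and> j' \<cdot> p' = k \<and> is_pushout (op C) s t i' j'"
    by (rule dual.pushout_two[OF ws]) (simp only: ses_op op_simps, blast)
  then obtain R i' p' j' q' where r: "(p', i') \<in> ses C E B R X" "(q', j') \<in> ses C E A R M"
    "i' \<cdot> q' = w" "j' \<cdot> p' = k" and "is_pushout (op C) s t i' j'" by blast
  then have pb: "is_pullback C i' j' s t"
    using is_pushout_swap[of "op C" s t i' j'] by (simp add: is_pushout_op)
  note wd = sesD[OF w] and kd = sesD[OF k] and rd = sesD[OF r(1)] and qd = sesD[OF r(2)]
  note [simp] = homsD[OF wd(1)] homsD[OF wd(2)] homsD[OF kd(1)] homsD[OF kd(2)] homsD[OF rd(1)] homsD[OF rd(2)]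
    homsD[OF qd(1)] homsD[OF qd(2)] homsD[OF a] homsD[OF w'(1)]
  note P = pullbackD[OF pb wd(2) kd(2) rd(2)]
  obtain u where u: "u \<in> homs C X R" "i' \<cdot> u = Ident C X" "j' \<cdot> u = w'"
    using P(3)[of "Ident C X" X w'] w' by (auto simp: homs_iff)
  obtain r where b: "is_biproduct C B X R p' u r i'"
    using ses_section[OF r(1) u(1,2)] by blast
  note bd = biproductD[OF b]
  note [simp] = homsD[OF u(1)] homsD[OF bd(6)]
  have "k \<cdot> (r \<cdot> q') \<boxplus> w' \<cdot> w = j' \<cdot> (((p' \<cdot> r) \<boxplus> (u \<cdot> i')) \<cdot> q')"
    by (simp add: comp_plus_left comp_plus_right r(3) sq_ext[OF r(4)] sq_ext[OF u(3)])
  also have "\<dots> = Zer C A M" by (simp add: bd(12) qd(4))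
  finally have "k \<cdot> (r \<cdot> q' \<boxplus> \<alpha>) = k \<cdot> Zer C A B"
    by (simp add: comp_plus_right w'(3))
  then have "r \<cdot> q' \<boxplus> \<alpha> = Zer C A B" by (rule ses_mono[OF k, rotated 2]) (simp_all add: homs_iff)
  then have "\<alpha> \<boxplus> r \<cdot> q' = Zer C A B" by (subst plus_comm) simp_all
  then have "r \<cdot> q' = neg C \<alpha>" by (intro neg_unique) simp_all
  from that[OF r(2) b this r(3,4) u(3)] show ?thesis .
qed

lemma ses_graph_dual:
  assumes w: "(v, w) \<in> ses C E V0 Y D" and x: "(v', x) \<in> ses C E V0 N X"
    and f: "f \<in> homs C X D" and y: "y \<in> homs C N Y" "y \<cdot> v' = v" "w \<cdot> y = f \<cdot> x"
  obtains n a R i1 i2 p1 p2 where "(n, a) \<in> ses C E N R D" "is_biproduct C X Y R i1 i2 p1 p2"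
    "a \<cdot> i1 = neg C f" "a \<cdot> i2 = w"
proof -
  interpret dual: exact_category "op C" "op_seqs E" by (rule exact_dual)
  have o: "(w, v) \<in> ses (op C) (op_seqs E) D Y V0" "(x, v') \<in> ses (op C) (op_seqs E) X N V0"
    "f \<in> homs (op C) D X" "y \<in> homs (op C) Y N" "Comp (op C) v' y = v" "Comp (op C) y w = Comp (op C) x f"
    using assms by simp_all
  show ?thesis
    by (rule dual.ses_graph[OF o]) (rule that; simp add: is_biproduct_op)
qed

end

section \<open>Cotorsion pairs\<close>

text \<open>
  A self-dual description of a cotorsion pair in which the vanishing of the extension group is
  expressed by splittings.
\<close>

definition cotorsion_split :: "('o, 'm) addcat \<Rightarrow> ('m \<times> 'm) set \<Rightarrow> 'o set \<Rightarrow> 'o set \<Rightarrow> bool"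
  where "cotorsion_split C E \<X> \<Y> \<longleftrightarrow> \<X> \<subseteq> Obj C \<and> \<Y> \<subseteq> Obj C \<and> summand_closed C \<X> \<and> summand_closed C \<Y> \<and>
    (\<forall>A \<in> \<X>. \<forall>B \<in> \<Y>. \<forall>Z i p. (i, p) \<in> ses C E B Z A \<longrightarrow>
       (\<exists>s \<in> homs C A Z. p \<cdot>\<^bsub>C\<^esub> s = Ident C A)) \<and>
    (\<forall>B \<in> Obj C. (\<exists>Y \<in> \<Y>. \<exists>X \<in> \<X>. ses C E Y X B \<noteq> {}) \<and> (\<exists>Y \<in> \<Y>. \<exists>X \<in> \<X>. ses C E B Y X \<noteq> {}))"

lemma ses_op_nonempty: "ses (op C) (op_seqs E) Z Y X \<noteq> {} \<longleftrightarrow> ses C E X Y Z \<noteq> {}"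
  by (auto simp: ses_def op_seqs_def)

lemma summand_closed_op [simp]: "summand_closed (op C) X \<longleftrightarrow> summand_closed C X"
proof -
  have "is_direct_summand (op C) A B \<longleftrightarrow> is_direct_summand C A B" for A B
    unfolding is_direct_summand_def is_biproduct_op by blast
  thus ?thesis by (simp add: summand_closed_def)
qed

text \<open>
  All extensions are equivalent to the biproduct extension, whose deflation has a section; an
  equivalence transports that section.
\<close>

lemma cotorsion_pair_imp_cot:
  fixes C (structure)
  assumes "exact_category C E" "cotorsion_pair C E \<X> \<Y>"
  shows "cotorsion_split C E \<X> \<Y>"
proof -
  interpret exact_category C E by fact
  have sub: "\<X> \<subseteq> Obj C" "\<Y> \<subseteq> Obj C" using assms(2) by (auto simp: cotorsion_pair_def full_additive_subcat_def)
  have "\<exists>s \<in> homs C A Z. p \<cdot> s = Ident C A"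
    if A: "A \<in> \<X>" and B: "B \<in> \<Y>" and s: "(i, p) \<in> ses C E B Z A" for A B Z i p
  proof -
    have ob: "A \<in> Obj C" "B \<in> Obj C" using A B sub by auto
    then obtain X i1 i2 p1 p2 where b: "is_biproduct C B A X i1 i2 p1 p2" using ex_biproduct by blast
    note bd = biproductD[OF b] and d = sesD[OF s]
    note [simp] = homsD[OF bd(5)] homsD[OF bd(7)] homsD[OF d(1)] homsD[OF d(2)]
    let ?r = "ext_equiv C E A B"
    have e1: "(i1, p2) \<in> extensions C E A B"
      using split_exact[OF b] bd by (auto simp: extensions_def ses_def)
    have e2: "(i, p) \<in> extensions C E A B"
      using s homsD(5)[OF d(1)] by (auto simp: extensions_def)
    have "is_iso C (Ident C Z)"
      by (auto simp: is_iso_def homs_iff intro: bexI[of _ "Ident C Z"])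
    then have refl: "((i, p), (i, p)) \<in> ?r"
      using e2 by (auto simp: ext_equiv_def homs_iff intro!: bexI[of _ "Ident C Z"])
    have "is_singleton (Ext1 C E A B)"
      using assms(2) A B by (auto simp: cotorsion_pair_def Ext1_zero_def)
    moreover have "?r `` {(i1, p2)} \<in> Ext1 C E A B" "?r `` {(i, p)} \<in> Ext1 C E A B"
      using e1 e2 by (auto simp: Ext1_def quotientI)
    ultimately have "?r `` {(i1, p2)} = ?r `` {(i, p)}"
      by (auto simp: is_singleton_def)
    with refl have "((i1, p2), (i, p)) \<in> ?r" by blast
    then obtain h where h: "h \<in> homs C X Z" "p \<cdot> h = p2"
      using homsD[OF bd(4)] by (auto simp: ext_equiv_def)
    note [simp] = homsD[OF h(1)]
    have "h \<cdot> i2 \<in> homs C A Z" "p \<cdot> (h \<cdot> i2) = Ident C A"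
      using h(2)[THEN sq_ext] bd(9) by (auto simp: homs_iff)
    thus ?thesis by blast
  qed
  with assms(2) sub show ?thesis unfolding cotorsion_split_def cotorsion_pair_def by blast
qed

context exact_category
begin

lemma cot_section:
  assumes "cotorsion_split C E \<X> \<Y>" "A \<in> \<X>" "B \<in> \<Y>" "(i, p) \<in> ses C E B Z A"
  shows "\<exists>s \<in> homs C A Z. p \<cdot> s = Ident C A"
  using assms unfolding cotorsion_split_def by blast

lemma cot_dual:
  assumes "cotorsion_split C E \<X> \<Y>"
  shows "cotorsion_split (op C) (op_seqs E) \<Y> \<X>"
proof -
  have "\<exists>s \<in> homs C Z A. s \<cdot> p = Ident C A"
    if A: "A \<in> \<Y>" and B: "B \<in> \<X>" and s: "(p, i) \<in> ses C E A Z B" for A B Z i p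
  proof -
    obtain s where "s \<in> homs C B Z" "i \<cdot> s = Ident C B"
      using cot_section[OF assms B A s] by blast
    from ses_section[OF s this] obtain r where b: "is_biproduct C A B Z p s r i" by blast
    show ?thesis using biproductD(6,8)[OF b] by blast
  qed
  thus ?thesis using assms unfolding cotorsion_split_def ses_op_nonempty summand_closed_op
    by simp blast
qed

lemma cotD:
  assumes "cotorsion_split C E \<X> \<Y>"
  shows "\<X> \<subseteq> Obj C" "\<Y> \<subseteq> Obj C"
    "\<lbrakk>is_biproduct C A B X i1 i2 p1 p2; X \<in> \<X>\<rbrakk> \<Longrightarrow> A \<in> \<X>"
proof -
  have *: "\<X> \<subseteq> Obj C" "\<Y> \<subseteq> Obj C" "summand_closed C \<X>" using assms by (auto simp: cotorsion_split_def)
  show "\<X> \<subseteq> Obj C" "\<Y> \<subseteq> Obj C" by (fact *(1) *(2))+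
  show "\<lbrakk>is_biproduct C A B X i1 i2 p1 p2; X \<in> \<X>\<rbrakk> \<Longrightarrow> A \<in> \<X>"
    using *(3) unfolding summand_closed_def is_direct_summand_def by blast
qed

lemma cot_cover:
  assumes "cotorsion_split C E \<X> \<Y>" "B \<in> Obj C"
  obtains X Y i p where "X \<in> \<X>" "Y \<in> \<Y>" "(i, p) \<in> ses C E Y X B"
  using assms unfolding cotorsion_split_def by fastforce

lemma cot_envelope:
  assumes "cotorsion_split C E \<X> \<Y>" "B \<in> Obj C"
  obtains X Y i p where "X \<in> \<X>" "Y \<in> \<Y>" "(i, p) \<in> ses C E B Y X"
  using assms unfolding cotorsion_split_def by fastforce

text \<open>
  The pullback of the given sequence along \<open>f\<close> splits.
\<close>

lemma cot_lift:
  assumes c: "cotorsion_split C E \<X> \<Y>" and A: "A \<in> \<X>" "B \<in> \<Y>" and s: "(i, p) \<in> ses C E B Z K" and f: "f \<in> homs C A K"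
  shows "\<exists>g \<in> homs C A Z. p \<cdot> g = f"
proof -
  obtain B' i' f' p' where *: "(i', p') \<in> ses C E B B' A" "f' \<in> homs C B' Z" "f' \<cdot> i' = i"
    "is_pullback C p' f' f p"
    by (rule ses_pullback[OF s f])
  obtain t where t: "t \<in> homs C A B'" "p' \<cdot> t = Ident C A"
    using cot_section[OF c A *(1)] by blast
  note P = pullbackD[OF *(4) f sesD(2)[OF s] sesD(2)[OF *(1)]] and sd = sesD[OF s] sesD[OF *(1)]
  note [simp] = homsD[OF sd(2)] homsD[OF f] homsD[OF *(2)] homsD[OF t(1)] homsD[OF sd(8)]
  have "p \<cdot> (f' \<cdot> t) = f" using sq_ext[OF P(2)[symmetric], of t] t(2) by simp
  moreover have "f' \<cdot> t \<in> homs C A Z" by (simp add: homs_iff)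
  ultimately show ?thesis by blast
qed

lemma cot_extend:
  assumes c: "cotorsion_split C E \<X> \<Y>" and A: "A \<in> \<X>" "B \<in> \<Y>" and s: "(i, p) \<in> ses C E K Z A" and f: "f \<in> homs C K B"
  shows "\<exists>g \<in> homs C Z B. g \<cdot> i = f"
proof -
  interpret dual: exact_category "op C" "op_seqs E" by (rule exact_dual)
  show ?thesis using dual.cot_lift[OF cot_dual[OF c] A(2,1), of p i Z K f] s f by simp
qed

text \<open>
  Idempotents need not split in an arbitrary exact category, so a retract is turned into a direct
  summand by lifting it to a cover from the left-hand class.
\<close>

lemma cot_retract_left:
  assumes c: "cotorsion_split C E \<X> \<Y>" and f: "f \<in> homs C A B" and g: "g \<in> homs C B A" and gf: "g \<cdot> f = Ident C A"
    and B: "B \<in> \<X>"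
  shows "A \<in> \<X>"
proof -
  have "A \<in> Obj C" using homsD[OF f] by simp
  then obtain X Y i p where *: "X \<in> \<X>" "Y \<in> \<Y>" "(i, p) \<in> ses C E Y X A" by (rule cot_cover[OF c])
  obtain h where h: "h \<in> homs C B X" "p \<cdot> h = g" using cot_lift[OF c B *(2,3) g] by blast
  note [simp] = homsD[OF f] homsD[OF g] homsD[OF h(1)] homsD[OF sesD(2)[OF *(3)]]
  have "p \<cdot> (h \<cdot> f) = Ident C A" using sq_ext[OF h(2), of f] gf by simp
  moreover have "h \<cdot> f \<in> homs C A X" by (simp add: homs_iff)
  ultimately obtain r where "is_biproduct C Y A X i (h \<cdot> f) r p" using ses_section[OF *(3)] by blast
  from cotD(3)[OF c biproduct_swap[OF this] *(1)] show ?thesis .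
qed

lemma cot_retract_right:
  assumes c: "cotorsion_split C E \<X> \<Y>" and f: "f \<in> homs C A B" and g: "g \<in> homs C B A" and gf: "g \<cdot> f = Ident C A"
    and B: "B \<in> \<Y>"
  shows "A \<in> \<Y>"
proof -
  interpret dual: exact_category "op C" "op_seqs E" by (rule exact_dual)
  show ?thesis using dual.cot_retract_left[OF cot_dual[OF c], of g A B f] f g gf B by simp
qed

text \<open>
  For a cover \<open>Y \<rightarrowtail> X \<twoheadrightarrow> Z\<close> the preimage \<open>N\<close> of \<open>A\<close> retracts onto \<open>Y\<close>, and this retraction
  extends along \<open>N \<rightarrowtail> X \<twoheadrightarrow> K\<close>. So the cover splits and \<open>Z\<close> is a summand of \<open>X\<close>.
\<close>

lemma cot_ext_closed_left:
  assumes c: "cotorsion_split C E \<X> \<Y>" and s: "(i, p) \<in> ses C E A Z K" and AK: "A \<in> \<X>" "K \<in> \<X>"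
  shows "Z \<in> \<X>"
proof -
  note d = sesD[OF s]
  have Z: "Z \<in> Obj C" using homsD[OF d(1)] by simp
  then obtain X Y \<iota> \<pi> where x: "X \<in> \<X>" "Y \<in> \<Y>" "(\<iota>, \<pi>) \<in> ses C E Y X Z" by (rule cot_cover[OF c])
  obtain N v n \<nu> where n: "(\<nu>, p \<cdot> \<pi>) \<in> ses C E N X K" "(v, n) \<in> ses C E Y N A" "\<nu> \<cdot> v = \<iota>"
    using noether_dual[OF x(3) s] by metis
  note nd = sesD[OF n(2)] and \<nu>d = sesD[OF n(1)] and xd = sesD[OF x(3)]
  note [simp] = homsD[OF nd(1)] homsD[OF \<nu>d(1)] homsD[OF xd(1)] homsD[OF xd(2)]
  have "\<exists>g \<in> homs C N Y. g \<cdot> v = Ident C Y"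
    by (rule cot_extend[OF c AK(1) x(2) n(2)]) (simp add: homs_iff)
  then obtain r where r: "r \<in> homs C N Y" "r \<cdot> v = Ident C Y" by blast
  obtain r' where r': "r' \<in> homs C X Y" "r' \<cdot> \<nu> = r"
    using cot_extend[OF c AK(2) x(2) n(1) r(1)] by blast
  note [simp] = homsD[OF r'(1)]
  have "r' \<cdot> \<iota> = Ident C Y" using sq_ext[OF r'(2), of v] n(3) r(2) by simp
  from ses_retraction[OF x(3) r'(1) this] obtain t where "is_biproduct C Y Z X \<iota> t r' \<pi>" by blast
  from cotD(3)[OF c biproduct_swap[OF this] x(1)] show ?thesis .
qed

lemma cot_ext_closed_right:
  assumes c: "cotorsion_split C E \<X> \<Y>" and s: "(i, p) \<in> ses C E A Z K" and AK: "A \<in> \<Y>" "K \<in> \<Y>"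
  shows "Z \<in> \<Y>"
proof -
  interpret dual: exact_category "op C" "op_seqs E" by (rule exact_dual)
  show ?thesis by (rule dual.cot_ext_closed_left[OF cot_dual[OF c], of p i K Z A]) (use s AK in simp_all)
qed

lemma cot_biproduct:
  assumes c: "cotorsion_split C E \<X> \<Y>" and b: "is_biproduct C A B X i1 i2 p1 p2"
  shows "A \<in> \<X> \<Longrightarrow> B \<in> \<X> \<Longrightarrow> X \<in> \<X>" "A \<in> \<Y> \<Longrightarrow> B \<in> \<Y> \<Longrightarrow> X \<in> \<Y>"
proof -
  have s: "(i1, p2) \<in> ses C E A X B" using split_exact[OF b] biproductD[OF b] by (simp add: ses_def)
  show "A \<in> \<X> \<Longrightarrow> B \<in> \<X> \<Longrightarrow> X \<in> \<X>" "A \<in> \<Y> \<Longrightarrow> B \<in> \<Y> \<Longrightarrow> X \<in> \<Y>"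
    using cot_ext_closed_left[OF c s] cot_ext_closed_right[OF c s] by auto
qed

lemma cot_zero:
  assumes c: "cotorsion_split C E \<X> \<Y>" and Z: "is_zero_object C Z"
  shows "Z \<in> \<X>" "Z \<in> \<Y>"
proof -
  have [simp]: "Z \<in> Obj C" using Z by (simp add: is_zero_object_def)
  then obtain X Y i p where *: "X \<in> \<X>" "Y \<in> \<Y>" "(i, p) \<in> ses C E Y X Z" by (rule cot_cover[OF c])
  have [simp]: "X \<in> Obj C" "Y \<in> Obj C" using * cotD(1,2)[OF c] by auto
  have "Zer C Z Z \<in> homs C Z Z" "Ident C Z \<in> homs C Z Z" by (simp_all add: homs_iff)
  moreover have "\<exists>!f. f \<in> homs C Z Z" using Z by (simp add: is_zero_object_def)
  ultimately have e: "Zer C Z Z = Ident C Z" by blast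
  show "Z \<in> \<X>" by (rule cot_retract_left[OF c _ _ _ *(1), of "Zer C Z X" Z "Zer C X Z"]) (simp_all add: homs_iff e)
  show "Z \<in> \<Y>" by (rule cot_retract_right[OF c _ _ _ *(2), of "Zer C Z Y" Z "Zer C Y Z"]) (simp_all add: homs_iff e)
qed

end

section \<open>Twin cotorsion pairs\<close>

locale twin = exact_category C E for C :: "('o, 'm) addcat" (structure) and E +
  fixes S T U V :: "'o set"
  assumes ST: "cotorsion_split C E S T" and UV: "cotorsion_split C E U V" and SU: "S \<subseteq> U"
begin

abbreviation W where "W \<equiv> twin_core T U"
abbreviation Bp where "Bp \<equiv> B_plus C E T U V"
abbreviation Bm where "Bm \<equiv> B_minus C E S T U"
abbreviation H where "H \<equiv> Bp \<inter> Bm"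

lemma in_W: "X \<in> W \<longleftrightarrow> X \<in> T \<and> X \<in> U"
  by (simp add: twin_core_def)

lemma W_Obj: "X \<in> W \<Longrightarrow> X \<in> Obj C"
  using cotD(1,2)[OF ST] cotD(1,2)[OF UV] by (auto simp: in_W)

text \<open>
  The envelope \<open>X \<rightarrowtail> T0 \<twoheadrightarrow> S0\<close> of an object of \<open>V\<close> splits, because \<open>S0\<close> lies in \<open>U\<close>.
\<close>

lemma VT: "V \<subseteq> T"
proof
  fix X assume X: "X \<in> V"
  hence [simp]: "X \<in> Obj C" using cotD(2)[OF UV] by auto
  then obtain S0 T0 i p where *: "S0 \<in> S" "T0 \<in> T" "(i, p) \<in> ses C E X T0 S0" by (rule cot_envelope[OF ST])
  have "\<exists>g \<in> homs C T0 X. g \<cdot> i = Ident C X"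
    by (rule cot_extend[OF UV _ X *(3)]) (use * SU in \<open>auto simp: homs_iff\<close>)
  then obtain r where "r \<in> homs C T0 X" "r \<cdot> i = Ident C X" by blast
  from cot_retract_right[OF ST sesD(1)[OF *(3)] this *(2)] show "X \<in> T" .
qed

lemma twin_dual: "twin (op C) (op_seqs E) V U T S"
proof -
  interpret dual: exact_category "op C" "op_seqs E" by (rule exact_dual)
  show ?thesis by unfold_locales (use cot_dual ST UV VT in auto)
qed

lemma B_plus_op [simp]: "B_plus (op C) (op_seqs E) U T S = Bm"
  by (auto simp: B_plus_def B_minus_def ses_op_nonempty twin_core_def Int_commute)

lemma B_minus_op [simp]: "B_minus (op C) (op_seqs E) V U T = Bp"
  by (auto simp: B_plus_def B_minus_def ses_op_nonempty twin_core_def Int_commute)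

definition null :: "'m \<Rightarrow> bool"
  where "null f \<longleftrightarrow> (\<exists>X \<in> W. \<exists>u v. u \<in> homs C (Dom C f) X \<and> v \<in> homs C X (Cod C f) \<and> f = v \<cdot> u)"

lemma nullI: "\<lbrakk>u \<in> homs C A X; v \<in> homs C X B; X \<in> W\<rbrakk> \<Longrightarrow> null (v \<cdot> u)"
  unfolding null_def using homsD by (intro bexI[of _ X] exI[of _ u] exI[of _ v]) auto

lemma nullE:
  assumes "null f" "f \<in> homs C A B"
  obtains X u v where "X \<in> W" "u \<in> homs C A X" "v \<in> homs C X B" "v \<cdot> u = f"
  using assms homsD[OF assms(2)] unfolding null_def by auto

lemma null_op: "twin.null (op C) U T f \<longleftrightarrow> null f" if "twin (op C) (op_seqs E) V U T S"
  unfolding twin.null_def[OF that] null_def by (auto simp: twin_core_def)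

lemma null_comp:
  assumes "null f" "f \<in> homs C A B"
  shows "g \<in> homs C B D \<Longrightarrow> null (g \<cdot> f)" "h \<in> homs C D A \<Longrightarrow> null (f \<cdot> h)"
proof -
  obtain X u v where *: "X \<in> W" "u \<in> homs C A X" "v \<in> homs C X B" "v \<cdot> u = f" by (rule nullE[OF assms])
  note [simp] = homsD[OF *(2)] homsD[OF *(3)]
  show "null (g \<cdot> f)" if g: "g \<in> homs C B D"
    using nullI[OF *(2), of "g \<cdot> v" D] *(1,4) homsD[OF g] by (auto simp: homs_iff)
  show "null (f \<cdot> h)" if h: "h \<in> homs C D A"
    using nullI[OF _ *(3), of "u \<cdot> h" D] *(1) homsD[OF h] by (auto simp: homs_iff *(4)[symmetric])
qed

lemma W_biproduct: "is_biproduct C A B X i1 i2 p1 p2 \<Longrightarrow> A \<in> W \<Longrightarrow> B \<in> W \<Longrightarrow> X \<in> W"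
  using cot_biproduct(2)[OF ST] cot_biproduct(1)[OF UV] by (simp add: in_W)

lemma null_plus:
  assumes "null f" "null g" "f \<in> homs C A B" "g \<in> homs C A B"
  shows "null (f \<boxplus> g)"
proof -
  obtain X u v where f: "X \<in> W" "u \<in> homs C A X" "v \<in> homs C X B" "v \<cdot> u = f" by (rule nullE[OF assms(1,3)])
  obtain Y u' v' where g: "Y \<in> W" "u' \<in> homs C A Y" "v' \<in> homs C Y B" "v' \<cdot> u' = g" by (rule nullE[OF assms(2,4)])
  obtain Z i1 i2 p1 p2 where b: "is_biproduct C X Y Z i1 i2 p1 p2"
    using ex_biproduct[OF W_Obj[OF f(1)] W_Obj[OF g(1)]] by blast
  note bd = biproductD[OF b]
  define w where "w = (i1 \<cdot> u) \<boxplus> (i2 \<cdot> u')"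
  have w: "w \<in> homs C A Z" "p1 \<cdot> w = u" "p2 \<cdot> w = u'"
    using biproduct_pair[OF b f(2) g(2)] by (simp_all add: w_def)
  note [simp] = homsD[OF f(2)] homsD[OF f(3)] homsD[OF g(2)] homsD[OF g(3)] homsD[OF bd(6)] homsD[OF bd(7)]
    homsD[OF w(1)] w(2,3)
  have "((v \<cdot> p1) \<boxplus> (v' \<cdot> p2)) \<cdot> w = f \<boxplus> g" by (simp add: comp_plus_left f(4) g(4))
  moreover have "(v \<cdot> p1) \<boxplus> (v' \<cdot> p2) \<in> homs C Z B" by (simp add: homs_iff)
  ultimately show ?thesis using nullI[OF w(1) _ W_biproduct[OF b f(1) g(1)]] by metis
qed

lemma null_neg:
  assumes "null f" "f \<in> homs C A B"
  shows "null (neg C f)"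
proof -
  obtain X u v where f: "X \<in> W" "u \<in> homs C A X" "v \<in> homs C X B" "v \<cdot> u = f" by (rule nullE[OF assms])
  note [simp] = homsD[OF f(2)] homsD[OF f(3)]
  have "neg C f = neg C v \<cdot> u" using comp_neg(2)[of u v] f(4) by simp
  thus ?thesis using nullI[OF f(2), of "neg C v" B] f(1) by (simp add: homs_iff)
qed

lemma null_diff:
  assumes "null f" "null g" "f \<in> homs C A B" "g \<in> homs C A B"
  shows "null (f \<boxminus> g)"
  unfolding diff_def
  by (rule null_plus[OF assms(1) null_neg[OF assms(2,4)] assms(3)])
    (use homsD[OF assms(4)] in \<open>simp add: homs_iff\<close>)

lemma W_nonempty: "is_zero_object C Z \<Longrightarrow> Z \<in> W"
  using cot_zero[OF ST] cot_zero[OF UV] by (simp add: in_W)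

lemma null_zer: "A \<in> Obj C \<Longrightarrow> B \<in> Obj C \<Longrightarrow> null (Zer C A B)"
proof -
  assume [simp]: "A \<in> Obj C" "B \<in> Obj C"
  obtain Z where Z: "is_zero_object C Z" using ex_zero_object by blast
  hence [simp]: "Z \<in> Obj C" by (simp add: is_zero_object_def)
  show ?thesis using nullI[OF _ _ W_nonempty[OF Z], of "Zer C A Z" A "Zer C Z B" B] by (simp add: homs_iff)
qed

lemma BmE:
  assumes "B \<in> Bm"
  obtains w s W0 S0 where "W0 \<in> W" "S0 \<in> S" "(w, s) \<in> ses C E B W0 S0"
  using assms unfolding B_minus_def by fastforce

lemma BpE:
  assumes "B \<in> Bp"
  obtains v w V0 W0 where "W0 \<in> W" "V0 \<in> V" "(v, w) \<in> ses C E V0 W0 B"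
  using assms unfolding B_plus_def by fastforce

lemma BmI: "\<lbrakk>W0 \<in> W; S0 \<in> S; (w, s) \<in> ses C E B W0 S0\<rbrakk> \<Longrightarrow> B \<in> Bm"
  unfolding B_minus_def using homsD(4)[OF sesD(1)] by blast

lemma BpI: "\<lbrakk>W0 \<in> W; V0 \<in> V; (v, w) \<in> ses C E V0 W0 B\<rbrakk> \<Longrightarrow> B \<in> Bp"
  unfolding B_plus_def using homsD(5)[OF sesD(2)] by blast

lemma extend_through_S:
  assumes "(i, p) \<in> ses C E K Z A" "A \<in> S" "B \<in> T" "f \<in> homs C K B"
  shows "\<exists>g \<in> homs C Z B. g \<cdot> i = f"
  using cot_extend[OF ST assms(2,3,1,4)] .

lemma lift_U_Bp:
  assumes "X \<in> U" "(v, w) \<in> ses C E V0 W0 B" "V0 \<in> V" "f \<in> homs C X B"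
  shows "\<exists>g \<in> homs C X W0. w \<cdot> g = f"
  using cot_lift[OF UV assms(1,3,2,4)] .

text \<open>
  The second factor lifts along the cover \<open>V0 \<rightarrowtail> W0 \<twoheadrightarrow> Y\<close>.
\<close>

lemma null_through_U:
  assumes "Y \<in> Bp" "X \<in> U" "a \<in> homs C A X" "b \<in> homs C X Y"
  shows "null (b \<cdot> a)"
proof -
  obtain v w V0 W0 where y: "W0 \<in> W" "V0 \<in> V" "(v, w) \<in> ses C E V0 W0 Y" by (rule BpE[OF assms(1)])
  obtain g where g: "g \<in> homs C X W0" "w \<cdot> g = b" using lift_U_Bp[OF assms(2) y(3,2) assms(4)] by blast
  note w = sesD(2)[OF y(3)]
  note [simp] = homsD[OF w] homsD[OF g(1)] homsD[OF assms(3)]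
  have "b \<cdot> a = w \<cdot> (g \<cdot> a)" using sq_ext[OF g(2), of a] by simp
  thus ?thesis using nullI[OF _ w y(1), of "g \<cdot> a" A] by (simp add: homs_iff)
qed

lemma null_through_T:
  assumes "Z \<in> Bm" "X \<in> T" "a \<in> homs C Z X" "b \<in> homs C X A"
  shows "null (b \<cdot> a)"
proof -
  interpret dual: twin "op C" "op_seqs E" V U T S by (rule twin_dual)
  show ?thesis using dual.null_through_U[of Z X b A a] assms by (simp add: null_op[OF twin_dual])
qed

text \<open>
  To place an object in \<open>B\<^sup>-\<close> it suffices to find the middle term in \<open>U\<close>: embedding that term into
  an object of \<open>T\<close> with cokernel in \<open>S\<close> leads to \<open>T \<inter> U\<close> and enlarges the cokernel by an extension
  inside \<open>S\<close>.
\<close>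

lemma BmI_U:
  assumes s: "(u, s) \<in> ses C E B U0 S0" "U0 \<in> U" "S0 \<in> S"
  shows "B \<in> Bm"
proof -
  have "U0 \<in> Obj C" using homsD(5)[OF sesD(1)[OF s(1)]] .
  then obtain S1 T1 i p where t: "S1 \<in> S" "T1 \<in> T" "(i, p) \<in> ses C E U0 T1 S1" by (rule cot_envelope[OF ST])
  obtain Q r k t' where q: "(i \<cdot> u, r) \<in> ses C E B T1 Q" "(k, t') \<in> ses C E S0 Q S1"
    using noether[OF s(1) t(3)] by metis
  have "Q \<in> S" by (rule cot_ext_closed_left[OF ST q(2) s(3) t(1)])
  moreover have "T1 \<in> W" using cot_ext_closed_left[OF UV t(3) s(2)] t(1,2) SU by (auto simp: in_W)
  ultimately show ?thesis using BmI[OF _ _ q(1)] by simp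
qed

text \<open>
  The pushout of the two given inflations contains \<open>M\<close> and is an extension of \<open>S0\<close> by \<open>W0\<close>, hence an
  object of \<open>U\<close>.
\<close>

lemma Bm_ext:
  assumes B: "B \<in> Bm" and m: "(m, q) \<in> ses C E B M S0" "S0 \<in> S"
  shows "M \<in> Bm"
proof -
  obtain w s W0 S1 where w: "W0 \<in> W" "S1 \<in> S" "(w, s) \<in> ses C E B W0 S1" by (rule BmE[OF B])
  obtain R i' p' j' q' where r: "(i', p') \<in> ses C E W0 R S0" "(j', q') \<in> ses C E M R S1"
    by (rule pushout_two[OF m(1) w(3)])
  have "R \<in> U" using cot_ext_closed_left[OF UV r(1)] w(1) m(2) SU by (auto simp: in_W)
  from BmI_U[OF r(2) this w(2)] show ?thesis .
qed

lemma Bp_ext: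
  assumes "B \<in> Bp" "(m, q) \<in> ses C E V0 M B" "V0 \<in> V"
  shows "M \<in> Bp"
proof -
  interpret dual: twin "op C" "op_seqs E" V U T S by (rule twin_dual)
  show ?thesis using dual.Bm_ext[of B q m M V0] assms by simp
qed

lemma W_sub_H: "X \<in> W \<Longrightarrow> X \<in> H"
proof -
  assume X: "X \<in> W"
  note [simp] = W_Obj[OF X]
  obtain Z where Z: "is_zero_object C Z" using ex_zero_object by blast
  have b: "is_biproduct C X Z X (Ident C X) (Zer C Z X) (Ident C X) (Zer C X Z)"
    by (rule iso_biproduct_zero[OF _ _ _ _ Z]) (simp_all add: homs_iff)
  have "(Ident C X, Zer C X Z) \<in> ses C E X X Z" "(Zer C Z X, Ident C X) \<in> ses C E Z X X"
    using split_exact[OF b] split_exact[OF biproduct_swap[OF b]] biproductD[OF b] by (simp_all add: ses_def)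
  moreover have "Z \<in> S" "Z \<in> V" using cot_zero[OF _ Z] ST UV by auto
  ultimately show ?thesis using BmI[OF X] BpI[OF X] by simp
qed

section \<open>Reflections and coreflections\<close>

text \<open>
  Inflations with cokernel in \<open>S\<close> are epimorphisms modulo null arrows, as long as the target lies in
  \<open>B\<^sup>+\<close>: after subtracting a null arrow that extends the given factorization, what remains factors
  through an object of \<open>S \<subseteq> U\<close>.
\<close>

lemma reflection_unique:
  assumes m: "(m, \<sigma>) \<in> ses C E M M' S'" "S' \<in> S" and u: "Y \<in> Bp" "u \<in> homs C M' Y" "null (u \<cdot> m)"
  shows "null u"
proof -
  note d = sesD[OF m(1)]
  note [simp] = homsD[OF d(1)] homsD[OF d(2)] homsD[OF u(2)]
  have "u \<cdot> m \<in> homs C M Y" by (simp add: homs_iff)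
  then obtain X a b where x: "X \<in> W" "a \<in> homs C M X" "b \<in> homs C X Y" "b \<cdot> a = u \<cdot> m" by (rule nullE[OF u(3)])
  obtain a' where a': "a' \<in> homs C M' X" "a' \<cdot> m = a"
    using extend_through_S[OF m _ x(2)] x(1) by (auto simp: in_W)
  note [simp] = homsD[OF x(3)] homsD[OF a'(1)]
  have "(u \<boxminus> b \<cdot> a') \<cdot> m = Zer C M Y" by (simp add: comp_diff_left a'(2) x(4))
  then obtain c where c: "c \<in> homs C S' Y" "c \<cdot> \<sigma> = u \<boxminus> b \<cdot> a'"
    using ses_desc[OF m(1), of "u \<boxminus> b \<cdot> a'" Y] by (auto simp: homs_iff)
  have "null (c \<cdot> \<sigma>)" using null_through_U[OF u(1) _ d(2) c(1)] m(2) SU by auto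
  moreover have "null (b \<cdot> a')" by (rule nullI[OF a'(1) x(3,1)])
  moreover have "(c \<cdot> \<sigma>) \<boxplus> (b \<cdot> a') = u" unfolding c(2) by (simp add: diff_plus)
  ultimately show ?thesis using null_plus[of "c \<cdot> \<sigma>" "b \<cdot> a'" M' Y] homsD[OF c(1)] by (simp add: homs_iff)
qed

text \<open>
  The reflection of \<open>M\<close> into \<open>H\<close>. A cover \<open>V0 \<rightarrowtail> U0 \<twoheadrightarrow> M\<close> is pushed out along \<open>U0 \<rightarrowtail> W0 \<twoheadrightarrow> S'\<close>.
  The square formed by \<open>U0\<close>, \<open>W0\<close>, \<open>M\<close>, \<open>M'\<close> is both a pushout and a pullback. The pushout property
  extends arrows from \<open>M\<close> to \<open>M'\<close>; the pullback property shows that an arrow into \<open>M\<close> becomes null in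
  \<open>M'\<close> only if it lifts to the cover \<open>U0\<close>.
\<close>

lemma reflection:
  assumes M: "M \<in> Bm"
  obtains M' S' V0 U0 m \<sigma> \<iota> \<pi> where
    "M' \<in> H" "S' \<in> S" "V0 \<in> V" "U0 \<in> U" "(m, \<sigma>) \<in> ses C E M M' S'" "(\<iota>, \<pi>) \<in> ses C E V0 U0 M"
    "\<And>Y f. \<lbrakk>Y \<in> Bp; f \<in> homs C M Y\<rbrakk> \<Longrightarrow> \<exists>g \<in> homs C M' Y. g \<cdot> m = f"
    "\<And>Z z. \<lbrakk>z \<in> homs C Z M; null (m \<cdot> z)\<rbrakk> \<Longrightarrow> \<exists>g \<in> homs C Z U0. \<pi> \<cdot> g = z"
proof -
  have "M \<in> Obj C" using M by (simp add: B_minus_def)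
  then obtain U0 V0 \<iota> \<pi> where u: "U0 \<in> U" "V0 \<in> V" "(\<iota>, \<pi>) \<in> ses C E V0 U0 M" by (rule cot_cover[OF UV])
  have "U0 \<in> Obj C" using u(1) cotD(1)[OF UV] by auto
  then obtain S' W0 j s where w: "S' \<in> S" "W0 \<in> T" "(j, s) \<in> ses C E U0 W0 S'" by (rule cot_envelope[OF ST])
  have W0: "W0 \<in> W" using cot_ext_closed_left[OF UV w(3) u(1)] w(1,2) SU by (auto simp: in_W)
  obtain M' \<rho> m \<sigma> where r: "(j \<cdot> \<iota>, \<rho>) \<in> ses C E V0 W0 M'" "(m, \<sigma>) \<in> ses C E M M' S'"
    and po: "is_pushout C j \<pi> \<rho> m" and pb: "is_pullback C \<pi> j m \<rho>"
    using noether[OF u(3) w(3)] by metis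
  note ud = sesD[OF u(3)] and wd = sesD[OF w(3)] and md = sesD[OF r(2)] and rd = sesD[OF r(1)]
  note [simp] = homsD[OF ud(2)] homsD[OF wd(1)] homsD[OF md(1)] homsD[OF rd(2)]
  have "M' \<in> H" using BpI[OF W0 u(2) r(1)] Bm_ext[OF M r(2) w(1)] by simp
  moreover have "\<exists>g \<in> homs C M' Y. g \<cdot> m = f" if Y: "Y \<in> Bp" and f: "f \<in> homs C M Y" for Y f
  proof -
    obtain v' w' V1 W1 where y: "W1 \<in> W" "V1 \<in> V" "(v', w') \<in> ses C E V1 W1 Y" by (rule BpE[OF Y])
    note yd = sesD[OF y(3)]
    note [simp] = homsD[OF f] homsD[OF yd(2)]
    obtain g where g: "g \<in> homs C U0 W1" "w' \<cdot> g = f \<cdot> \<pi>"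
      using lift_U_Bp[OF u(1) y(3,2), of "f \<cdot> \<pi>"] by (auto simp: homs_iff)
    obtain h where h: "h \<in> homs C W0 W1" "h \<cdot> j = g"
      using extend_through_S[OF w(3,1) _ g(1)] y(1) by (auto simp: in_W)
    note [simp] = homsD[OF h(1)]
    note P = pushoutD[OF po wd(1) ud(2) rd(2)]
    have "(w' \<cdot> h) \<cdot> j = f \<cdot> \<pi>" using g(2) h(2) by simp
    then show ?thesis using P(3)[of "w' \<cdot> h" Y f] f by (auto simp: homs_iff)
  qed
  moreover have "\<exists>g \<in> homs C Z U0. \<pi> \<cdot> g = z" if z: "z \<in> homs C Z M" and n: "null (m \<cdot> z)" for Z z
  proof -
    note [simp] = homsD[OF z]
    have "m \<cdot> z \<in> homs C Z M'" by (simp add: homs_iff)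
    then obtain X a b where x: "X \<in> W" "a \<in> homs C Z X" "b \<in> homs C X M'" "b \<cdot> a = m \<cdot> z" by (rule nullE[OF n])
    obtain b' where b': "b' \<in> homs C X W0" "\<rho> \<cdot> b' = b"
      using lift_U_Bp[OF _ r(1) u(2) x(3)] x(1) by (auto simp: in_W)
    note [simp] = homsD[OF x(2)] homsD[OF b'(1)]
    note P = pullbackD[OF pb md(1) rd(2) ud(2)]
    have "m \<cdot> z = \<rho> \<cdot> (b' \<cdot> a)" using sq_ext[OF b'(2), of a] x(4) by simp
    then show ?thesis using P(3)[OF z, of "b' \<cdot> a"] by (auto simp: homs_iff)
  qed
  ultimately show ?thesis using that w(1) u r(2) by blast
qed

text \<open>
  The dual of the reflection. Here an arrow out of \<open>N\<close> becomes null on \<open>N'\<close> only if it extends to the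
  envelope \<open>T0\<close> of \<open>N\<close>.
\<close>

lemma coreflection:
  assumes N: "N \<in> Bp"
  obtains N' V' S0 T0 \<epsilon> \<kappa> \<tau> s where
    "N' \<in> H" "V' \<in> V" "S0 \<in> S" "T0 \<in> T" "(\<kappa>, \<epsilon>) \<in> ses C E V' N' N" "(\<tau>, s) \<in> ses C E N T0 S0"
    "\<And>Y f. \<lbrakk>Y \<in> Bm; f \<in> homs C Y N\<rbrakk> \<Longrightarrow> \<exists>g \<in> homs C Y N'. \<epsilon> \<cdot> g = f"
    "\<And>A h. \<lbrakk>h \<in> homs C N A; null (h \<cdot> \<epsilon>)\<rbrakk> \<Longrightarrow> \<exists>g \<in> homs C T0 A. g \<cdot> \<tau> = h"
proof -
  interpret dual: twin "op C" "op_seqs E" V U T S by (rule twin_dual)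
  have N': "N \<in> B_minus (op C) (op_seqs E) V U T" using N by simp
  show ?thesis
    by (rule dual.reflection[OF N']) (rule that; simp add: null_op[OF twin_dual] Int_commute)
qed

text \<open>
  Direct sums of the sequences that witness membership in \<open>B\<^sup>-\<close> are exact.
\<close>

lemma Bm_biproduct:
  assumes b: "is_biproduct C A B X a1 a2 pa1 pa2" and A: "A \<in> Bm" and B: "B \<in> Bm"
  shows "X \<in> Bm"
proof -
  obtain f1 g1 W1 S1 where 1: "W1 \<in> W" "S1 \<in> S" "(f1, g1) \<in> ses C E A W1 S1" by (rule BmE[OF A])
  obtain f2 g2 W2 S2 where 2: "W2 \<in> W" "S2 \<in> S" "(f2, g2) \<in> ses C E B W2 S2" by (rule BmE[OF B])
  note d1 = sesD[OF 1(3)] and d2 = sesD[OF 2(3)]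
  obtain Y b1 b2 pb1 pb2 where y: "is_biproduct C W1 W2 Y b1 b2 pb1 pb2"
    using ex_biproduct[of W1 W2] homsD[OF d1(1)] homsD[OF d2(1)] by blast
  obtain Z c1 c2 pc1 pc2 where z: "is_biproduct C S1 S2 Z c1 c2 pc1 pc2"
    using ex_biproduct[of S1 S2] homsD[OF d1(2)] homsD[OF d2(2)] by blast
  note bd = biproductD[OF b] and yd = biproductD[OF y] and zd = biproductD[OF z]
  note [simp] = homsD[OF d1(1)] homsD[OF d1(2)] homsD[OF d2(1)] homsD[OF d2(2)]
    homsD[OF yd(4)] homsD[OF yd(5)] homsD[OF zd(4)] homsD[OF zd(5)]
  define f where "f = ((b1 \<cdot> f1) \<cdot> pa1) \<boxplus> ((b2 \<cdot> f2) \<cdot> pa2)"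
  define g where "g = ((c1 \<cdot> g1) \<cdot> pb1) \<boxplus> ((c2 \<cdot> g2) \<cdot> pb2)"
  have f: "f \<in> homs C X Y" "f \<cdot> a1 = b1 \<cdot> f1" "f \<cdot> a2 = b2 \<cdot> f2"
    unfolding f_def by (rule biproduct_copair[OF b]; simp add: homs_iff)+
  have g: "g \<in> homs C Y Z" "g \<cdot> b1 = c1 \<cdot> g1" "g \<cdot> b2 = c2 \<cdot> g2"
    unfolding g_def by (rule biproduct_copair[OF y]; simp add: homs_iff)+
  note [simp] = homsD[OF f(1)] homsD[OF g(1)]
  have "seq_direct_sum C (f1, g1) (f2, g2) (f, g)"
    unfolding seq_direct_sum_def prod.case
  proof (intro conjI)
    show "is_composable C f1 g1" "is_composable C f2 g2" "is_composable C f g" by (simp_all add: is_composable_def)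
    have "is_biproduct C (Dom C f1) (Dom C f2) (Dom C f) a1 a2 pa1 pa2"
      "is_biproduct C (Cod C f1) (Cod C f2) (Cod C f) b1 b2 pb1 pb2"
      "is_biproduct C (Cod C g1) (Cod C g2) (Cod C g) c1 c2 pc1 pc2"
      using b y z by simp_all
    thus "\<exists>a1 a2 pa1 pa2 b1 b2 pb1 pb2 c1 c2 pc1 pc2.
       is_biproduct C (Dom C f1) (Dom C f2) (Dom C f) a1 a2 pa1 pa2 \<and>
       is_biproduct C (Cod C f1) (Cod C f2) (Cod C f) b1 b2 pb1 pb2 \<and>
       is_biproduct C (Cod C g1) (Cod C g2) (Cod C g) c1 c2 pc1 pc2 \<and>
       f \<cdot> a1 = b1 \<cdot> f1 \<and> f \<cdot> a2 = b2 \<cdot> f2 \<and> g \<cdot> b1 = c1 \<cdot> g1 \<and> g \<cdot> b2 = c2 \<cdot> g2"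
      using f(2,3) g(2,3) by metis
  qed
  from direct_sum_closed[OF d1(3) d2(3) this] have "(f, g) \<in> ses C E X Y Z"
    using f g by (simp add: ses_def)
  from BmI[OF W_biproduct[OF y 1(1) 2(1)] cot_biproduct(1)[OF ST z 1(2) 2(2)] this] show ?thesis .
qed

lemma H_biproduct:
  assumes b: "is_biproduct C A B X a1 a2 pa1 pa2" and A: "A \<in> H" and B: "B \<in> H"
  shows "X \<in> H"
proof -
  interpret dual: twin "op C" "op_seqs E" V U T S by (rule twin_dual)
  have "is_biproduct (op C) A B X pa1 pa2 a1 a2" using b by (simp add: is_biproduct_op)
  from dual.Bm_biproduct[OF this] Bm_biproduct[OF b] A B show ?thesis by simp
qed

section \<open>Cokernels and images in the heart\<close>

text \<open>
  Monomorphisms and cokernels of the heart, expressed by representatives in the ambient category. In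
  the second notion the factorization holds on the nose, which is stronger than a factorization modulo null
  arrows and is what the constructions provide.
\<close>

definition heart_mono :: "'m \<Rightarrow> bool"
  where "heart_mono f \<longleftrightarrow> (\<forall>Z \<in> H. \<forall>z \<in> homs C Z (Dom C f). null (f \<cdot> z) \<longrightarrow> null z)"

definition heart_cokernel :: "'m \<Rightarrow> 'm \<Rightarrow> bool"
  where "heart_cokernel g c \<longleftrightarrow> Cod C c \<in> H \<and> null (c \<cdot> g) \<and>
    (\<forall>Y \<in> H. \<forall>h \<in> homs C (Cod C g) Y. null (h \<cdot> g) \<longrightarrow> (\<exists>u \<in> homs C (Cod C c) Y. u \<cdot> c = h)) \<and>
    (\<forall>Y \<in> H. \<forall>u \<in> homs C (Cod C c) Y. null (u \<cdot> c) \<longrightarrow> null u)"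

lemma heart_monoD: "\<lbrakk>heart_mono f; f \<in> homs C A B; Z \<in> H; z \<in> homs C Z A; null (f \<cdot> z)\<rbrakk> \<Longrightarrow> null z"
  unfolding heart_mono_def by (auto simp: homs_iff)

lemma heart_cokernelD:
  assumes "heart_cokernel g c" "g \<in> homs C A B" "c \<in> homs C B Q"
  shows "Q \<in> H" "null (c \<cdot> g)"
    "\<lbrakk>Y \<in> H; h \<in> homs C B Y; null (h \<cdot> g)\<rbrakk> \<Longrightarrow> \<exists>u \<in> homs C Q Y. u \<cdot> c = h"
    "\<lbrakk>Y \<in> H; u \<in> homs C Q Y; null (u \<cdot> c)\<rbrakk> \<Longrightarrow> null u"
  using assms unfolding heart_cokernel_def by (simp_all add: homs_iff)

text \<open>
  Let \<open>M\<close> be the pushout of \<open>A \<rightarrowtail> W0 \<twoheadrightarrow> S0\<close> along \<open>g\<close>. An arrow on \<open>B\<close> whose composite with \<open>g\<close> is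
  null extends over \<open>W0\<close>, hence over \<open>M\<close> and its reflection \<open>M'\<close>. Both \<open>B \<rightarrowtail> M\<close> and \<open>M \<rightarrowtail> M'\<close>
  have a cokernel in \<open>S\<close>, which gives uniqueness.
\<close>

lemma heart_cokernel_exists:
  assumes A: "A \<in> H" and B: "B \<in> H" and g: "g \<in> homs C A B"
  shows "\<exists>c. c \<in> homs C B (Cod C c) \<and> heart_cokernel g c"
proof -
  have "A \<in> Bm" using A by simp
  then obtain w s W0 S0 where w: "W0 \<in> W" "S0 \<in> S" "(w, s) \<in> ses C E A W0 S0" by (rule BmE)
  obtain M c0 g' t where c0: "(c0, t) \<in> ses C E B M S0" "g' \<in> homs C W0 M" and po: "is_pushout C w g g' c0"
    by (rule ses_pushout[OF w(3) g])
  have M: "M \<in> Bm" using Bm_ext[OF _ c0(1) w(2)] B by simp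
  obtain M' S' V1 U1 m \<sigma> \<iota> \<pi> where m: "M' \<in> H" "S' \<in> S" "V1 \<in> V" "U1 \<in> U" "(m, \<sigma>) \<in> ses C E M M' S'"
    "(\<iota>, \<pi>) \<in> ses C E V1 U1 M"
    and ext: "\<And>Y f. \<lbrakk>Y \<in> Bp; f \<in> homs C M Y\<rbrakk> \<Longrightarrow> \<exists>g \<in> homs C M' Y. g \<cdot> m = f"
    and "\<And>Z z. \<lbrakk>z \<in> homs C Z M; null (m \<cdot> z)\<rbrakk> \<Longrightarrow> \<exists>g \<in> homs C Z U1. \<pi> \<cdot> g = z"
    by (rule reflection[OF M]) (rule that; blast)
  note wd = sesD[OF w(3)] and cd = sesD[OF c0(1)] and md = sesD[OF m(5)]
  note P = pushoutD[OF po wd(1) g c0(2)]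
  note [simp] = homsD[OF wd(1)] homsD[OF g] homsD[OF c0(2)] homsD[OF cd(1)] homsD[OF md(1)]
  have "null ((m \<cdot> g') \<cdot> w)" by (rule nullI[OF wd(1) _ w(1)]) (simp add: homs_iff)
  then have "null ((m \<cdot> c0) \<cdot> g)" using P(2) by simp
  moreover have "\<exists>u \<in> homs C M' Y. u \<cdot> (m \<cdot> c0) = h"
    if Y: "Y \<in> H" and h: "h \<in> homs C B Y" and n: "null (h \<cdot> g)" for Y h
  proof -
    note [simp] = homsD[OF h]
    have "h \<cdot> g \<in> homs C A Y" by (simp add: homs_iff)
    then obtain X a b where x: "X \<in> W" "a \<in> homs C A X" "b \<in> homs C X Y" "b \<cdot> a = h \<cdot> g" by (rule nullE[OF n])
    obtain a' where a': "a' \<in> homs C W0 X" "a' \<cdot> w = a"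
      using extend_through_S[OF w(3,2) _ x(2)] x(1) by (auto simp: in_W)
    note [simp] = homsD[OF x(3)] homsD[OF a'(1)]
    obtain u where u: "u \<in> homs C M Y" "u \<cdot> c0 = h"
      using P(3)[of "b \<cdot> a'" Y h] h x(4) a'(2) by (auto simp: homs_iff)
    obtain u' where u': "u' \<in> homs C M' Y" "u' \<cdot> m = u" using ext[OF _ u(1)] Y by blast
    have "u' \<cdot> (m \<cdot> c0) = h" using sq_ext[OF u'(2), of c0] u(2) homsD[OF u'(1)] by simp
    with u'(1) show ?thesis by blast
  qed
  moreover have "null u" if Y: "Y \<in> H" and u: "u \<in> homs C M' Y" and n: "null (u \<cdot> (m \<cdot> c0))" for Y u
  proof -
    note [simp] = homsD[OF u]
    have "null (u \<cdot> m)"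
      by (rule reflection_unique[OF c0(1) w(2), of Y]) (use Y n in \<open>simp_all add: homs_iff\<close>)
    thus ?thesis using reflection_unique[OF m(5,2) _ u] Y by blast
  qed
  ultimately have "heart_cokernel g (m \<cdot> c0)" using m(1) by (simp add: heart_cokernel_def)
  thus ?thesis by (intro exI[of _ "m \<cdot> c0"]) (simp add: homs_iff)
qed

text \<open>
  Let \<open>N' \<rightarrow> N\<close> be the coreflection of the kernel and \<open>N \<rightarrowtail> T0 \<twoheadrightarrow> S0\<close> its envelope. The pushout \<open>M\<close>
  of \<open>X\<close> and \<open>T0\<close> over \<open>N\<close> sits in \<open>X \<rightarrowtail> M \<twoheadrightarrow> S0\<close> and in \<open>T0 \<rightarrowtail> M \<twoheadrightarrow> D\<close>. The first sequence makes
  \<open>X \<rightarrow> M \<rightarrow> M'\<close> a cokernel of \<open>N' \<rightarrow> X\<close>, where \<open>M'\<close> is the reflection of \<open>M\<close>. The second one makes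
  \<open>M' \<rightarrow> D\<close> a monomorphism: up to null arrows an arrow into \<open>M'\<close> that dies in \<open>D\<close> comes from \<open>T0\<close>.
\<close>

lemma deflation_factor:
  assumes nf: "(n, f) \<in> ses C E N X D" and H: "X \<in> H" "D \<in> H" "N \<in> Bp"
    and lift: "\<And>W0 b. \<lbrakk>W0 \<in> W; b \<in> homs C W0 D\<rbrakk> \<Longrightarrow> \<exists>b' \<in> homs C W0 X. f \<cdot> b' = b"
  obtains N' g Q c i where "N' \<in> H" "g \<in> homs C N' X" "c \<in> homs C X Q" "i \<in> homs C Q D" "i \<cdot> c = f"
    "heart_cokernel g c" "heart_mono i"
proof -
  obtain N' V' S0 T0 \<epsilon> \<kappa> \<tau> s where e: "N' \<in> H" "V' \<in> V" "S0 \<in> S" "T0 \<in> T" "(\<kappa>, \<epsilon>) \<in> ses C E V' N' N"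
    "(\<tau>, s) \<in> ses C E N T0 S0"
    and "\<And>Y f. \<lbrakk>Y \<in> Bm; f \<in> homs C Y N\<rbrakk> \<Longrightarrow> \<exists>g \<in> homs C Y N'. \<epsilon> \<cdot> g = f"
    and ext0: "\<And>A h. \<lbrakk>h \<in> homs C N A; null (h \<cdot> \<epsilon>)\<rbrakk> \<Longrightarrow> \<exists>g \<in> homs C T0 A. g \<cdot> \<tau> = h"
    by (rule coreflection[OF H(3)]) (rule that; blast)
  obtain M c0 s' t d0 where c0: "(c0, s') \<in> ses C E X M S0" and t: "(t, d0) \<in> ses C E T0 M D" and d0: "d0 \<cdot> c0 = f"
    and po: "is_pushout C \<tau> n t c0"
    by (rule pushout_two[OF e(6) nf])
  have M: "M \<in> Bm" using Bm_ext[OF _ c0 e(3)] H by simp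
  obtain M' S' V1 U1 m \<sigma> \<iota> \<pi> where m: "M' \<in> H" "S' \<in> S" "V1 \<in> V" "U1 \<in> U" "(m, \<sigma>) \<in> ses C E M M' S'"
    "(\<iota>, \<pi>) \<in> ses C E V1 U1 M"
    and ext: "\<And>Y f. \<lbrakk>Y \<in> Bp; f \<in> homs C M Y\<rbrakk> \<Longrightarrow> \<exists>g \<in> homs C M' Y. g \<cdot> m = f"
    and "\<And>Z z. \<lbrakk>z \<in> homs C Z M; null (m \<cdot> z)\<rbrakk> \<Longrightarrow> \<exists>g \<in> homs C Z U1. \<pi> \<cdot> g = z"
    by (rule reflection[OF M]) (rule that; blast)
  note nd = sesD[OF nf] and \<epsilon>d = sesD[OF e(5)] and \<tau>d = sesD[OF e(6)] and cd = sesD[OF c0] and td = sesD[OF t]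
    and md = sesD[OF m(5)]
  note P = pushoutD[OF po \<tau>d(1) nd(1) td(1)]
  obtain d where d: "d \<in> homs C M' D" "d \<cdot> m = d0" using ext[OF _ td(2)] H by blast
  note [simp] = homsD[OF nd(1)] homsD[OF nd(2)] homsD[OF \<epsilon>d(2)] homsD[OF \<tau>d(1)] homsD[OF cd(1)] homsD[OF td(1)]
    homsD[OF td(2)] homsD[OF md(1)] homsD[OF md(2)] homsD[OF d(1)]
  have "d \<cdot> (m \<cdot> c0) = f" using sq_ext[OF d(2), of c0] d0 by simp
  moreover have "heart_cokernel (n \<cdot> \<epsilon>) (m \<cdot> c0)"
    unfolding heart_cokernel_def
  proof (intro conjI ballI impI)
    show "Cod C (m \<cdot> c0) \<in> H" using m(1) by simp
    have "null ((m \<cdot> t) \<cdot> (\<tau> \<cdot> \<epsilon>))"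
      by (rule null_through_T[of N' T0 _ _ M']) (use e(1,4) in \<open>simp_all add: homs_iff\<close>)
    thus "null ((m \<cdot> c0) \<cdot> (n \<cdot> \<epsilon>))" using sq_ext[OF P(2), of \<epsilon>] by simp
  next
    fix Y h assume Y: "Y \<in> H" and "h \<in> homs C (Cod C (n \<cdot> \<epsilon>)) Y" and n: "null (h \<cdot> (n \<cdot> \<epsilon>))"
    then have h: "h \<in> homs C X Y" by simp
    note [simp] = homsD[OF h]
    obtain v where v: "v \<in> homs C T0 Y" "v \<cdot> \<tau> = h \<cdot> n"
      using ext0[of "h \<cdot> n" Y] n by (auto simp: homs_iff)
    obtain u where u: "u \<in> homs C M Y" "u \<cdot> c0 = h" using P(3)[OF v(1) h v(2)] by blast
    obtain u' where u': "u' \<in> homs C M' Y" "u' \<cdot> m = u" using ext[OF _ u(1)] Y by blast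
    have "u' \<cdot> (m \<cdot> c0) = h" using sq_ext[OF u'(2), of c0] u(2) homsD[OF u'(1)] by simp
    with u'(1) show "\<exists>u \<in> homs C (Cod C (m \<cdot> c0)) Y. u \<cdot> (m \<cdot> c0) = h" by auto
  next
    fix Y u assume Y: "Y \<in> H" and "u \<in> homs C (Cod C (m \<cdot> c0)) Y" and n: "null (u \<cdot> (m \<cdot> c0))"
    then have u: "u \<in> homs C M' Y" by simp
    note [simp] = homsD[OF u]
    have "null (u \<cdot> m)"
      by (rule reflection_unique[OF c0 e(3), of Y]) (use Y n in \<open>simp_all add: homs_iff\<close>)
    thus "null u" using reflection_unique[OF m(5,2) _ u] Y by blast
  qed
  moreover have "heart_mono d"
    unfolding heart_mono_def
  proof (intro ballI impI)
    fix Z z assume Z: "Z \<in> H" and "z \<in> homs C Z (Dom C d)" and n: "null (d \<cdot> z)"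
    then have z: "z \<in> homs C Z M'" by simp
    note [simp] = homsD[OF z]
    have "d \<cdot> z \<in> homs C Z D" by (simp add: homs_iff)
    then obtain W0 a b where x: "W0 \<in> W" "a \<in> homs C Z W0" "b \<in> homs C W0 D" "b \<cdot> a = d \<cdot> z" by (rule nullE[OF n])
    obtain b' where b': "b' \<in> homs C W0 X" "f \<cdot> b' = b" using lift[OF x(1,3)] by blast
    note [simp] = homsD[OF x(2)] homsD[OF b'(1)]
    \<comment> \<open>The null arrow \<open>d \<cdot> z\<close> lifts to a null arrow \<open>z0\<close> into \<open>M'\<close>; subtracting it reduces to \<open>d \<cdot> y = 0\<close>.\<close>
    define z0 where "z0 = (m \<cdot> (c0 \<cdot> b')) \<cdot> a"
    have z0: "z0 \<in> homs C Z M'" by (simp add: z0_def homs_iff)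
    have z0_null: "null z0" unfolding z0_def by (rule nullI[OF x(2) _ x(1)]) (simp add: homs_iff)
    note [simp] = homsD[OF z0]
    have dz0: "d \<cdot> z0 = d \<cdot> z"
      using sq_ext[OF b'(2), of a] x(4)
      by (simp add: z0_def sq_ext[OF d(2)] sq_ext[OF d0])
    define y where "y = z \<boxminus> z0"
    have y: "y \<in> homs C Z M'" "d \<cdot> y = Zer C Z D" by (simp_all add: y_def homs_iff comp_diff_right dz0)
    note [simp] = homsD[OF y(1)]
    \<comment> \<open>A section of \<open>\<sigma>\<close> that is annihilated by \<open>d\<close>: the sequence \<open>D \<rightarrowtail> M'/T0 \<twoheadrightarrow> S'\<close> is split by \<open>d\<close>, and
      the complementary section lifts to \<open>M'\<close>, because \<open>T0\<close> lies in \<open>T\<close>.\<close>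
    obtain Q r k t' where q: "(m \<cdot> t, r) \<in> ses C E T0 M' Q" "(k, t') \<in> ses C E D Q S'" "t' \<cdot> r = \<sigma>"
      and po2: "is_pushout C m d0 r k"
      using noether[OF t m(5)] by metis
    note rd = sesD[OF q(1)] and kd = sesD[OF q(2)]
    note [simp] = homsD[OF rd(2)] homsD[OF kd(1)] homsD[OF kd(2)]
    note P2 = pushoutD[OF po2 md(1) td(2) rd(2)]
    obtain e' where e': "e' \<in> homs C Q D" "e' \<cdot> r = d" "e' \<cdot> k = Ident C D"
      using P2(3)[OF d(1), of "Ident C D"] d(2) by (auto simp: homs_iff)
    obtain x where bip: "is_biproduct C D S' Q k x e' t'"
      using ses_retraction[OF q(2) e'(1,3)] by blast
    note bd = biproductD[OF bip]
    obtain \<phi> where \<phi>: "\<phi> \<in> homs C S' M'" "r \<cdot> \<phi> = x"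
      using cot_lift[OF ST m(2) e(4) q(1) bd(5)] by blast
    note [simp] = homsD[OF \<phi>(1)] homsD[OF e'(1)] homsD[OF bd(5)]
    have s\<phi>: "\<sigma> \<cdot> \<phi> = Ident C S'" using sq_ext[OF q(3), of \<phi>] \<phi>(2) bd(9) by simp
    have d\<phi>: "d \<cdot> \<phi> = Zer C S' D" using sq_ext[OF e'(2), of \<phi>] \<phi>(2) bd(11) by simp
    \<comment> \<open>The component of \<open>y\<close> in \<open>S'\<close> is null; what remains comes from \<open>M\<close> and dies in \<open>D\<close>.\<close>
    define y' where "y' = \<phi> \<cdot> (\<sigma> \<cdot> y)"
    have y': "y' \<in> homs C Z M'" by (simp add: y'_def homs_iff)
    have y'_null: "null y'" unfolding y'_def
      by (rule null_through_U[of M' S' _ Z]) (use m(1,2) SU in \<open>auto simp: homs_iff\<close>)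
    note [simp] = homsD[OF y']
    have "\<sigma> \<cdot> (y \<boxminus> y') = Zer C Z S'"
      using sq_ext[OF s\<phi>, of "\<sigma> \<cdot> y"] by (simp add: comp_diff_right) (simp add: y'_def)
    then obtain v where v: "v \<in> homs C Z M" "m \<cdot> v = y \<boxminus> y'"
      using ses_lift[OF m(5), of "y \<boxminus> y'" Z] by (auto simp: homs_iff)
    note [simp] = homsD[OF v(1)]
    have "d0 \<cdot> v = d \<cdot> (y \<boxminus> y')" using sq_ext[OF d(2), of v] v(2) by simp
    also have "\<dots> = Zer C Z D"
      using sq_ext[OF d\<phi>, of "\<sigma> \<cdot> y"] y(2) by (simp add: comp_diff_right) (simp add: y'_def)
    finally obtain v' where v': "v' \<in> homs C Z T0" "t \<cdot> v' = v" using ses_lift[OF t v(1)] by blast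
    note [simp] = homsD[OF v'(1)]
    have "null ((m \<cdot> t) \<cdot> v')" by (rule null_through_T[OF _ e(4) v'(1)]) (use Z in \<open>auto simp: homs_iff\<close>)
    then have "null (y \<boxminus> y')" using v v'(2) by simp
    then have "null ((y \<boxminus> y') \<boxplus> y')" using null_plus[OF _ y'_null, of "y \<boxminus> y'" Z M'] y' by (simp add: homs_iff)
    then have "null y" by (simp add: diff_plus)
    then have "null (y \<boxplus> z0)" using null_plus[OF _ z0_null y(1) z0] by simp
    thus "null z" by (simp add: y_def diff_plus)
  qed
  ultimately show ?thesis using that[OF e(1), of "n \<cdot> \<epsilon>" "m \<cdot> c0" M' d]
    by (auto simp: homs_iff)
qed

text \<open>
  Here \<open>s\<close> is an isomorphism of the heart with inverse \<open>t\<close>; the case of interest is \<open>R = X \<oplus> W0\<close>.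
\<close>

lemma heart_cokernel_transport:
  assumes hc: "heart_cokernel g c" and g: "g \<in> homs C A R" and c: "c \<in> homs C R Q"
    and s: "s \<in> homs C X R" and t: "t \<in> homs C R X" and ts: "t \<cdot> s = Ident C X"
    and st: "null (Ident C R \<boxminus> s \<cdot> t)"
  shows "heart_cokernel (t \<cdot> g) (c \<cdot> s)"
proof -
  note [simp] = homsD[OF g] homsD[OF c] homsD[OF s] homsD[OF t]
  define e where "e = Ident C R \<boxminus> s \<cdot> t"
  have e: "e \<in> homs C R R" "null e" using st by (simp_all add: e_def homs_iff)
  note [simp] = homsD[OF e(1)]
  have dec: "(f \<cdot> e) \<boxplus> (f \<cdot> (s \<cdot> t)) = f" if "f \<in> homs C R Y" for f Y
    using homsD[OF that] by (simp add: e_def comp_diff_right diff_plus)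
  have fe: "null (f \<cdot> e)" if "f \<in> homs C R Y" for f Y using null_comp(1)[OF e(2,1) that] .
  show ?thesis
    unfolding heart_cokernel_def
  proof (intro conjI ballI impI)
    show "Cod C (c \<cdot> s) \<in> H" using hc by (simp add: heart_cokernel_def)
    let ?x = "c \<cdot> (s \<cdot> (t \<cdot> g))" and ?y = "c \<cdot> (e \<cdot> g)"
    have "?y \<boxplus> ?x = ((c \<cdot> e) \<boxplus> (c \<cdot> (s \<cdot> t))) \<cdot> g" by (simp add: comp_plus_left)
    then have "?x \<boxplus> ?y = c \<cdot> g" unfolding dec[OF c] by (subst plus_comm) simp_all
    then have "?x = c \<cdot> g \<boxminus> ?y" by (subst (asm) plus_eq_iff) simp_all
    moreover have "null (c \<cdot> g)" using hc by (simp add: heart_cokernel_def)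
    moreover have "null ((c \<cdot> e) \<cdot> g)" by (rule null_comp(2)[OF fe[OF c] _ g]) (simp add: homs_iff)
    ultimately have "null ?x" using null_diff[of "c \<cdot> g" ?y A Q] by (simp add: homs_iff)
    then show "null ((c \<cdot> s) \<cdot> (t \<cdot> g))" by simp
  next
    fix Y h assume Y: "Y \<in> H" and "h \<in> homs C (Cod C (t \<cdot> g)) Y" and n: "null (h \<cdot> (t \<cdot> g))"
    then have h: "h \<in> homs C X Y" by simp
    note [simp] = homsD[OF h]
    have "h \<cdot> t \<in> homs C R Y" "null ((h \<cdot> t) \<cdot> g)" using n by (simp_all add: homs_iff)
    then obtain u where u: "u \<in> homs C Q Y" "u \<cdot> c = h \<cdot> t"
      using heart_cokernelD(3)[OF hc g c Y] by blast
    have "u \<cdot> (c \<cdot> s) = h" using sq_ext[OF u(2), of s] homsD[OF u(1)] ts by simp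
    with u(1) show "\<exists>u \<in> homs C (Cod C (c \<cdot> s)) Y. u \<cdot> (c \<cdot> s) = h" by auto
  next
    fix Y u assume Y: "Y \<in> H" and "u \<in> homs C (Cod C (c \<cdot> s)) Y" and n: "null (u \<cdot> (c \<cdot> s))"
    then have u: "u \<in> homs C Q Y" by simp
    note [simp] = homsD[OF u]
    have "null ((u \<cdot> (c \<cdot> s)) \<cdot> t)" by (rule null_comp(2)[OF n _ t]) (simp add: homs_iff)
    moreover have uc: "u \<cdot> c \<in> homs C R Y" by (simp add: homs_iff)
    ultimately have "null (((u \<cdot> c) \<cdot> e) \<boxplus> ((u \<cdot> c) \<cdot> (s \<cdot> t)))"
      using fe[OF uc] by (intro null_plus[of _ _ R Y]) (simp_all add: homs_iff)
    then have "null (u \<cdot> c)" using dec[OF uc] by simp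
    then show "null u" by (rule heart_cokernelD(4)[OF hc g c Y u])
  qed
qed

text \<open>
  With a cover \<open>V0 \<rightarrowtail> W0 \<twoheadrightarrow> D\<close> the arrow \<open>f\<close> is replaced by the deflation \<open>X \<oplus> W0 \<rightarrow> D\<close>. Its kernel is
  the pullback of \<open>X\<close> and \<open>W0\<close>, an extension of \<open>X\<close> by \<open>V0\<close>, hence in \<open>B\<^sup>+\<close>; arrows from \<open>W\<close> to \<open>D\<close>
  lift through the summand \<open>W0\<close>; and \<open>X\<close> and \<open>X \<oplus> W0\<close> are isomorphic in the heart.
\<close>

lemma heart_image:
  assumes X: "X \<in> H" and D: "D \<in> H" and f: "f \<in> homs C X D"
  obtains A g Q c i where "A \<in> H" "g \<in> homs C A X" "c \<in> homs C X Q" "i \<in> homs C Q D" "i \<cdot> c = f"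
    "heart_cokernel g c" "heart_mono i"
proof -
  have "D \<in> Bp" using D by simp
  then obtain v w V0 W0 where d: "W0 \<in> W" "V0 \<in> V" "(v, w) \<in> ses C E V0 W0 D" by (rule BpE)
  obtain N v' y x where x: "(v', x) \<in> ses C E V0 N X" "y \<in> homs C N W0" "y \<cdot> v' = v" and pb: "is_pullback C x y f w"
    by (rule ses_pullback[OF d(3) f])
  note P = pullbackD[OF pb f sesD(2)[OF d(3)] sesD(2)[OF x(1)]]
  obtain n a R i1 i2 p1 p2 where a: "(n, a) \<in> ses C E N R D" "a \<cdot> i1 = neg C f" "a \<cdot> i2 = w"
    and b: "is_biproduct C X W0 R i1 i2 p1 p2"
    by (rule ses_graph_dual[OF d(3) x(1) f x(2,3) P(2)[symmetric]])
  note bd = biproductD[OF b] and ad = sesD[OF a(1)] and wd = sesD[OF d(3)]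
  note [simp] = homsD[OF bd(4)] homsD[OF bd(5)] homsD[OF bd(6)] homsD[OF bd(7)] homsD[OF ad(2)] homsD[OF wd(2)]
    homsD[OF f]
  have R: "R \<in> H" by (rule H_biproduct[OF b X W_sub_H[OF d(1)]])
  have N: "N \<in> Bp" using Bp_ext[OF _ x(1) d(2)] X by simp
  have lift: "\<exists>b' \<in> homs C W1 R. a \<cdot> b' = b" if W1: "W1 \<in> W" and hb: "b \<in> homs C W1 D" for W1 b
  proof -
    obtain b' where b': "b' \<in> homs C W1 W0" "w \<cdot> b' = b"
      using lift_U_Bp[OF _ d(3,2) hb] W1 by (auto simp: in_W)
    have "i2 \<cdot> b' \<in> homs C W1 R" "a \<cdot> (i2 \<cdot> b') = b"
      using homsD[OF b'(1)] b'(2) sq_ext[OF a(3), of b'] by (simp_all add: homs_iff)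
    thus ?thesis by blast
  qed
  obtain N' g Q c i where *: "N' \<in> H" "g \<in> homs C N' R" "c \<in> homs C R Q" "i \<in> homs C Q D" "i \<cdot> c = a"
    "heart_cokernel g c" "heart_mono i"
    by (rule deflation_factor[OF a(1) R D N]) (use lift in blast)+
  note [simp] = homsD[OF *(2)] homsD[OF *(3)] homsD[OF *(4)]
  \<comment> \<open>The graph of \<open>f\<close> carries a sign: the restriction of \<open>a\<close> to \<open>X\<close> is \<open>-f\<close>.\<close>
  define s t where "s = neg C i1" and "t = neg C p1"
  have st: "s \<in> homs C X R" "t \<in> homs C R X" by (simp_all add: s_def t_def homs_iff)
  have "t \<cdot> s = Ident C X"
    unfolding s_def t_def by (simp add: comp_neg[symmetric] bd(8))
  moreover have e: "s \<cdot> t = i1 \<cdot> p1" unfolding s_def t_def by (simp add: comp_neg[symmetric])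
  have "i2 \<cdot> p2 = Ident C R \<boxminus> s \<cdot> t"
    unfolding e using plus_eq_iff[of "i2 \<cdot> p2" "i1 \<cdot> p1" "Ident C R"] bd(12) plus_comm[of "i2 \<cdot> p2" "i1 \<cdot> p1"] by simp
  with nullI[OF bd(7,5) d(1)] have "null (Ident C R \<boxminus> s \<cdot> t)" by simp
  ultimately have "heart_cokernel (t \<cdot> g) (c \<cdot> s)" using heart_cokernel_transport[OF *(6,2,3) st] by blast
  moreover have "i \<cdot> (c \<cdot> s) = f"
    using sq_ext[OF *(5), of s] st by (simp add: s_def comp_neg[symmetric] a(2))
  ultimately show ?thesis
    using that[OF *(1), of "t \<cdot> g" "c \<cdot> s" Q i] *(4,7) homsD[OF st(1)] homsD[OF st(2)] by (simp add: homs_iff)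
qed

section \<open>Amalgamation along monomorphisms\<close>

text \<open>
  What it means for an inflation \<open>a\<close> to be a monomorphism of the heart: the kernel \<open>N\<close> of the
  composite \<open>W1 \<twoheadrightarrow> R \<twoheadrightarrow> M\<close> lies in \<open>T\<close>, hence arrows from \<open>S\<close> to \<open>M\<close> lift to \<open>W1\<close>. Indeed
  \<open>N \<rightarrow> A \<rightarrow> R\<close> factors through \<open>W1\<close>, so \<open>N \<rightarrow> A\<close> is null on the coreflection of \<open>N\<close> and
  therefore \<open>N \<rightarrow> A\<close> extends to the envelope \<open>T0\<close> of \<open>N\<close>. The pullback \<open>Z\<close> of \<open>N \<rightarrow> A\<close> along this
  extension is an extension of \<open>T0\<close> by an object of \<open>V \<subseteq> T\<close>, and \<open>N\<close> is a retract of it.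
\<close>

lemma heart_mono_lift:
  assumes a: "(a, q) \<in> ses C E A R M" and A: "A \<in> H" and mono: "heart_mono a"
    and w: "W1 \<in> W" "V1 \<in> V" "(v, w) \<in> ses C E V1 W1 R" and \<phi>: "S1 \<in> S" "\<phi> \<in> homs C S1 M"
  shows "\<exists>l \<in> homs C S1 W1. q \<cdot> (w \<cdot> l) = \<phi>"
proof -
  obtain N v' n \<nu> where n: "(\<nu>, q \<cdot> w) \<in> ses C E N W1 M" "(v', n) \<in> ses C E V1 N A" "w \<cdot> \<nu> = a \<cdot> n"
    using noether_dual[OF w(3) a] by metis
  have N: "N \<in> Bp" using Bp_ext[OF _ n(2) w(2)] A by simp
  obtain N' V' S0 T0 \<epsilon> \<kappa> \<tau> s where e: "N' \<in> H" "V' \<in> V" "S0 \<in> S" "T0 \<in> T" "(\<kappa>, \<epsilon>) \<in> ses C E V' N' N"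
    "(\<tau>, s) \<in> ses C E N T0 S0"
    and "\<And>Y f. \<lbrakk>Y \<in> Bm; f \<in> homs C Y N\<rbrakk> \<Longrightarrow> \<exists>g \<in> homs C Y N'. \<epsilon> \<cdot> g = f"
    and ext0: "\<And>A h. \<lbrakk>h \<in> homs C N A; null (h \<cdot> \<epsilon>)\<rbrakk> \<Longrightarrow> \<exists>g \<in> homs C T0 A. g \<cdot> \<tau> = h"
    by (rule coreflection[OF N]) (rule that; blast)
  note ad = sesD[OF a] and wd = sesD[OF w(3)] and nd = sesD[OF n(2)] and \<nu>d = sesD[OF n(1)] and ed = sesD[OF e(5)]
    and \<tau>d = sesD[OF e(6)]
  note [simp] = homsD[OF ad(1)] homsD[OF ad(2)] homsD[OF wd(2)] homsD[OF nd(2)] homsD[OF \<nu>d(1)] homsD[OF ed(2)] homsD[OF \<tau>d(1)]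
  have "null (w \<cdot> (\<nu> \<cdot> \<epsilon>))" by (rule nullI[OF _ wd(2) w(1), of _ N']) (simp add: homs_iff)
  then have "null (a \<cdot> (n \<cdot> \<epsilon>))" using sq_ext[OF n(3), of \<epsilon>] by simp
  then have "null (n \<cdot> \<epsilon>)" using heart_monoD[OF mono ad(1) e(1)] by (simp add: homs_iff)
  then obtain g where g: "g \<in> homs C T0 A" "g \<cdot> \<tau> = n" using ext0[OF nd(2)] by blast
  obtain Z v'' g' z where z: "(v'', z) \<in> ses C E V1 Z T0" "g' \<in> homs C Z N" and pb: "is_pullback C z g' g n"
    by (rule ses_pullback[OF n(2) g(1)])
  note P = pullbackD[OF pb g(1) nd(2) sesD(2)[OF z(1)]]
  \<comment> \<open>The identity of \<open>N\<close> and its envelope agree over \<open>A\<close>, so \<open>N\<close> is a retract of \<open>Z\<close>.\<close>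
  obtain u where u: "u \<in> homs C N Z" "g' \<cdot> u = Ident C N"
    using P(3)[OF \<tau>d(1), of "Ident C N"] g(2) by (auto simp: homs_iff)
  have "Z \<in> T" using cot_ext_closed_right[OF ST z(1) _ e(4)] w(2) VT by blast
  then have "N \<in> T" by (rule cot_retract_right[OF ST u(1) z(2) u(2)])
  from cot_lift[OF ST \<phi>(1) this n(1) \<phi>(2)] obtain l where "l \<in> homs C S1 W1" "(q \<cdot> w) \<cdot> l = \<phi>" by blast
  thus ?thesis using homsD[OF \<open>l \<in> homs C S1 W1\<close>] by auto
qed

text \<open>
  In terms of extension groups: \<open>n\<close> annihilates \<open>Ext\<^sup>1(S', N)\<close> for all \<open>S'\<close> in \<open>S\<close>. Arrows from \<open>S\<close> to
  \<open>M\<close> lift to \<open>U0\<close>, so \<open>Ext\<^sup>1(S', N)\<close> embeds into \<open>Ext\<^sup>1(S', U0)\<close>, and every class there comes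
  from \<open>S1\<close>, because \<open>Ext\<^sup>1(S', T1) = 0\<close>. An arrow through \<open>W1\<close>, which affects no class because
  \<open>W1\<close> lies in \<open>T\<close>, corrects \<open>S1 \<rightarrow> U0\<close> to an arrow \<open>S1 \<rightarrow> N\<close>. Its composite with \<open>n\<close> factors
  through an object of \<open>W\<close>, because \<open>D\<close> lies in \<open>B\<^sup>+\<close>, so it annihilates all classes. The proof makes this explicit on the object \<open>G\<close>, the pullback of
  \<open>U0\<close> and \<open>T0\<close> over \<open>T1\<close>, an extension of \<open>T0\<close> by \<open>S1\<close> that receives \<open>N\<close> and retracts onto it.
\<close>

lemma extends_over_envelope:
  assumes U0: "U0 \<in> ext_star C E S T" and N: "(\<nu>, p) \<in> ses C E N U0 M" and \<tau>: "(\<tau>, s) \<in> ses C E N T0 S0" "S0 \<in> S" "T0 \<in> T"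
    and n: "n \<in> homs C N D" and D: "D \<in> Bp"
    and b: "W1 \<in> T" "b \<in> homs C W1 U0"
    and lift: "\<And>S' \<phi>. \<lbrakk>S' \<in> S; \<phi> \<in> homs C S' M\<rbrakk> \<Longrightarrow> \<exists>l \<in> homs C S' W1. p \<cdot> (b \<cdot> l) = \<phi>"
  shows "\<exists>\<psi> \<in> homs C T0 D. \<psi> \<cdot> \<tau> = n"
proof -
  obtain S1 T1 s1 t1 where u0: "S1 \<in> S" "T1 \<in> T" "(s1, t1) \<in> ses C E S1 U0 T1"
    using U0 unfolding ext_star_def by fastforce
  note Nd = sesD[OF N] and \<tau>d = sesD[OF \<tau>(1)] and ud = sesD[OF u0(3)]
  note [simp] = homsD[OF Nd(1)] homsD[OF Nd(2)] homsD[OF \<tau>d(1)] homsD[OF \<tau>d(2)] homsD[OF ud(1)] homsD[OF ud(2)]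
    homsD[OF n] homsD[OF b(2)]
  obtain \<xi> where \<xi>: "\<xi> \<in> homs C T0 T1" "\<xi> \<cdot> \<tau> = t1 \<cdot> \<nu>"
    using extend_through_S[OF \<tau>(1,2) u0(2), of "t1 \<cdot> \<nu>"] by (auto simp: homs_iff)
  obtain G s1' g g0 where G: "(s1', g0) \<in> ses C E S1 G T0" "g \<in> homs C G U0" "g \<cdot> s1' = s1"
    and pb: "is_pullback C g0 g \<xi> t1"
    by (rule ses_pullback[OF u0(3) \<xi>(1)])
  note Gd = sesD[OF G(1)]
  note P = pullbackD[OF pb \<xi>(1) ud(2) Gd(2)]
  obtain u where u: "u \<in> homs C N G" "g0 \<cdot> u = \<tau>" "g \<cdot> u = \<nu>"
    using P(3)[OF \<tau>d(1) Nd(1) \<xi>(2)] by blast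
  note [simp] = homsD[OF Gd(1)] homsD[OF Gd(2)] homsD[OF G(2)] homsD[OF u(1)]
  \<comment> \<open>The preimage \<open>X\<close> of \<open>N\<close> in \<open>G\<close> is the direct sum of \<open>S1\<close> and \<open>N\<close>, and \<open>G/X\<close> is \<open>S0\<close>. Hence arrows
    into \<open>T\<close> may be prescribed on \<open>S1\<close> and put to zero on \<open>N\<close>.\<close>
  obtain X a1 b1 \<zeta> where X: "(\<zeta>, s \<cdot> g0) \<in> ses C E X G S0" "(a1, b1) \<in> ses C E S1 X N"
    "\<zeta> \<cdot> a1 = s1'" and pb1: "is_pullback C b1 \<zeta> \<tau> g0"
    using noether_dual[OF G(1) \<tau>(1)] by metis
  note Xd = sesD[OF X(1)] and ad = sesD[OF X(2)]
  note P1 = pullbackD[OF pb1 \<tau>d(1) Gd(2) ad(2)]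
  obtain u' where u': "u' \<in> homs C N X" "b1 \<cdot> u' = Ident C N" "\<zeta> \<cdot> u' = u"
    using P1(3)[of "Ident C N" N u] u(1,2) by (auto simp: homs_iff)
  obtain r1 where bip: "is_biproduct C S1 N X a1 u' r1 b1"
    using ses_section[OF X(2) u'(1,2)] by blast
  note bd = biproductD[OF bip]
  note [simp] = homsD[OF Xd(1)] homsD[OF ad(1)] homsD[OF u'(1)] homsD[OF bd(6)]
  have ext: "\<exists>x' \<in> homs C G Y. x' \<cdot> s1' = x \<and> x' \<cdot> u = Zer C N Y" if x: "x \<in> homs C S1 Y" and Y: "Y \<in> T" for x Y
  proof -
    note [simp] = homsD[OF x]
    obtain x' where x': "x' \<in> homs C G Y" "x' \<cdot> \<zeta> = x \<cdot> r1"
      using extend_through_S[OF X(1) \<tau>(2) Y, of "x \<cdot> r1"] by (auto simp: homs_iff)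
    note [simp] = homsD[OF x'(1)]
    have "x' \<cdot> s1' = x" using sq_ext[OF x'(2), of a1] X(3) bd(8) by simp
    moreover have "x' \<cdot> u = Zer C N Y" using sq_ext[OF x'(2), of u'] u'(3) bd(11) by simp
    ultimately show ?thesis using x'(1) by blast
  qed
  have desc: "\<exists>h' \<in> homs C S0 Y. h' \<cdot> (s \<cdot> g0) = h"
    if h: "h \<in> homs C G Y" "h \<cdot> s1' = Zer C S1 Y" "h \<cdot> u = Zer C N Y" for h Y
  proof -
    note [simp] = homsD[OF h(1)]
    have "h \<cdot> \<zeta> = Zer C X Y"
      by (rule biproduct_eqI_left[OF bip, of _ Y]) (simp_all add: homs_iff X(3) u'(3) h(2,3))
    from ses_desc[OF X(1) h(1) this] show ?thesis .
  qed
  have "p \<cdot> s1 \<in> homs C S1 M" by (simp add: homs_iff)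
  then obtain l where l: "l \<in> homs C S1 W1" "p \<cdot> (b \<cdot> l) = p \<cdot> s1" using lift[OF u0(1)] by blast
  obtain \<mu> where \<mu>: "\<mu> \<in> homs C G W1" "\<mu> \<cdot> s1' = l" "\<mu> \<cdot> u = Zer C N W1"
    using ext[OF l(1) b(1)] by blast
  note [simp] = homsD[OF l(1)] homsD[OF \<mu>(1)]
  \<comment> \<open>Two corrections, the first on \<open>S1\<close> and the second on \<open>G/X = S0\<close>, move \<open>g\<close> into the kernel \<open>N\<close> of \<open>p\<close>
    without changing it on \<open>N\<close>.\<close>
  define h where "h = p \<cdot> g \<boxminus> p \<cdot> (b \<cdot> \<mu>)"
  have h: "h \<in> homs C G M" "h \<cdot> s1' = Zer C S1 M" "h \<cdot> u = Zer C N M"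
    by (simp_all add: h_def homs_iff comp_diff_left G(3) \<mu>(2,3) l(2) u(3) Nd(4))
  obtain h' where h': "h' \<in> homs C S0 M" "h' \<cdot> (s \<cdot> g0) = h" using desc[OF h] by blast
  obtain l' where l': "l' \<in> homs C S0 W1" "p \<cdot> (b \<cdot> l') = h'" using lift[OF \<tau>(2) h'(1)] by blast
  note [simp] = homsD[OF l'(1)] homsD[OF h'(1)]
  define f where "f = (g \<boxminus> b \<cdot> \<mu>) \<boxminus> b \<cdot> (l' \<cdot> (s \<cdot> g0))"
  have f: "f \<in> homs C G U0" by (simp add: f_def homs_iff)
  have "p \<cdot> (b \<cdot> (l' \<cdot> (s \<cdot> g0))) = (p \<cdot> (b \<cdot> l')) \<cdot> (s \<cdot> g0)" by simp
  then have "p \<cdot> (b \<cdot> (l' \<cdot> (s \<cdot> g0))) = h" by (simp only: l'(2) h'(2))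
  then have pf: "p \<cdot> f = Zer C G M"
    using homsD[OF h(1)] by (simp add: f_def comp_diff_right h_def[symmetric])
  obtain \<theta> where \<theta>: "\<theta> \<in> homs C G N" "\<nu> \<cdot> \<theta> = f" using ses_lift[OF N f pf] by blast
  note [simp] = homsD[OF \<theta>(1)]
  have fu: "f \<cdot> u = \<nu>"
    by (simp add: f_def comp_diff_left u(2,3) \<mu>(3) \<tau>d(4))
  \<comment> \<open>\<open>\<theta>\<close> retracts \<open>G\<close> onto \<open>N\<close>; once a further correction has made \<open>n \<cdot> \<theta>\<close> zero on \<open>S1\<close>, it
    descends to \<open>T0 = G/S1\<close>.\<close>
  have \<theta>u: "\<theta> \<cdot> u = Ident C N"
    by (rule ses_mono[OF N, of _ N]) (simp_all add: homs_iff sq_ext[OF \<theta>(2)] fu)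
  obtain v2 w2 V2 W2 where y: "W2 \<in> W" "V2 \<in> V" "(v2, w2) \<in> ses C E V2 W2 D" by (rule BpE[OF D])
  note yd = sesD[OF y(3)]
  note [simp] = homsD[OF yd(2)]
  have "n \<cdot> (\<theta> \<cdot> s1') \<in> homs C S1 D" by (simp add: homs_iff)
  then obtain \<omega> where \<omega>: "\<omega> \<in> homs C S1 W2" "w2 \<cdot> \<omega> = n \<cdot> (\<theta> \<cdot> s1')"
    using lift_U_Bp[OF _ y(3,2)] u0(1) SU by blast
  obtain \<omega>' where \<omega>': "\<omega>' \<in> homs C G W2" "\<omega>' \<cdot> s1' = \<omega>" "\<omega>' \<cdot> u = Zer C N W2"
    using ext[OF \<omega>(1)] y(1) by (auto simp: in_W)
  note [simp] = homsD[OF \<omega>'(1)]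
  have "n \<cdot> \<theta> \<boxminus> w2 \<cdot> \<omega>' \<in> homs C G D" "(n \<cdot> \<theta> \<boxminus> w2 \<cdot> \<omega>') \<cdot> s1' = Zer C S1 D"
    by (simp_all add: homs_iff comp_diff_left \<omega>'(2) \<omega>(2))
  then obtain \<psi> where \<psi>: "\<psi> \<in> homs C T0 D" "\<psi> \<cdot> g0 = n \<cdot> \<theta> \<boxminus> w2 \<cdot> \<omega>'"
    using ses_desc[OF G(1)] by blast
  have "\<psi> \<cdot> \<tau> = (\<psi> \<cdot> g0) \<cdot> u" using homsD[OF \<psi>(1)] u(2) by simp
  also have "\<dots> = n" unfolding \<psi>(2) by (simp add: comp_diff_left \<theta>u \<omega>'(3))
  finally show ?thesis using \<psi>(1) by blast
qed

text \<open>
  Take the pushout \<open>Y\<close> of \<open>A \<rightarrowtail> W0 \<twoheadrightarrow> S0\<close> along \<open>(\<alpha>, -\<beta>) : A \<rightarrow> B \<oplus> D\<close> and let \<open>F\<close> be its reflection. An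
  arrow into \<open>D\<close> that is null in \<open>F\<close> lifts to the pullback \<open>N\<close> of \<open>D\<close> and a cover \<open>U0\<close> of \<open>Y\<close>, and it
  is null as soon as \<open>N \<rightarrow> D\<close> extends to the envelope of \<open>N\<close>. The quotient \<open>M = Y/D\<close> is the cokernel of
  the inflation \<open>A \<rightarrow> B \<oplus> W0\<close> as well; so the hypothesis that \<open>\<alpha>\<close> is mono provides liftings of
  arrows from \<open>S\<close> to \<open>M\<close>.
\<close>

lemma amalgamation:
  assumes US: "U \<subseteq> ext_star C E S T" and H: "A \<in> H" "B \<in> H" "D \<in> H"
    and \<alpha>: "\<alpha> \<in> homs C A B" "heart_mono \<alpha>" and \<beta>: "\<beta> \<in> homs C A D"
  shows "\<exists>F \<gamma> \<delta>. F \<in> H \<and> \<gamma> \<in> homs C B F \<and> \<delta> \<in> homs C D F \<and> heart_mono \<delta> \<and> null (\<gamma> \<cdot> \<alpha> \<boxminus> \<delta> \<cdot> \<beta>)"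
proof -
  have "A \<in> Bm" using H by simp
  then obtain w s W0 S0 where w: "W0 \<in> W" "S0 \<in> S" "(w, s) \<in> ses C E A W0 S0" by (rule BmE)
  obtain P j1 j2 q1 q2 where b: "is_biproduct C B D P j1 j2 q1 q2"
    using ex_biproduct[of B D] homsD[OF \<alpha>(1)] homsD[OF \<beta>] by blast
  note bd = biproductD[OF b] and wd = sesD[OF w(3)]
  note [simp] = homsD[OF \<alpha>(1)] homsD[OF \<beta>] homsD[OF bd(4)] homsD[OF bd(5)] homsD[OF bd(6)] homsD[OF bd(7)]
    homsD[OF wd(1)] homsD[OF wd(2)]
  have P: "P \<in> H" by (rule H_biproduct[OF b H(2,3)])
  define f where "f = j1 \<cdot> \<alpha> \<boxminus> j2 \<cdot> \<beta>"
  have f: "f \<in> homs C A P" by (simp add: f_def homs_iff)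
  note [simp] = homsD[OF f]
  obtain Y y w0 t where y: "(y, t) \<in> ses C E P Y S0" "w0 \<in> homs C W0 Y" "t \<cdot> w0 = s" and po: "is_pushout C w f w0 y"
    by (rule ses_pushout[OF w(3) f])
  note yd = sesD[OF y(1)]
  note PO = pushoutD[OF po wd(1) f y(2)]
  have Y: "Y \<in> Bm" using Bm_ext[OF _ y(1) w(2)] P by simp
  \<comment> \<open>The quotient \<open>M = Y/D\<close>; it is also an extension of \<open>S0\<close> by \<open>B\<close>.\<close>
  have jq: "(j2, q1) \<in> ses C E D P B"
    using split_exact[OF biproduct_swap[OF b]] bd by (simp add: ses_def)
  obtain M e k tM where M: "(y \<cdot> j2, e) \<in> ses C E D Y M" "(k, tM) \<in> ses C E B M S0" "e \<cdot> y = k \<cdot> q1" "tM \<cdot> e = t"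
    using noether[OF jq y(1)] by metis
  note Md = sesD[OF M(1)] and kd = sesD[OF M(2)]
  note [simp] = homsD[OF yd(1)] homsD[OF yd(2)] homsD[OF y(2)] homsD[OF Md(2)] homsD[OF kd(1)] homsD[OF kd(2)]
  have ew: "e \<cdot> w0 \<in> homs C W0 M" "tM \<cdot> (e \<cdot> w0) = s" "(e \<cdot> w0) \<cdot> w = k \<cdot> \<alpha>"
  proof -
    show "e \<cdot> w0 \<in> homs C W0 M" by (simp add: homs_iff)
    show "tM \<cdot> (e \<cdot> w0) = s" using sq_ext[OF M(4), of w0] y(3) by simp
    have "(e \<cdot> w0) \<cdot> w = k \<cdot> (q1 \<cdot> f)" using PO(2) sq_ext[OF M(3), of f] by simp
    also have "q1 \<cdot> f = \<alpha>"
      by (simp add: f_def comp_diff_right sq_ext[OF bd(8)] sq_ext[OF bd(11)])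
    finally show "(e \<cdot> w0) \<cdot> w = k \<cdot> \<alpha>" .
  qed
  obtain a q R i1 i2 p1 p2 where a: "(a, q) \<in> ses C E A R M" "p1 \<cdot> a = neg C \<alpha>" "q \<cdot> i1 = k" "q \<cdot> i2 = e \<cdot> w0"
    and bR: "is_biproduct C B W0 R i1 i2 p1 p2"
    by (rule ses_graph[OF w(3) M(2) \<alpha>(1) ew])
  note ad = sesD[OF a(1)] and Rd = biproductD[OF bR]
  note [simp] = homsD[OF ad(1)] homsD[OF ad(2)] homsD[OF Rd(4)] homsD[OF Rd(5)] homsD[OF Rd(6)] homsD[OF Rd(7)]
  have R: "R \<in> H" by (rule H_biproduct[OF bR H(2) W_sub_H[OF w(1)]])
  have amono: "heart_mono a"
    unfolding heart_mono_def
  proof (intro ballI impI)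
    fix Z z assume Z: "Z \<in> H" and "z \<in> homs C Z (Dom C a)" and n: "null (a \<cdot> z)"
    then have z: "z \<in> homs C Z A" by simp
    note [simp] = homsD[OF z]
    have "null (p1 \<cdot> (a \<cdot> z))" by (rule null_comp(1)[OF n _ Rd(6), of Z]) (simp add: homs_iff)
    then have "null (neg C (p1 \<cdot> (a \<cdot> z)))" by (rule null_neg[of _ Z B]) (simp add: homs_iff)
    moreover have "neg C (p1 \<cdot> (a \<cdot> z)) = \<alpha> \<cdot> z"
      by (simp add: sq_ext[OF a(2)] comp_neg(2))
    ultimately show "null z" using heart_monoD[OF \<alpha>(2,1) Z z] by simp
  qed
  have "R \<in> Bp" using R by simp
  then obtain v1 w1 V1 W1 where w1: "W1 \<in> W" "V1 \<in> V" "(v1, w1) \<in> ses C E V1 W1 R" by (rule BpE)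
  define c where "c = (y \<cdot> j1) \<cdot> p1 \<boxplus> w0 \<cdot> p2"
  have c: "c \<in> homs C R Y" "c \<cdot> i1 = y \<cdot> j1" "c \<cdot> i2 = w0"
    unfolding c_def by (rule biproduct_copair[OF bR]; simp add: homs_iff)+
  note [simp] = homsD[OF c(1)]
  have ec: "e \<cdot> c = q"
    by (rule biproduct_eqI_left[OF bR, of _ M])
      (simp_all add: homs_iff c(2,3) a(3,4) sq_ext[OF M(3)] bd(8))
  obtain F S' V0 U0 m \<sigma> \<iota> \<pi> where F: "F \<in> H" "S' \<in> S" "V0 \<in> V" "U0 \<in> U" "(m, \<sigma>) \<in> ses C E Y F S'" "(\<iota>, \<pi>) \<in> ses C E V0 U0 Y"
    and "\<And>Y' f. \<lbrakk>Y' \<in> Bp; f \<in> homs C Y Y'\<rbrakk> \<Longrightarrow> \<exists>g \<in> homs C F Y'. g \<cdot> m = f"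
    and liftU: "\<And>Z z. \<lbrakk>z \<in> homs C Z Y; null (m \<cdot> z)\<rbrakk> \<Longrightarrow> \<exists>g \<in> homs C Z U0. \<pi> \<cdot> g = z"
    by (rule reflection[OF Y]) (rule that; blast)
  note md = sesD[OF F(5)] and \<pi>d = sesD[OF F(6)] and w1d = sesD[OF w1(3)]
  note [simp] = homsD[OF md(1)] homsD[OF \<pi>d(2)] homsD[OF w1d(2)]
  obtain N v n \<nu> where N: "(\<nu>, e \<cdot> \<pi>) \<in> ses C E N U0 M" "(v, n) \<in> ses C E V0 N D"
    and pbN: "is_pullback C n \<nu> (y \<cdot> j2) \<pi>"
    using noether_dual[OF F(6) M(1)] by metis
  note Nd = sesD[OF N(1)] and nd = sesD[OF N(2)]
  note [simp] = homsD[OF Nd(1)] homsD[OF nd(2)]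
  obtain l0 where l0: "l0 \<in> homs C W1 U0" "\<pi> \<cdot> l0 = c \<cdot> w1"
    using cot_lift[OF UV _ F(3,6), of W1 "c \<cdot> w1"] w1(1) by (auto simp: in_W homs_iff)
  note [simp] = homsD[OF l0(1)]
  have lift: "\<exists>l \<in> homs C S1 W1. (e \<cdot> \<pi>) \<cdot> (l0 \<cdot> l) = \<phi>" if S1: "S1 \<in> S" and \<phi>: "\<phi> \<in> homs C S1 M" for S1 \<phi>
  proof -
    obtain l where l: "l \<in> homs C S1 W1" "q \<cdot> (w1 \<cdot> l) = \<phi>"
      using heart_mono_lift[OF a(1) H(1) amono w1 S1 \<phi>] by blast
    note [simp] = homsD[OF l(1)]
    have "(e \<cdot> \<pi>) \<cdot> (l0 \<cdot> l) = \<phi>"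
      using l(2) by (simp add: sq_ext[OF l0(2)] sq_ext[OF ec])
    with l(1) show ?thesis by blast
  qed
  have "N \<in> Obj C" using homsD[OF nd(2)] by simp
  then obtain S2 T2 \<tau> s2 where \<tau>: "S2 \<in> S" "T2 \<in> T" "(\<tau>, s2) \<in> ses C E N T2 S2" by (rule cot_envelope[OF ST])
  have "\<exists>\<psi> \<in> homs C T2 D. \<psi> \<cdot> \<tau> = n"
  proof (rule extends_over_envelope[OF _ N(1) \<tau>(3,1,2) nd(2) _ _ l0(1)])
    show "U0 \<in> ext_star C E S T" using F(4) US by blast
    show "D \<in> Bp" "W1 \<in> T" using H(3) w1(1) by (simp_all add: in_W)
  qed (use lift in blast)
  then obtain \<psi> where \<psi>: "\<psi> \<in> homs C T2 D" "\<psi> \<cdot> \<tau> = n" by blast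
  note [simp] = homsD[OF \<psi>(1)] homsD[OF sesD(1)[OF \<tau>(3)]]
  define \<gamma> \<delta> where "\<gamma> = m \<cdot> (y \<cdot> j1)" and "\<delta> = m \<cdot> (y \<cdot> j2)"
  have \<delta>: "\<gamma> \<in> homs C B F" "\<delta> \<in> homs C D F" by (simp_all add: \<gamma>_def \<delta>_def homs_iff)
  have "heart_mono \<delta>"
    unfolding heart_mono_def
  proof (intro ballI impI)
    fix Z z assume Z: "Z \<in> H" and "z \<in> homs C Z (Dom C \<delta>)" and n: "null (\<delta> \<cdot> z)"
    then have z: "z \<in> homs C Z D" using homsD[OF \<delta>(2)] by simp
    note [simp] = homsD[OF z]
    have "(y \<cdot> j2) \<cdot> z \<in> homs C Z Y" "null (m \<cdot> ((y \<cdot> j2) \<cdot> z))" using n by (simp_all add: \<delta>_def homs_iff)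
    from liftU[OF this] obtain g where g: "g \<in> homs C Z U0" "\<pi> \<cdot> g = (y \<cdot> j2) \<cdot> z" by blast
    obtain z' where z': "z' \<in> homs C Z N" "n \<cdot> z' = z"
      using pullbackD(3)[OF pbN Md(1) \<pi>d(2) nd(2) z g(1) g(2)[symmetric]] by blast
    note [simp] = homsD[OF z'(1)]
    have "null (\<psi> \<cdot> (\<tau> \<cdot> z'))"
      by (rule null_through_T[of Z T2 _ _ D]) (use Z \<tau>(2) \<psi>(1) in \<open>simp_all add: homs_iff\<close>)
    then show "null z" using sq_ext[OF \<psi>(2), of z'] z'(2) by simp
  qed
  moreover have "null (\<gamma> \<cdot> \<alpha> \<boxminus> \<delta> \<cdot> \<beta>)"
  proof -
    have "null ((m \<cdot> w0) \<cdot> w)" by (rule nullI[OF wd(1) _ w(1)]) (simp add: homs_iff)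
    also have "(m \<cdot> w0) \<cdot> w = m \<cdot> (y \<cdot> f)" using PO(2) by simp
    also have "\<dots> = \<gamma> \<cdot> \<alpha> \<boxminus> \<delta> \<cdot> \<beta>"
      by (simp add: f_def \<gamma>_def \<delta>_def comp_diff_right)
    finally show ?thesis .
  qed
  ultimately show ?thesis using F(1) \<delta> by blast
qed

end

section \<open>Integrality from amalgamation and images\<close>

context additive_category
begin

text \<open>
  The amalgamating square receives an arrow from the pushout, so the monomorphism \<open>\<delta>'\<close> factors
  through \<open>\<delta>\<close>.
\<close>

lemma right_integralI:
  assumes pre: "preabelian C"
    and amalg: "\<And>\<alpha> \<beta> A B D. \<lbrakk>\<alpha> \<in> homs C A B; \<beta> \<in> homs C A D; is_mono C \<alpha>\<rbrakk>
      \<Longrightarrow> \<exists>F \<gamma> \<delta>. \<gamma> \<in> homs C B F \<and> \<delta> \<in> homs C D F \<and> \<gamma> \<cdot> \<alpha> = \<delta> \<cdot> \<beta> \<and> is_mono C \<delta>"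
  shows "right_integral C"
  unfolding right_integral_def
proof (intro conjI allI impI)
  fix \<alpha> \<beta> \<gamma> \<delta> assume a: "is_pushout C \<alpha> \<beta> \<gamma> \<delta> \<and> is_mono C \<alpha>"
  obtain A B D F where h: "\<alpha> \<in> homs C A B" "\<beta> \<in> homs C A D" "\<gamma> \<in> homs C B F"
    using a by (auto simp: is_pushout_def is_comm_square_def homs_iff)
  note P = pushoutD[OF conjunct1[OF a] h]
  obtain F' \<gamma>' \<delta>' where f: "\<gamma>' \<in> homs C B F'" "\<delta>' \<in> homs C D F'" "\<gamma>' \<cdot> \<alpha> = \<delta>' \<cdot> \<beta>" "is_mono C \<delta>'"
    using amalg[OF h(1,2)] a by blast
  obtain u where u: "u \<in> homs C F F'" "u \<cdot> \<delta> = \<delta>'" using P(3)[OF f(1,2,3)] by blast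
  show "is_mono C \<delta>"
  proof (rule monoI_zero[OF P(1)])
    fix Z g assume g: "g \<in> homs C Z D" "\<delta> \<cdot> g = Zer C Z F"
    have "\<delta>' \<cdot> g = Zer C Z F'"
      using sq_ext[OF u(2), of g] homsD[OF P(1)] homsD[OF u(1)] homsD[OF g(1)] g(2) by simp
    from monoD_zero[OF f(4,2) g(1) this] show "g = Zer C Z D" .
  qed
qed (fact pre)

text \<open>
  This is the argument that deduces left integrality from right integrality in the presence of
  images, with amalgamation in place of pushouts. The pullback is the kernel of \<open>(\<gamma>, -\<delta>)\<close>, so the
  cokernel part \<open>c\<close> of the image factorization is a cokernel of \<open>A \<rightarrow> B \<oplus> D\<close>.
\<close>

lemma left_integralI:
  assumes pre: "preabelian C"
    and amalg: "\<And>\<alpha> \<beta> A B D. \<lbrakk>\<alpha> \<in> homs C A B; \<beta> \<in> homs C A D; is_mono C \<alpha>\<rbrakk>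
      \<Longrightarrow> \<exists>F \<gamma> \<delta>. \<gamma> \<in> homs C B F \<and> \<delta> \<in> homs C D F \<and> \<gamma> \<cdot> \<alpha> = \<delta> \<cdot> \<beta> \<and> is_mono C \<delta>"
    and image: "\<And>f X Y. f \<in> homs C X Y \<Longrightarrow> \<exists>Q c i g. c \<in> homs C X Q \<and> i \<in> homs C Q Y \<and> i \<cdot> c = f \<and>
      is_cokernel C c g \<and> is_mono C i"
  shows "left_integral C"
  unfolding left_integral_def
proof (intro conjI allI impI)
  fix \<alpha> \<beta> \<gamma> \<delta> assume a: "is_pullback C \<alpha> \<beta> \<gamma> \<delta> \<and> is_epi C \<delta>"
  obtain A B D F where h: "\<alpha> \<in> homs C A B" "\<beta> \<in> homs C A D" "\<gamma> \<in> homs C B F" "\<delta> \<in> homs C D F"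
    and sq: "\<gamma> \<cdot> \<alpha> = \<delta> \<cdot> \<beta>"
    using a by (auto simp: is_pullback_def is_comm_square_def homs_iff)
  obtain P j1 j2 q1 q2 where b: "is_biproduct C B D P j1 j2 q1 q2"
    using ex_biproduct[of B D] homsD[OF h(1)] homsD[OF h(2)] by blast
  note bd = biproductD[OF b]
  note [simp] = homsD[OF h(1)] homsD[OF h(2)] homsD[OF h(3)] homsD[OF h(4)]
    homsD[OF bd(4)] homsD[OF bd(5)] homsD[OF bd(6)] homsD[OF bd(7)]
  define f where "f = \<gamma> \<cdot> q1 \<boxminus> \<delta> \<cdot> q2"
  define k where "k = j1 \<cdot> \<alpha> \<boxplus> j2 \<cdot> \<beta>"
  have f: "f \<in> homs C P F" by (simp add: f_def homs_iff)
  have k: "k \<in> homs C A P" "q1 \<cdot> k = \<alpha>" "q2 \<cdot> k = \<beta>"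
    unfolding k_def by (rule biproduct_pair[OF b h(1,2)])+
  note [simp] = homsD[OF f] homsD[OF k(1)] k(2,3)
  have fk: "f \<cdot> k = Zer C A F" by (simp add: f_def comp_diff_left sq)
  have k_univ: "\<exists>v \<in> homs C X A. k \<cdot> v = g" if g: "g \<in> homs C X P" "f \<cdot> g = Zer C X F" for X g
  proof -
    note [simp] = homsD[OF g(1)]
    have "\<gamma> \<cdot> (q1 \<cdot> g) = \<delta> \<cdot> (q2 \<cdot> g)"
      by (rule diff_eq_zer) (use g(2) in \<open>simp_all add: f_def comp_diff_left\<close>)
    moreover have "q1 \<cdot> g \<in> homs C X B" "q2 \<cdot> g \<in> homs C X D" by (simp_all add: homs_iff)
    ultimately obtain v where v: "v \<in> homs C X A" "\<alpha> \<cdot> v = q1 \<cdot> g" "\<beta> \<cdot> v = q2 \<cdot> g"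
      using a unfolding is_pullback_def by (metis homsD(2) h)
    note [simp] = homsD[OF v(1)]
    have "k \<cdot> v = ((j1 \<cdot> q1) \<boxplus> (j2 \<cdot> q2)) \<cdot> g"
      by (simp add: k_def comp_plus_left v(2,3))
    then have "k \<cdot> v = g" by (simp add: bd(12))
    with v(1) show ?thesis by blast
  qed
  obtain Q c i g where c: "c \<in> homs C P Q" "i \<in> homs C Q F" "i \<cdot> c = f" "is_cokernel C c g" "is_mono C i"
    using image[OF f] by blast
  note [simp] = homsD[OF c(1)] homsD[OF c(2)]
  obtain X where g: "g \<in> homs C X P" and cg: "c \<cdot> g = Zer C X Q"
    using c(4) by (auto simp: is_cokernel_def homs_iff)
  note [simp] = homsD[OF g]
  have "f \<cdot> g = Zer C X F" using sq_ext[OF c(3), of g] cg by simp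
  then obtain v where v: "v \<in> homs C X A" "k \<cdot> v = g" using k_univ[OF g] by blast
  show "is_epi C \<alpha>"
  proof (rule epiI_zero[OF h(1)])
    fix Z b assume b: "b \<in> homs C B Z" "b \<cdot> \<alpha> = Zer C A Z"
    note [simp] = homsD[OF b(1)]
    have "(b \<cdot> q1) \<cdot> g = Zer C X Z"
      using sq_ext[OF k(2), of v] v sq_ext[OF b(2), of v] homsD[OF v(1)] by simp
    moreover have "b \<cdot> q1 \<in> homs C (Cod C g) Z" by (simp add: homs_iff)
    ultimately have "\<exists>!u. u \<in> homs C Q Z \<and> u \<cdot> c = b \<cdot> q1"
      using c(4) unfolding is_cokernel_def by simp
    then obtain u where u: "u \<in> homs C Q Z" "u \<cdot> c = b \<cdot> q1" by blast
    \<comment> \<open>Restricted to \<open>D\<close>, \<open>u \<cdot> c\<close> is zero and \<open>i \<cdot> c\<close> is \<open>-\<delta>\<close>; hence \<open>\<gamma>' \<cdot> \<delta> = 0\<close>.\<close>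
    obtain Z' \<gamma>' \<zeta> where z: "\<gamma>' \<in> homs C F Z'" "\<zeta> \<in> homs C Z Z'" "\<gamma>' \<cdot> i = \<zeta> \<cdot> u" "is_mono C \<zeta>"
      using amalg[OF c(2) u(1) c(5)] by blast
    note [simp] = homsD[OF u(1)] homsD[OF z(1)] homsD[OF z(2)]
    have g'f: "\<gamma>' \<cdot> f = \<zeta> \<cdot> (b \<cdot> q1)"
      using sq_ext[OF z(3), of c] c(3) u(2) by simp
    have "f \<cdot> j2 = neg C \<delta>"
      by (simp add: f_def comp_diff_left bd(9,11)) (simp add: diff_def)
    then have "\<gamma>' \<cdot> neg C \<delta> = Zer C D Z'"
      using sq_ext[OF g'f, of j2] bd(11) by simp
    then have "\<gamma>' \<cdot> \<delta> = neg C (Zer C D Z')" by (simp add: comp_neg(1)[symmetric]) (metis neg_neg comp_simps(1) \<open>\<gamma>' \<in> homs C F Z'\<close> h(4) homsD)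
    also have "\<dots> = Zer C D Z'" by (rule neg_unique[symmetric]) simp_all
    finally have "\<gamma>' = Zer C F Z'" using epiD_zero[OF conjunct2[OF a] h(4) z(1)] by simp
    then have "\<zeta> \<cdot> u = Zer C Q Z'" using z(3) by simp
    then have "u = Zer C Q Z" by (rule monoD_zero[OF z(4,2) u(1)])
    then have "b \<cdot> q1 = Zer C P Z" using u(2) by simp
    then show "b = Zer C B Z" using sq_ext[of b q1 "Zer C P Z" j1] bd(8) by simp
  qed
qed (fact pre)

end

section \<open>The heart\<close>

lemma full_subcat_op: "full_subcat (op C) D = op (full_subcat C D)"
  by (simp add: full_subcat_def op_def conj_commute)

lemma factors_through_op: "factors_through (op C) W A B = factors_through C W B A"
  by (auto simp: factors_through_def)

lemma quot_class_op: "quot_class (op C) W f = quot_class C W f"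
  by (simp add: quot_class_def factors_through_op)

lemma quotient_cat_op: "quotient_cat (op C) W = op (quotient_cat C W)"
proof -
  have "(\<Union>g \<in> G. \<Union>f \<in> F. quot_class C W (f \<cdot>\<^bsub>C\<^esub> g)) = (\<Union>f \<in> F. \<Union>g \<in> G. quot_class C W (f \<cdot>\<^bsub>C\<^esub> g))" for F G
    by blast
  thus ?thesis by (simp add: quotient_cat_def quot_class_op) (simp add: op_def quot_class_op)
qed

context twin
begin

abbreviation \<H> where "\<H> \<equiv> heart C E S T U V"

definition heart_arr :: "'m \<Rightarrow> 'm set"
  where "heart_arr f = quot_class (full_subcat C H) W f"

text \<open>
  The heart of the opposite twin cotorsion pair is the opposite heart on the nose, so results about
  one can be read as results about the other without a comparison functor.
\<close>

lemma heart_op: "heart (op C) (op_seqs E) V U T S = op \<H>"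
  by (simp add: heart_def full_subcat_op quotient_cat_op twin_core_def Int_commute)

lemma homs_full: "homs (full_subcat C H) A B = {f \<in> homs C A B. A \<in> H \<and> B \<in> H}"
  by (auto simp: homs_def full_subcat_def)

lemma factors_through_heart:
  assumes "A \<in> H" "B \<in> H"
  shows "factors_through (full_subcat C H) W A B = {f \<in> homs C A B. null f}"
proof (intro equalityI subsetI)
  fix f assume "f \<in> factors_through (full_subcat C H) W A B"
  then obtain u v X where "f = v \<cdot> u" "X \<in> W" "u \<in> homs C A X" "v \<in> homs C X B"
    unfolding factors_through_def homs_full by (auto simp: full_subcat_def)
  thus "f \<in> {f \<in> homs C A B. null f}" using nullI Comp_closed by blast
next
  fix f assume "f \<in> {f \<in> homs C A B. null f}"
  then obtain u v X where "f = v \<cdot> u" "X \<in> W" "u \<in> homs C A X" "v \<in> homs C X B"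
    using nullE by (metis mem_Collect_eq)
  moreover have "X \<in> H" using W_sub_H[OF \<open>X \<in> W\<close>] .
  ultimately show "f \<in> factors_through (full_subcat C H) W A B"
    unfolding factors_through_def homs_full using assms by (auto simp: full_subcat_def)
qed

lemma heart_arr_iff:
  assumes "f \<in> homs C A B" "A \<in> H" "B \<in> H"
  shows "g \<in> heart_arr f \<longleftrightarrow> g \<in> homs C A B \<and> null (g \<boxminus> f)"
proof -
  note [simp] = homsD[OF assms(1)]
  have c: "heart_arr f = {f \<boxplus> h | h. h \<in> homs C A B \<and> null h}"
    unfolding heart_arr_def quot_class_def using factors_through_heart[OF assms(2,3)]
    by (simp add: full_subcat_def)
  show ?thesis
  proof
    assume "g \<in> heart_arr f"
    then obtain h where h: "h \<in> homs C A B" "null h" "g = f \<boxplus> h" using c by blast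
    note [simp] = homsD[OF h(1)]
    have "h \<boxplus> f = g" unfolding h(3) by (rule plus_comm) simp_all
    then have "h = g \<boxminus> f" by (subst (asm) plus_eq_iff) (simp_all add: h(3))
    then show "g \<in> homs C A B \<and> null (g \<boxminus> f)" using h by (simp add: homs_iff)
  next
    assume g: "g \<in> homs C A B \<and> null (g \<boxminus> f)"
    note [simp] = homsD[OF conjunct1[OF g]]
    have "g = f \<boxplus> (g \<boxminus> f)" by (simp add: diff_plus)
    moreover have "g \<boxminus> f \<in> homs C A B" by (simp add: homs_iff)
    ultimately show "g \<in> heart_arr f" using c g by blast
  qed
qed

lemma null_diff_sym:
  assumes "f \<in> homs C A B" "g \<in> homs C A B" "null (f \<boxminus> g)"
  shows "null (g \<boxminus> f)"
proof -
  note [simp] = homsD[OF assms(1)] homsD[OF assms(2)]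
  have "g \<boxminus> f \<boxplus> (f \<boxminus> g) = Zer C A B"
  proof -
    have "(g \<boxminus> f) \<boxplus> (f \<boxminus> g) = (g \<boxminus> f) \<boxplus> (f \<boxplus> neg C g)" by (simp add: diff_def)
    also have "\<dots> = ((g \<boxminus> f) \<boxplus> f) \<boxplus> neg C g" by (rule plus_assoc[symmetric]) simp_all
    also have "\<dots> = Zer C A B" by (simp add: diff_plus plus_neg)
    finally show ?thesis .
  qed
  then have "f \<boxminus> g \<boxplus> (g \<boxminus> f) = Zer C A B" by (subst plus_comm) simp_all
  then have "g \<boxminus> f = neg C (f \<boxminus> g)" by (intro neg_unique) simp_all
  thus ?thesis using null_neg[OF assms(3), of A B] by (simp add: homs_iff)
qed

lemma null_diff_trans:
  assumes "f \<in> homs C A B" "g \<in> homs C A B" "h \<in> homs C A B" "null (f \<boxminus> g)" "null (g \<boxminus> h)"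
  shows "null (f \<boxminus> h)"
proof -
  note [simp] = homsD[OF assms(1)] homsD[OF assms(2)] homsD[OF assms(3)]
  have "((f \<boxminus> g) \<boxplus> (g \<boxminus> h)) \<boxplus> h = f"
    by (simp add: plus_assoc diff_plus)
  then have "(f \<boxminus> g) \<boxplus> (g \<boxminus> h) = f \<boxminus> h" by (subst (asm) plus_eq_iff) simp_all
  thus ?thesis using null_plus[OF assms(4,5), of A B] by (simp add: homs_iff)
qed

lemma heart_arr_eq:
  assumes "f \<in> homs C A B" "g \<in> homs C A B" "A \<in> H" "B \<in> H"
  shows "heart_arr f = heart_arr g \<longleftrightarrow> null (f \<boxminus> g)"
proof
  have "null (f \<boxminus> f)" using null_zer homsD[OF assms(1)] by simp
  then have "f \<in> heart_arr f" using heart_arr_iff[OF assms(1,3,4)] assms(1) by simp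
  then show "heart_arr f = heart_arr g \<Longrightarrow> null (f \<boxminus> g)" using heart_arr_iff[OF assms(2-4)] by simp
  assume n: "null (f \<boxminus> g)"
  note n' = null_diff_sym[OF assms(1,2) n]
  show "heart_arr f = heart_arr g"
    using null_diff_trans[OF _ assms(1,2) _ n] null_diff_trans[OF _ assms(2,1) _ n']
    by (auto simp: heart_arr_iff[OF assms(1,3,4)] heart_arr_iff[OF assms(2-4)])
qed

lemma heart_arr_self: "f \<in> homs C A B \<Longrightarrow> A \<in> H \<Longrightarrow> B \<in> H \<Longrightarrow> f \<in> heart_arr f"
  using heart_arr_iff[of f A B f] null_zer homsD[of f A B] by simp

lemma heart_simps:
  "Obj \<H> = H" "Arr \<H> = heart_arr ` {f \<in> Arr C. Dom C f \<in> H \<and> Cod C f \<in> H}"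
  "Ident \<H> A = heart_arr (Ident C A)" "Zer \<H> A B = heart_arr (Zer C A B)"
  "Dom \<H> F = the_elem (Dom C ` F)" "Cod \<H> F = the_elem (Cod C ` F)"
  "Comp \<H> G F = (\<Union>g \<in> G. \<Union>f \<in> F. heart_arr (g \<cdot> f))" "Plus \<H> G F = (\<Union>g \<in> G. \<Union>f \<in> F. heart_arr (g \<boxplus> f))"
  by (simp_all add: heart_def quotient_cat_def heart_arr_def) (simp_all add: full_subcat_def)

lemma heart_arr_Dom_Cod:
  assumes "f \<in> homs C A B" "A \<in> H" "B \<in> H"
  shows "Dom \<H> (heart_arr f) = A" "Cod \<H> (heart_arr f) = B"
proof -
  have "Dom C g = A" "Cod C g = B" if "g \<in> heart_arr f" for g
    using that heart_arr_iff[OF assms] homsD(2,3)[of g A B] by simp_all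
  then have "Dom C ` heart_arr f = {A}" "Cod C ` heart_arr f = {B}"
    using heart_arr_self[OF assms] by force+
  thus "Dom \<H> (heart_arr f) = A" "Cod \<H> (heart_arr f) = B" by (simp_all add: heart_simps)
qed

lemma Arr_heart:
  assumes "F \<in> Arr \<H>"
  obtains f A B where "f \<in> homs C A B" "A \<in> H" "B \<in> H" "F = heart_arr f"
proof -
  obtain f where f: "f \<in> Arr C" "Dom C f \<in> H" "Cod C f \<in> H" "F = heart_arr f"
    using assms unfolding heart_simps(2) by blast
  then have "f \<in> homs C (Dom C f) (Cod C f)" by (simp add: homs_iff)
  with f that show ?thesis by blast
qed

lemma homs_heart: "F \<in> homs \<H> A B \<longleftrightarrow> A \<in> H \<and> B \<in> H \<and> (\<exists>f \<in> homs C A B. F = heart_arr f)"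
proof
  assume F: "F \<in> homs \<H> A B"
  then have "F \<in> Arr \<H>" by (simp add: homs_def)
  then obtain f A' B' where f: "f \<in> homs C A' B'" "A' \<in> H" "B' \<in> H" "F = heart_arr f" by (rule Arr_heart)
  moreover have "A' = A" "B' = B" using heart_arr_Dom_Cod[OF f(1-3)] F f(4) by (simp_all add: homs_def)
  ultimately show "A \<in> H \<and> B \<in> H \<and> (\<exists>f \<in> homs C A B. F = heart_arr f)" by blast
next
  assume "A \<in> H \<and> B \<in> H \<and> (\<exists>f \<in> homs C A B. F = heart_arr f)"
  then obtain f where f: "A \<in> H" "B \<in> H" "f \<in> homs C A B" "F = heart_arr f" by blast
  then show "F \<in> homs \<H> A B"
    using heart_arr_Dom_Cod[OF f(3,1,2)] homsD[OF f(3)] by (auto simp: homs_iff heart_simps(2))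
qed

lemma homs_heartE:
  assumes "F \<in> homs \<H> A B"
  obtains f where "f \<in> homs C A B" "F = heart_arr f" "A \<in> H" "B \<in> H"
  using assms unfolding homs_heart by blast

lemma heart_arr_hom: "f \<in> homs C A B \<Longrightarrow> A \<in> H \<Longrightarrow> B \<in> H \<Longrightarrow> heart_arr f \<in> homs \<H> A B"
  by (auto simp: homs_heart)

lemma comp_heart:
  assumes f: "f \<in> homs C A B" and g: "g \<in> homs C B D" and H: "A \<in> H" "B \<in> H" "D \<in> H"
  shows "Comp \<H> (heart_arr g) (heart_arr f) = heart_arr (g \<cdot> f)"
proof -
  note [simp] = homsD[OF f] homsD[OF g]
  have "heart_arr (g' \<cdot> f') = heart_arr (g \<cdot> f)" if "g' \<in> heart_arr g" "f' \<in> heart_arr f" for g' f'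
  proof -
    have f': "f' \<in> homs C A B" "null (f' \<boxminus> f)" and g': "g' \<in> homs C B D" "null (g' \<boxminus> g)"
      using that heart_arr_iff[OF f H(1,2)] heart_arr_iff[OF g H(2,3)] by auto
    note [simp] = homsD[OF f'(1)] homsD[OF g'(1)]
    have "null (g' \<cdot> (f' \<boxminus> f))" by (rule null_comp(1)[OF f'(2) _ g'(1), of A]) (simp add: homs_iff)
    then have 1: "null (g' \<cdot> f' \<boxminus> g' \<cdot> f)" by (simp add: comp_diff_right)
    have "null ((g' \<boxminus> g) \<cdot> f)" by (rule null_comp(2)[OF g'(2) _ f, of D]) (simp add: homs_iff)
    then have 2: "null (g' \<cdot> f \<boxminus> g \<cdot> f)" by (simp add: comp_diff_left)
    have "null (g' \<cdot> f' \<boxminus> g \<cdot> f)"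
      by (rule null_diff_trans[OF _ _ _ 1 2, of A D]) (simp_all add: homs_iff)
    then show ?thesis by (subst heart_arr_eq[of _ A D]) (simp_all add: homs_iff H[simplified])
  qed
  then show ?thesis
    unfolding heart_simps using heart_arr_self[OF f H(1,2)] heart_arr_self[OF g H(2,3)] by blast
qed

lemma plus_heart:
  assumes f: "f \<in> homs C A B" and g: "g \<in> homs C A B" and H: "A \<in> H" "B \<in> H"
  shows "Plus \<H> (heart_arr f) (heart_arr g) = heart_arr (f \<boxplus> g)"
proof -
  note [simp] = homsD[OF f] homsD[OF g]
  have "heart_arr (f' \<boxplus> g') = heart_arr (f \<boxplus> g)" if "g' \<in> heart_arr g" "f' \<in> heart_arr f" for g' f'
  proof -
    have f': "f' \<in> homs C A B" "null (f' \<boxminus> f)" and g': "g' \<in> homs C A B" "null (g' \<boxminus> g)"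
      using that heart_arr_iff[OF f H(1,2)] heart_arr_iff[OF g H] by auto
    note [simp] = homsD[OF f'(1)] homsD[OF g'(1)]
    have "((f' \<boxminus> f) \<boxplus> (g' \<boxminus> g)) \<boxplus> (f \<boxplus> g) = ((f' \<boxminus> f) \<boxplus> f) \<boxplus> ((g' \<boxminus> g) \<boxplus> g)"
      by (simp only: plus_ac plus_simps diff_simps homsD[OF f'(1)] homsD[OF g'(1)] homsD[OF f] homsD[OF g])
    also have "\<dots> = f' \<boxplus> g'" by (simp add: diff_plus)
    finally have "(f' \<boxminus> f) \<boxplus> (g' \<boxminus> g) = (f' \<boxplus> g') \<boxminus> (f \<boxplus> g)" by (subst (asm) plus_eq_iff) simp_all
    then have "null ((f' \<boxplus> g') \<boxminus> (f \<boxplus> g))" using null_plus[OF f'(2) g'(2), of A B] by (simp add: homs_iff)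
    then show ?thesis by (subst heart_arr_eq[of _ A B]) (simp_all add: homs_iff H[simplified])
  qed
  then show ?thesis
    unfolding heart_simps using heart_arr_self[OF f H(1,2)] heart_arr_self[OF g H] by blast
qed

lemma comp_plus_heart:
  assumes F: "F \<in> homs \<H> X Y" and G: "G \<in> homs \<H> Y Z" and F': "F' \<in> homs \<H> Y Z"
  shows "Comp \<H> (Plus \<H> G F') F = Plus \<H> (Comp \<H> G F) (Comp \<H> F' F)"
proof -
  obtain f where f: "f \<in> homs C X Y" "F = heart_arr f" and H1: "X \<in> H" "Y \<in> H" by (rule homs_heartE[OF F])
  obtain g where g: "g \<in> homs C Y Z" "G = heart_arr g" and H2: "Z \<in> H" by (rule homs_heartE[OF G])
  obtain g' where g': "g' \<in> homs C Y Z" "F' = heart_arr g'" by (rule homs_heartE[OF F'])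
  note H = H1 H2
  have p: "g \<boxplus> g' \<in> homs C Y Z" using homsD[OF g(1)] homsD[OF g'(1)] by (simp add: homs_iff)
  show ?thesis
    unfolding f(2) g(2) g'(2) plus_heart[OF g(1) g'(1) H(2,3)] comp_heart[OF f(1) g(1) H] comp_heart[OF f(1) g'(1) H]
      comp_heart[OF f(1) p H] Comp_Plus_left[OF f(1) g(1) g'(1)]
    by (rule plus_heart[symmetric, OF Comp_closed[OF f(1) g(1)] Comp_closed[OF f(1) g'(1)] H(1,3)])
qed

lemma plus_comp_heart:
  assumes F: "F \<in> homs \<H> X Y" and F': "F' \<in> homs \<H> X Y" and G: "G \<in> homs \<H> Y Z"
  shows "Comp \<H> G (Plus \<H> F F') = Plus \<H> (Comp \<H> G F) (Comp \<H> G F')"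
proof -
  obtain f where f: "f \<in> homs C X Y" "F = heart_arr f" and H1: "X \<in> H" "Y \<in> H" by (rule homs_heartE[OF F])
  obtain g where g: "g \<in> homs C Y Z" "G = heart_arr g" and H2: "Z \<in> H" by (rule homs_heartE[OF G])
  obtain f' where f': "f' \<in> homs C X Y" "F' = heart_arr f'" by (rule homs_heartE[OF F'])
  note H = H1 H2
  have p: "f \<boxplus> f' \<in> homs C X Y" using homsD[OF f(1)] homsD[OF f'(1)] by (simp add: homs_iff)
  show ?thesis
    unfolding f(2) g(2) f'(2) plus_heart[OF f(1) f'(1) H(1,2)] comp_heart[OF f(1) g(1) H] comp_heart[OF f'(1) g(1) H]
      comp_heart[OF p g(1) H] Comp_Plus_right[OF f(1) f'(1) g(1)]
    by (rule plus_heart[symmetric, OF Comp_closed[OF f(1) g(1)] Comp_closed[OF f'(1) g(1)] H(1,3)])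
qed

lemma preadditive_heart: "preadditive_category \<H>"
proof -
  have 1: "Dom \<H> F \<in> Obj \<H>" "Cod \<H> F \<in> Obj \<H>" if "F \<in> Arr \<H>" for F
    using Arr_heart[OF that] heart_arr_Dom_Cod heart_simps(1) by metis+
  have ob: "A \<in> Obj C" if "A \<in> H" for A using that by (simp add: B_plus_def)
  have 2: "Ident \<H> A \<in> homs \<H> A A" if "A \<in> Obj \<H>" for A
    using that ob[of A] by (auto simp: heart_simps(1,3) intro!: heart_arr_hom Ident_closed)
  have 3: "Comp \<H> G F \<in> homs \<H> X Z'" if F: "F \<in> homs \<H> X Y" and G: "G \<in> homs \<H> Y Z'" for F G X Y Z'
  proof -
    obtain f where f: "f \<in> homs C X Y" "F = heart_arr f" and H1: "X \<in> H" "Y \<in> H" by (rule homs_heartE[OF F])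
    obtain g where g: "g \<in> homs C Y Z'" "G = heart_arr g" and H2: "Z' \<in> H" by (rule homs_heartE[OF G])
    show ?thesis unfolding f(2) g(2) comp_heart[OF f(1) g(1) H1 H2] by (rule heart_arr_hom[OF Comp_closed[OF f(1) g(1)] H1(1) H2])
  qed
  have 4: "Comp \<H> (Comp \<H> K G) F = Comp \<H> K (Comp \<H> G F)"
    if F: "F \<in> homs \<H> X Y" and G: "G \<in> homs \<H> Y Z'" and K: "K \<in> homs \<H> Z' W'" for F G K X Y Z' W'
  proof -
    obtain f where f: "f \<in> homs C X Y" "F = heart_arr f" and H1: "X \<in> H" "Y \<in> H" by (rule homs_heartE[OF F])
    obtain g where g: "g \<in> homs C Y Z'" "G = heart_arr g" by (rule homs_heartE[OF G])
    obtain k where k: "k \<in> homs C Z' W'" "K = heart_arr k" and H2: "Z' \<in> H" "W' \<in> H" by (rule homs_heartE[OF K])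
    note H = H1 H2
    show ?thesis
      unfolding f(2) g(2) k(2) comp_heart[OF f(1) g(1) H(1,2,3)] comp_heart[OF g(1) k(1) H(2,3,4)]
        comp_heart[OF f(1) Comp_closed[OF g(1) k(1)] H(1,2,4)] comp_heart[OF Comp_closed[OF f(1) g(1)] k(1) H(1,3,4)]
        Comp_assoc[OF f(1) g(1) k(1)] ..
  qed
  have 5: "Comp \<H> (Ident \<H> Y) F = F" "Comp \<H> F (Ident \<H> X) = F" if F: "F \<in> homs \<H> X Y" for F X Y
  proof -
    obtain f where f: "f \<in> homs C X Y" "F = heart_arr f" and H: "X \<in> H" "Y \<in> H" by (rule homs_heartE[OF F])
    show "Comp \<H> (Ident \<H> Y) F = F" "Comp \<H> F (Ident \<H> X) = F"
      using comp_heart[OF f(1) Ident_closed[OF ob[OF H(2)]] H H(2)] comp_heart[OF Ident_closed[OF ob[OF H(1)]] f(1) H(1) H]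
      by (simp_all only: heart_simps(3) f(2) Ident_left[OF f(1)] Ident_right[OF f(1)])
  qed
  have 6: "comm_group (hom_group \<H> A B)" if AB: "A \<in> Obj \<H>" "B \<in> Obj \<H>" for A B
  proof -
    have H: "A \<in> H" "B \<in> H" using AB by (simp_all add: heart_simps(1))
    have [simp]: "A \<in> Obj C" "B \<in> Obj C" using H ob by auto
    have z: "Zer C A B \<in> homs C A B" by (simp add: homs_iff)
    have p: "f \<boxplus> g \<in> homs C A B" if "f \<in> homs C A B" "g \<in> homs C A B" for f g
      using homsD[OF that(1)] homsD[OF that(2)] by (simp add: homs_iff)
    have car: "carrier (hom_group \<H> A B) = homs \<H> A B" "monoid.mult (hom_group \<H> A B) = Plus \<H>"
      "one (hom_group \<H> A B) = Zer \<H> A B"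
      by (simp_all add: hom_group_def)
    have comm: "Plus \<H> x y = Plus \<H> y x" if x: "x \<in> homs \<H> A B" and y: "y \<in> homs \<H> A B" for x y
    proof -
      obtain f where f: "f \<in> homs C A B" "x = heart_arr f" by (rule homs_heartE[OF x])
      obtain g where g: "g \<in> homs C A B" "y = heart_arr g" by (rule homs_heartE[OF y])
      have "f \<boxplus> g = g \<boxplus> f" using homsD[OF f(1)] homsD[OF g(1)] by (intro plus_comm) simp_all
      then show ?thesis unfolding f(2) g(2) plus_heart[OF f(1) g(1) H] plus_heart[OF g(1) f(1) H] by simp
    qed
    show ?thesis
    proof (rule comm_groupI; unfold car)
      fix x y assume x: "x \<in> homs \<H> A B" and y: "y \<in> homs \<H> A B"
      obtain f where f: "f \<in> homs C A B" "x = heart_arr f" by (rule homs_heartE[OF x])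
      obtain g where g: "g \<in> homs C A B" "y = heart_arr g" by (rule homs_heartE[OF y])
      show "Plus \<H> x y \<in> homs \<H> A B"
        unfolding f(2) g(2) plus_heart[OF f(1) g(1) H] by (rule heart_arr_hom[OF p[OF f(1) g(1)] H])
      show "Plus \<H> x y = Plus \<H> y x" by (rule comm[OF x y])
    next
      fix x y z assume x: "x \<in> homs \<H> A B" and y: "y \<in> homs \<H> A B" and z: "z \<in> homs \<H> A B"
      obtain f where f: "f \<in> homs C A B" "x = heart_arr f" by (rule homs_heartE[OF x])
      obtain g where g: "g \<in> homs C A B" "y = heart_arr g" by (rule homs_heartE[OF y])
      obtain k where k: "k \<in> homs C A B" "z = heart_arr k" by (rule homs_heartE[OF z])
      have "(f \<boxplus> g) \<boxplus> k = f \<boxplus> (g \<boxplus> k)"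
        using homsD[OF f(1)] homsD[OF g(1)] homsD[OF k(1)] by (intro plus_assoc) simp_all
      then show "Plus \<H> (Plus \<H> x y) z = Plus \<H> x (Plus \<H> y z)"
        unfolding f(2) g(2) k(2) plus_heart[OF f(1) g(1) H] plus_heart[OF g(1) k(1) H]
          plus_heart[OF p[OF f(1) g(1)] k(1) H] plus_heart[OF f(1) p[OF g(1) k(1)] H] by simp
    next
      show "Zer \<H> A B \<in> homs \<H> A B" unfolding heart_simps(4) by (rule heart_arr_hom[OF z H])
    next
      fix x assume x: "x \<in> homs \<H> A B"
      obtain f where f: "f \<in> homs C A B" "x = heart_arr f" by (rule homs_heartE[OF x])
      show "Plus \<H> (Zer \<H> A B) x = x"
        unfolding heart_simps(4) f(2) plus_heart[OF z f(1) H] using homsD[OF f(1)] by simp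
      have n: "neg C f \<in> homs C A B" using homsD[OF f(1)] by (simp add: homs_iff)
      have "f \<boxplus> neg C f = Zer C A B" using homsD[OF f(1)] by (simp add: plus_neg)
      then have "Plus \<H> x (heart_arr (neg C f)) = Zer \<H> A B"
        unfolding heart_simps(4) f(2) plus_heart[OF f(1) n H] by simp
      then show "\<exists>y \<in> homs \<H> A B. Plus \<H> y x = Zer \<H> A B"
        using heart_arr_hom[OF n H] comm[OF x heart_arr_hom[OF n H]] by auto
    qed
  qed
  show ?thesis
    by (rule preadditive_category.intro)
      (assumption | rule 1 2 3 4 5 6 comp_plus_heart plus_comp_heart)+
qed

lemma heart_arr_zero:
  assumes "f \<in> homs C A B" "A \<in> H" "B \<in> H"
  shows "heart_arr f = Zer \<H> A B \<longleftrightarrow> null f"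
proof -
  note [simp] = homsD[OF assms(1)]
  have "Zer C A B \<in> homs C A B" by (simp add: homs_iff)
  from heart_arr_eq[OF assms(1) this assms(2,3)] show ?thesis by (simp add: heart_simps(4))
qed

lemma additive_heart: "additive_category \<H>"
proof -
  interpret q: preadditive_category \<H> by (rule preadditive_heart)
  show ?thesis
  proof
    obtain Z where Z: "is_zero_object C Z" using ex_zero_object by blast
    have ZH: "Z \<in> H" using W_sub_H[OF W_nonempty[OF Z]] .
    have *: "(\<exists>!F. F \<in> homs \<H> A Z) \<and> (\<exists>!F. F \<in> homs \<H> Z A)" if A: "A \<in> H" for A
    proof -
      have "A \<in> Obj C" using A by (simp add: B_plus_def)
      then obtain f g where "\<And>h. h \<in> homs C A Z \<longleftrightarrow> h = f" "\<And>h. h \<in> homs C Z A \<longleftrightarrow> h = g"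
        using Z unfolding is_zero_object_def by metis
      then show ?thesis using A ZH by (auto simp: homs_heart)
    qed
    show "\<exists>Z. is_zero_object \<H> Z"
    proof (rule exI[of _ Z], unfold is_zero_object_def heart_simps(1), intro conjI ballI)
      show "Z \<in> H" by (rule ZH)
      show "\<exists>!F. F \<in> homs \<H> A Z" "\<exists>!F. F \<in> homs \<H> Z A" if "A \<in> H" for A
        using *[OF that] by (rule conjunct1, rule conjunct2)
    qed
    show "\<exists>X i1 i2 p1 p2. is_biproduct \<H> A B X i1 i2 p1 p2" if AB: "A \<in> Obj \<H>" "B \<in> Obj \<H>" for A B
    proof -
      have H: "A \<in> H" "B \<in> H" using AB by (simp_all add: heart_simps(1))
      then have "A \<in> Obj C" "B \<in> Obj C" by (simp_all add: B_plus_def)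
      then obtain X i1 i2 p1 p2 where b: "is_biproduct C A B X i1 i2 p1 p2" using ex_biproduct by blast
      note bd = biproductD[OF b] and X = H_biproduct[OF b H]
      have "is_biproduct \<H> A B X (heart_arr i1) (heart_arr i2) (heart_arr p1) (heart_arr p2)"
        unfolding is_biproduct_def
      proof (intro conjI)
        show "A \<in> Obj \<H>" "B \<in> Obj \<H>" "X \<in> Obj \<H>" using H X by (simp_all add: heart_simps(1))
        show "heart_arr i1 \<in> homs \<H> A X" "heart_arr i2 \<in> homs \<H> B X" "heart_arr p1 \<in> homs \<H> X A" "heart_arr p2 \<in> homs \<H> X B"
          by (rule heart_arr_hom; use bd H X in simp)+
        show "Comp \<H> (heart_arr p1) (heart_arr i1) = Ident \<H> A" "Comp \<H> (heart_arr p2) (heart_arr i2) = Ident \<H> B"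
          "Comp \<H> (heart_arr p2) (heart_arr i1) = Zer \<H> A B" "Comp \<H> (heart_arr p1) (heart_arr i2) = Zer \<H> B A"
          by (simp_all only: comp_heart[OF bd(4) bd(6) H(1) X H(1)] comp_heart[OF bd(5) bd(7) H(2) X H(2)]
              comp_heart[OF bd(4) bd(7) H(1) X H(2)] comp_heart[OF bd(5) bd(6) H(2) X H(1)] bd(8-11) heart_simps(3,4))
        show "Plus \<H> (Comp \<H> (heart_arr i1) (heart_arr p1)) (Comp \<H> (heart_arr i2) (heart_arr p2)) = Ident \<H> X"
          by (simp only: comp_heart[OF bd(6) bd(4) X H(1) X] comp_heart[OF bd(7) bd(5) X H(2) X]
              plus_heart[OF Comp_closed[OF bd(6,4)] Comp_closed[OF bd(7,5)] X X] bd(12) heart_simps(3))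
      qed
      then show ?thesis by blast
    qed
  qed
qed

lemma mono_heart:
  assumes "f \<in> homs C A B" "A \<in> H" "B \<in> H"
  shows "is_mono \<H> (heart_arr f) \<longleftrightarrow> heart_mono f"
proof
  interpret q: preadditive_category \<H> by (rule preadditive_heart)
  show "heart_mono f" if m: "is_mono \<H> (heart_arr f)"
    unfolding heart_mono_def
  proof (intro ballI impI)
    fix Z z assume Z: "Z \<in> H" and "z \<in> homs C Z (Dom C f)" and n: "null (f \<cdot> z)"
    then have z: "z \<in> homs C Z A" using homsD[OF assms(1)] by simp
    have "Comp \<H> (heart_arr f) (heart_arr z) = Zer \<H> Z B"
      using n by (simp add: comp_heart[OF z assms(1) Z assms(2,3)] heart_arr_zero[OF Comp_closed[OF z assms(1)] Z assms(3)])
    from q.monoD_zero[OF m heart_arr_hom[OF assms] heart_arr_hom[OF z Z assms(2)] this]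
    show "null z" using heart_arr_zero[OF z Z assms(2)] by simp
  qed
  show "is_mono \<H> (heart_arr f)" if m: "heart_mono f"
  proof (rule q.monoI_zero[OF heart_arr_hom[OF assms]])
    fix Z g assume g: "g \<in> homs \<H> Z A" "Comp \<H> (heart_arr f) g = Zer \<H> Z B"
    obtain z where z: "z \<in> homs C Z A" "g = heart_arr z" and Z: "Z \<in> H" by (rule homs_heartE[OF g(1)])
    have "null (f \<cdot> z)"
      using g(2) unfolding z(2) comp_heart[OF z(1) assms(1) Z assms(2,3)]
      by (simp add: heart_arr_zero[OF Comp_closed[OF z(1) assms(1)] Z assms(3)])
    from heart_monoD[OF m assms(1) Z z(1) this] show "g = Zer \<H> Z A"
      by (simp add: z(2) heart_arr_zero[OF z(1) Z assms(2)])
  qed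
qed

lemma cokernel_heart:
  assumes hc: "heart_cokernel g c" and g: "g \<in> homs C A B" and c: "c \<in> homs C B D" and H: "A \<in> H" "B \<in> H"
  shows "is_cokernel \<H> (heart_arr c) (heart_arr g)"
proof -
  note K = heart_cokernelD[OF hc g c]
  note D = heart_arr_Dom_Cod[OF g H] heart_arr_Dom_Cod[OF c H(2) K(1)]
  show ?thesis
    unfolding is_cokernel_def D
  proof (intro conjI allI ballI impI)
    show "heart_arr c \<in> Arr \<H>" "heart_arr g \<in> Arr \<H>" using heart_arr_hom[OF g H] heart_arr_hom[OF c H(2) K(1)] by (simp_all add: homs_def)
    show "Comp \<H> (heart_arr c) (heart_arr g) = Zer \<H> A D"
      using K(2) by (simp add: comp_heart[OF g c H K(1)] heart_arr_zero[OF Comp_closed[OF g c] H(1) K(1)])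
    fix Y h assume hQ: "h \<in> homs \<H> B Y" and n: "Comp \<H> h (heart_arr g) = Zer \<H> A Y"
    obtain h' where h: "h' \<in> homs C B Y" "h = heart_arr h'" and Y: "Y \<in> H" by (rule homs_heartE[OF hQ])
    have "null (h' \<cdot> g)"
      using n unfolding h(2) comp_heart[OF g h(1) H Y] by (simp add: heart_arr_zero[OF Comp_closed[OF g h(1)] H(1) Y])
    then obtain u where u: "u \<in> homs C D Y" "u \<cdot> c = h'" using K(3)[OF Y h(1)] by blast
    show "\<exists>!u. u \<in> homs \<H> D Y \<and> Comp \<H> u (heart_arr c) = h"
    proof (intro ex1I[of _ "heart_arr u"] conjI)
      show "heart_arr u \<in> homs \<H> D Y" by (rule heart_arr_hom[OF u(1) K(1) Y])
      show "Comp \<H> (heart_arr u) (heart_arr c) = h" by (simp add: comp_heart[OF c u(1) H(2) K(1) Y] u(2) h(2))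
      fix v assume v: "v \<in> homs \<H> D Y \<and> Comp \<H> v (heart_arr c) = h"
      obtain v' where v': "v' \<in> homs C D Y" "v = heart_arr v'" by (rule homs_heartE[OF conjunct1[OF v]])
      note [simp] = homsD[OF u(1)] homsD[OF v'(1)] homsD[OF c]
      have "heart_arr (v' \<cdot> c) = heart_arr (u \<cdot> c)" using v unfolding v'(2) comp_heart[OF c v'(1) H(2) K(1) Y] u(2) h(2) by simp
      then have "null (v' \<cdot> c \<boxminus> u \<cdot> c)"
        using heart_arr_eq[OF Comp_closed[OF c v'(1)] Comp_closed[OF c u(1)] H(2) Y] by simp
      then have "null ((v' \<boxminus> u) \<cdot> c)" by (simp add: comp_diff_left)
      then have "null (v' \<boxminus> u)" by (rule K(4)[OF Y, rotated]) (simp_all add: homs_iff)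
      then show "v = heart_arr u" unfolding v'(2) using heart_arr_eq[OF v'(1) u(1) K(1) Y] by simp
    qed
  qed (simp add: D)
qed

lemma cokernels_heart: "F \<in> Arr \<H> \<Longrightarrow> \<exists>c. is_cokernel \<H> c F"
proof -
  assume "F \<in> Arr \<H>"
  then obtain f A B where f: "f \<in> homs C A B" "A \<in> H" "B \<in> H" "F = heart_arr f" by (rule Arr_heart)
  obtain c where c: "c \<in> homs C B (Cod C c)" "heart_cokernel f c" using heart_cokernel_exists[OF f(2,3,1)] by blast
  from cokernel_heart[OF c(2) f(1) c(1) f(2,3)] show ?thesis unfolding f(4) by blast
qed

lemma preabelian_heart: "preabelian \<H>"
proof -
  interpret dual: twin "op C" "op_seqs E" V U T S by (rule twin_dual)
  have "\<exists>k. is_kernel \<H> k F" if "F \<in> Arr \<H>" for F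
    using dual.cokernels_heart[of F] that unfolding heart_op by simp
  thus ?thesis using cokernels_heart additive_heart by (simp add: preabelian_def)
qed

lemma integral_heart:
  assumes US: "U \<subseteq> ext_star C E S T"
  shows "integral \<H>"
proof -
  have amalg: "\<exists>F \<gamma> \<delta>. \<gamma> \<in> homs \<H> B F \<and> \<delta> \<in> homs \<H> D F \<and> Comp \<H> \<gamma> \<alpha> = Comp \<H> \<delta> \<beta> \<and> is_mono \<H> \<delta>"
    if h: "\<alpha> \<in> homs \<H> A B" "\<beta> \<in> homs \<H> A D" "is_mono \<H> \<alpha>" for \<alpha> \<beta> A B D
  proof -
    obtain a where a: "a \<in> homs C A B" "\<alpha> = heart_arr a" and H1: "A \<in> H" "B \<in> H" by (rule homs_heartE[OF h(1)])
    obtain b where b: "b \<in> homs C A D" "\<beta> = heart_arr b" and H2: "D \<in> H" by (rule homs_heartE[OF h(2)])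
    note H = H1 H2
    have "heart_mono a" using h(3) mono_heart[OF a(1) H(1,2)] a(2) by simp
    then obtain F c d where f: "F \<in> H" "c \<in> homs C B F" "d \<in> homs C D F" "heart_mono d" "null (c \<cdot> a \<boxminus> d \<cdot> b)"
      using amalgamation[OF US H a(1) _ b(1)] by blast
    have "Comp \<H> (heart_arr c) \<alpha> = Comp \<H> (heart_arr d) \<beta>"
      unfolding a(2) b(2) comp_heart[OF a(1) f(2) H(1,2) f(1)] comp_heart[OF b(1) f(3) H(1,3) f(1)]
      using heart_arr_eq[OF Comp_closed[OF a(1) f(2)] Comp_closed[OF b(1) f(3)] H(1) f(1)] f(5) by simp
    moreover have "is_mono \<H> (heart_arr d)" using mono_heart[OF f(3) H(3) f(1)] f(4) by simp
    ultimately show ?thesis using heart_arr_hom[OF f(2) H(2) f(1)] heart_arr_hom[OF f(3) H(3) f(1)] by blast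
  qed
  have image: "\<exists>P c i g. c \<in> homs \<H> X P \<and> i \<in> homs \<H> P Y \<and> Comp \<H> i c = F \<and> is_cokernel \<H> c g \<and> is_mono \<H> i"
    if F: "F \<in> homs \<H> X Y" for F X Y
  proof -
    obtain f where f: "f \<in> homs C X Y" "F = heart_arr f" and H: "X \<in> H" "Y \<in> H" by (rule homs_heartE[OF F])
    obtain A g P c i where *: "A \<in> H" "g \<in> homs C A X" "c \<in> homs C X P" "i \<in> homs C P Y" "i \<cdot> c = f"
      "heart_cokernel g c" "heart_mono i"
      by (rule heart_image[OF H f(1)])
    have P: "P \<in> H" by (rule heart_cokernelD(1)[OF *(6,2,3)])
    have "Comp \<H> (heart_arr i) (heart_arr c) = F" by (simp add: comp_heart[OF *(3,4) H(1) P H(2)] *(5) f(2))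
    moreover have "is_cokernel \<H> (heart_arr c) (heart_arr g)" by (rule cokernel_heart[OF *(6,2,3,1) H(1)])
    moreover have "is_mono \<H> (heart_arr i)" using mono_heart[OF *(4) P H(2)] *(7) by simp
    ultimately show ?thesis using heart_arr_hom[OF *(3) H(1) P] heart_arr_hom[OF *(4) P H(2)] by blast
  qed
  show ?thesis
    unfolding integral_def
    using additive_category.left_integralI[OF additive_heart preabelian_heart amalg image]
      additive_category.right_integralI[OF additive_heart preabelian_heart amalg] by (rule conjI)
qed

end

lemma ext_star_op: "ext_star (op C) (op_seqs E) X Y = ext_star C E Y X"
  by (auto simp: ext_star_def ses_op_nonempty)

theorem theorem6p2:
  fixes \<B> :: "('o, 'm) addcat" and E :: "('m \<times> 'm) set"
    and \<S> \<T> \<U> \<V> :: "'o set"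
  assumes "exact_category \<B> E"
    and "krull_schmidt \<B>"
    and "enough_projectives \<B> E"
    and "enough_injectives \<B> E"
    and "twin_cotorsion_pair \<B> E \<S> \<T> \<U> \<V>"
    and "(\<U> \<subseteq> ext_star \<B> E \<S> \<T> \<and> projectives \<B> E \<subseteq> twin_core \<T> \<U>) \<or>
         (\<T> \<subseteq> ext_star \<B> E \<U> \<V> \<and> injectives \<B> E \<subseteq> twin_core \<T> \<U>)"
  shows "integral (heart \<B> E \<S> \<T> \<U> \<V>)"
proof -
  interpret twin \<B> E \<S> \<T> \<U> \<V>
    unfolding twin_def twin_axioms_def
    using assms(1,5) cotorsion_pair_imp_cot[OF assms(1)] by (auto simp: twin_cotorsion_pair_def)
  interpret dual: twin "op \<B>" "op_seqs E" \<V> \<U> \<T> \<S> by (rule twin_dual)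
  show ?thesis
  proof (cases "\<U> \<subseteq> ext_star \<B> E \<S> \<T>")
    case True
    then show ?thesis by (rule integral_heart)
  next
    case False
    then have "\<T> \<subseteq> ext_star (op \<B>) (op_seqs E) \<V> \<U>" using assms(6) by (simp add: ext_star_op)
    from dual.integral_heart[OF this] show ?thesis unfolding heart_op by (simp add: integral_op)
  qed
qed

end
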